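(* Assume that $\mathbf f\in L^2(0,T;\mathbf H^{-1}_{b,l}(\Omega))$, $\mathbf g_s\in L^2(0,T;\mathbf H^{-1/2}(\Gamma_s))$, $\mathbf u_0\in\mathbf H$, and take $\mathbf f^{m+1}=\frac1k\int_{t_m}^{t_{m+1}}\mathbf f(t)\,dt$, $\mathbf g_s^{m+1}=\frac1k\int_{t_m}^{t_{m+1}}\mathbf g_s(t)\,dt$. Assume that $(\mathbf X_h,Q_h)$ satisfies the hydrostatic inf-sup condition: there is $\beta>0$ independent of $h$ such that for all $h>0$ $$\sup_{\mathbf v_h\in\mathbf X_h\setminus\{0\}}\frac{(q_h,\nabla_{\mathbf x}\cdot\langle\mathbf v_h\rangle)_S}{|\nabla_{\mathbf x}\mathbf v_h|+\|\partial_z\mathbf v_h\|_{L^3}}\ge\beta\|q_h\|_{L^2(S)}\qquad\forall q_h\in Q_h\setminus\{0\}.$$ If $(\mathbf u_h^0)_h$ is bounded in $\mathbf L^2(\Omega)$, then there is a constant $C>0$ independent of $k$ and $h$ such that the solution of the fully discrete scheme satisfies $$\|\mathbf u_h^{m+1}\|_{l^\infty(L^2)\cap l^2(H^1)}+\|\mathbf u_h^{m+1/2}\|_{l^\infty(L^2)\cap l^2(H^1)}\le C,$$ $$\|\mathbf u_h^{m+1}-\mathbf u_h^{m+1/2}\|_{l^2(L^2)}+\|\mathbf u_h^{m+1/2}-\mathbf u_h^m\|_{l^2(L^2)}\le C\,k^{1/2},$$ $$\|u_{3,h}^{m+1}\|_{l^2(H(\partial_z)\cap L^\infty_zL^2_{\mathbf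 x})}\le C.$$
   Context: Domain and operators. $S\subset\mathbb R^2$ is a bounded domain with polygonal boundary, $D:\overline S\to\mathbb R_+$ ($D>0$ in $S$) is continuous and piecewise affine, $\Omega=\{(\mathbf x,z):\mathbf x=(x,y)\in S,\ -D(\mathbf x)<z<0\}$, $\Gamma_s=\overline S\times\{0\}$, $\Gamma_b=\{(\mathbf x,-D(\mathbf x)):\mathbf x\in S\}$, $\Gamma_l=\{(\mathbf x,z):\mathbf x\in\partial S,\ -D(\mathbf x)<z<0\}$, $D_{\max}=\max D$. $\nabla_{\mathbf x}=(\partial_x,\partial_y)^t$, $\nabla=(\nabla_{\mathbf x},\partial_z)^t$, $\langle\mathbf v\rangle(\mathbf x)=\int_{-D(\mathbf x)}^0\mathbf v(\mathbf x,z)\,dz$. Norms and spaces. $|\cdot|$ and $(\cdot,\cdot)$ are the norm and scalar product of $L^2(\Omega)$; $(\cdot,\cdot)_S$ is the scalar product of $L^2(S)$; $\|v\|=|\nabla v|$ is used as the norm of $H^1_{b,l}(\Omega)=\{v\in H^1(\Omega): v|_{\Gamma_b\cup\Gamma_l}=0\}$. Boldface spaces are spaces of $\mathbb R^2$-valued functions. $\mathbf H^{-1}_{b,l}(\Omega)$ and $\mathbf H^{-1/2}(\Gamma_s)$ are the duals of $\mathbf H^1_{b,l}(\Omega)$ and $\mathbf H^{1/2}(\Gamma_s)$, with dualities $\langle\cdot,\cdot\rangle_\Omega$, $\langle\cdot,\cdot\rangle_{\Gamma_s}$. $\mathbf H=\{\mathbf v\in\mathbf L^2(\Omega):\nabla_{\mathbf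 x}\cdot\langle\mathbf v\rangle=0\text{ in }S,\ \langle\mathbf v\rangle\cdot\mathbf n_{\partial S}=0\}$. $H(\partial_z)=\{v\in L^2(\Omega):\partial_zv\in L^2(\Omega)\}$ with its graph norm; $H_0(\partial_z)=\{v\in H(\partial_z): v=0\text{ on }\Gamma_s\cup\Gamma_b\}$. $L_0^2(S)$ is the space of mean-zero functions in $L^2(S)$. $\|u\|_{L^q_zL^p_{\mathbf x}}$ is the $L^q(-D_{\max},0)$-norm of $z\mapsto\|u(\cdot,z)\|_{L^p(S_z)}$, $S_z=\{\mathbf x\in S:(\mathbf x,z)\in\Omega\}$. Trilinear form. For $\mathbf U=(\mathbf u,u_3)$, $$c(\mathbf U,\mathbf v,\mathbf w)=\int_\Omega\{(\mathbf U\cdot\nabla)\mathbf v\cdot\mathbf w+\tfrac12(\nabla\cdot\mathbf U)\,\mathbf v\cdot\mathbf w\}=-\int_\Omega\{(\mathbf U\cdot\nabla)\mathbf w\cdot\mathbf v+\tfrac12(\nabla\cdot\mathbf U)\,\mathbf v\cdot\mathbf w\}.$$ Discretization. $k=T/M$, $t_m=mk$. $\mathbf X_h\subset\mathbf H^1_{b,l}(\Omega)$, $Y_h\subset H_0(\partial_z)$, $Q_h\subset L^2_0(S)$ are finite element spaces built on a regular, quasi-uniform, vertically structured triangulation of $\Omega$ and the induced triangulation of $S$ (functions of $\mathbf X_h$ are globally continuous, those of $Y_h$ continuous in the vertical direction). Viscosity is $1$ and there is no Coriolis term. Scheme. Start from $\mathbf u_h^0\in\mathbf X_h$, an approximation of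 $\mathbf u_0$. For each $m$: Sub-step 0: find $u_{3,h}^m\in Y_h$ with $(\partial_zu_{3,h}^m,\partial_zy_h)=-(\nabla_{\mathbf x}\cdot\mathbf u_h^m,\partial_zy_h)$ for all $y_h\in Y_h$; set $\mathbf U_h^m=(\mathbf u_h^m,u_{3,h}^m)$. Sub-step 1: find $\mathbf u_h^{m+1/2}\in\mathbf X_h$ with $\frac1k(\mathbf u_h^{m+1/2}-\mathbf u_h^m,\mathbf v_h)+c(\mathbf U_h^m,\mathbf u_h^{m+1/2},\mathbf v_h)+(\nabla\mathbf u_h^{m+1/2},\nabla\mathbf v_h)=\langle\mathbf f^{m+1},\mathbf v_h\rangle_\Omega+\langle\mathbf g_s^{m+1},\mathbf v_h\rangle_{\Gamma_s}$ for all $\mathbf v_h\in\mathbf X_h$. Sub-step 2: find $(\mathbf u_h^{m+1},p_h^{m+1})\in\mathbf X_h\times Q_h$ with $\frac1k(\mathbf u_h^{m+1}-\mathbf u_h^{m+1/2},\mathbf v_h)+(\nabla(\mathbf u_h^{m+1}-\mathbf u_h^{m+1/2}),\nabla\mathbf v_h)-(p_h^{m+1},\nabla_{\mathbf x}\cdot\langle\mathbf v_h\rangle)_S=0$ and $(\nabla_{\mathbf x}\cdot\langle\mathbf u_h^{m+1}\rangle,q_h)_S=0$ for all $(\mathbf v_h,q_h)\in\mathbf X_h\times Q_h$. Discrete-in-time norms. For a family indexed by $m$ with values in a Banach space $X$, $\|\cdot\|_{l^2(X)}=(k\sum_m\|\cdot\|_X^2)^{1/2}$ and $\|\cdot\|_{l^\infty(X)}=\max_m\|\cdot\|_X$;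 here $m$ runs over $0,\dots,M-1$ in the quantities $\mathbf u_h^{m+1},\mathbf u_h^{m+1/2},\mathbf u_h^{m+1}-\mathbf u_h^{m+1/2},\mathbf u_h^{m+1/2}-\mathbf u_h^m,u_{3,h}^{m+1}$. A norm indexed by an intersection is the sum of the corresponding norms. *)

theory Defs
  imports "HOL-Analysis.Analysis" "HOL-Probability.Essential_Supremum"
begin

type_synonym pt2 = "real^2"
type_synonym pt3 = "(real^2) \<times> real"

section \<open>Lebesgue spaces and weak derivatives\<close>

text \<open>Elements of Lebesgue and Sobolev spaces on \<open>G\<close> are represented by functions on the whole
  type; only their values on \<open>G\<close> matter.\<close>

definition L2 :: "'a::euclidean_space set \<Rightarrow> ('a \<Rightarrow> 'b::euclidean_space) \<Rightarrow> bool" where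
  "L2 G v \<longleftrightarrow> v \<in> borel_measurable (lebesgue_on G)
            \<and> integrable (lebesgue_on G) (\<lambda>x. (norm (v x))\<^sup>2)"

definition L2_inner ::
  "'a::euclidean_space set \<Rightarrow> ('a \<Rightarrow> 'b::euclidean_space) \<Rightarrow> ('a \<Rightarrow> 'b) \<Rightarrow> real" where
  "L2_inner G v w = (LINT x|lebesgue_on G. v x \<bullet> w x)"

definition Lp_norm ::
  "real \<Rightarrow> 'a::euclidean_space set \<Rightarrow> ('a \<Rightarrow> 'b::euclidean_space) \<Rightarrow> real" where
  "Lp_norm p G v = (LINT x|lebesgue_on G. norm (v x) powr p) powr (1 / p)"

definition L2_norm :: "'a::euclidean_space set \<Rightarrow> ('a \<Rightarrow> 'b::euclidean_space) \<Rightarrow> real" where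
  "L2_norm G v = sqrt (LINT x|lebesgue_on G. (norm (v x))\<^sup>2)"

primrec C_k :: "nat \<Rightarrow> ('a::euclidean_space \<Rightarrow> real) \<Rightarrow> bool" where
  "C_k 0 \<phi> \<longleftrightarrow> continuous_on UNIV \<phi>"
| "C_k (Suc n) \<phi> \<longleftrightarrow> (\<forall>x. \<phi> differentiable (at x))
                   \<and> (\<forall>e\<in>Basis. C_k n (\<lambda>x. frechet_derivative \<phi> (at x) e))"

abbreviation pderiv_fun :: "'a::euclidean_space \<Rightarrow> ('a \<Rightarrow> real) \<Rightarrow> 'a \<Rightarrow> real" where
  "pderiv_fun e \<phi> x \<equiv> frechet_derivative \<phi> (at x) e"

definition fun_support :: "('a::euclidean_space \<Rightarrow> real) \<Rightarrow> 'a set" where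
  "fun_support \<phi> = closure {x. \<phi> x \<noteq> 0}"

definition test_functions :: "'a::euclidean_space set \<Rightarrow> ('a \<Rightarrow> real) set" where
  "test_functions G = {\<phi>. (\<forall>n. C_k n \<phi>) \<and> compact (fun_support \<phi>) \<and> fun_support \<phi> \<subseteq> G}"

definition locally_integrable ::
  "'a::euclidean_space set \<Rightarrow> ('a \<Rightarrow> 'b::euclidean_space) \<Rightarrow> bool" where
  "locally_integrable G v \<longleftrightarrow> (\<forall>K. compact K \<and> K \<subseteq> G \<longrightarrow> integrable (lebesgue_on K) v)"

definition has_weak_deriv ::
  "'a::euclidean_space set \<Rightarrow> 'a \<Rightarrow> ('a \<Rightarrow> 'b::euclidean_space) \<Rightarrow> ('a \<Rightarrow> 'b) \<Rightarrow> bool" where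
  "has_weak_deriv G e v g \<longleftrightarrow> locally_integrable G v \<and> locally_integrable G g
     \<and> (\<forall>\<phi>\<in>test_functions G.
          (LINT x|lebesgue_on G. pderiv_fun e \<phi> x *\<^sub>R v x) = - (LINT x|lebesgue_on G. \<phi> x *\<^sub>R g x))"

text \<open>A representative of the weak derivative, which is unique up to null sets.\<close>

definition wderiv ::
  "'a::euclidean_space set \<Rightarrow> 'a \<Rightarrow> ('a \<Rightarrow> 'b::euclidean_space) \<Rightarrow> 'a \<Rightarrow> 'b" where
  "wderiv G e v = (SOME g. has_weak_deriv G e v g)"

definition has_L2_deriv ::
  "'a::euclidean_space set \<Rightarrow> 'a \<Rightarrow> ('a \<Rightarrow> 'b::euclidean_space) \<Rightarrow> bool" where
  "has_L2_deriv G e v \<longleftrightarrow> (\<exists>g. has_weak_deriv G e v g \<and> L2 G g)"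

definition wdiv :: "'a::euclidean_space set \<Rightarrow> ('a \<Rightarrow> 'a) \<Rightarrow> 'a \<Rightarrow> real" where
  "wdiv G w x = (\<Sum>e\<in>Basis. wderiv G e (\<lambda>y. w y \<bullet> e) x)"

definition H1 :: "'a::euclidean_space set \<Rightarrow> ('a \<Rightarrow> 'b::euclidean_space) \<Rightarrow> bool" where
  "H1 G v \<longleftrightarrow> L2 G v \<and> (\<forall>e\<in>Basis. has_L2_deriv G e v)"

definition grad_inner ::
  "'a::euclidean_space set \<Rightarrow> ('a \<Rightarrow> 'b::euclidean_space) \<Rightarrow> ('a \<Rightarrow> 'b) \<Rightarrow> real" where
  "grad_inner G v w = (\<Sum>e\<in>Basis. L2_inner G (wderiv G e v) (wderiv G e w))"

definition grad_norm :: "'a::euclidean_space set \<Rightarrow> ('a \<Rightarrow> 'b::euclidean_space) \<Rightarrow> real" where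
  "grad_norm G v = sqrt (\<Sum>e\<in>Basis. (L2_norm G (wderiv G e v))\<^sup>2)"


section \<open>The domain\<close>

text \<open>The condition \<open>interior (closure S) = S\<close> excludes slits: \<open>S\<close> lies on one side of each
  boundary edge.\<close>

definition polygonal_domain :: "pt2 set \<Rightarrow> bool" where
  "polygonal_domain S \<longleftrightarrow> open S \<and> connected S \<and> S \<noteq> {} \<and> bounded S \<and> interior (closure S) = S
     \<and> (\<exists>E. finite E \<and> frontier S = (\<Union>(a, b)\<in>E. closed_segment a b))"

definition piecewise_affine_on :: "pt2 set \<Rightarrow> (pt2 \<Rightarrow> real) \<Rightarrow> bool" where
  "piecewise_affine_on A D \<longleftrightarrow> (\<exists>\<P>. finite \<P> \<and> \<Union>\<P> = A
     \<and> (\<forall>P\<in>\<P>. polytope P \<and> (\<exists>a c. \<forall>x\<in>P. D x = a \<bullet> x + c)))"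

definition depth_function :: "pt2 set \<Rightarrow> (pt2 \<Rightarrow> real) \<Rightarrow> bool" where
  "depth_function S D \<longleftrightarrow> continuous_on (closure S) D \<and> piecewise_affine_on (closure S) D
     \<and> (\<forall>x\<in>closure S. D x \<ge> 0) \<and> (\<forall>x\<in>S. D x > 0)"

definition Omega :: "pt2 set \<Rightarrow> (pt2 \<Rightarrow> real) \<Rightarrow> pt3 set" where
  "Omega S D = {(x, z). x \<in> S \<and> - D x < z \<and> z < 0}"

definition Gamma_s :: "pt2 set \<Rightarrow> pt3 set" where
  "Gamma_s S = closure S \<times> {0}"

definition D_max :: "pt2 set \<Rightarrow> (pt2 \<Rightarrow> real) \<Rightarrow> real" where
  "D_max S D = Sup (D ` closure S)"

definition slice :: "pt2 set \<Rightarrow> (pt2 \<Rightarrow> real) \<Rightarrow> real \<Rightarrow> pt2 set" where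
  "slice S D z = {x \<in> S. (x, z) \<in> Omega S D}"

definition vint :: "(pt2 \<Rightarrow> real) \<Rightarrow> (pt3 \<Rightarrow> 'b::euclidean_space) \<Rightarrow> pt2 \<Rightarrow> 'b" where
  "vint D v x = (LINT z|lebesgue_on {- D x<..<0}. v (x, z))"

abbreviation e_z :: pt3 where "e_z \<equiv> (0, 1)"

abbreviation dz :: "pt2 set \<Rightarrow> (pt2 \<Rightarrow> real) \<Rightarrow> (pt3 \<Rightarrow> 'b::euclidean_space) \<Rightarrow> pt3 \<Rightarrow> 'b" where
  "dz S D \<equiv> wderiv (Omega S D) e_z"

text \<open>\<open>\<nabla>\<^sub>x \<cdot> u\<close> for a horizontal field on \<open>\<Omega>\<close>, and the norm \<open>|\<nabla>\<^sub>x v|\<close>.\<close>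

definition div_x :: "pt2 set \<Rightarrow> (pt2 \<Rightarrow> real) \<Rightarrow> (pt3 \<Rightarrow> pt2) \<Rightarrow> pt3 \<Rightarrow> real" where
  "div_x S D u p = (\<Sum>e\<in>Basis. wderiv (Omega S D) (e, 0) (\<lambda>q. u q \<bullet> e) p)"

definition grad_x_norm :: "pt2 set \<Rightarrow> (pt2 \<Rightarrow> real) \<Rightarrow> (pt3 \<Rightarrow> pt2) \<Rightarrow> real" where
  "grad_x_norm S D v = sqrt (\<Sum>e\<in>Basis. (L2_norm (Omega S D) (wderiv (Omega S D) (e, 0) v))\<^sup>2)"


section \<open>Function spaces with boundary conditions\<close>

text \<open>Boundary values are taken in the sense of Green's formula: for a test function \<open>\<phi>\<close>,
  \<open>\<integral>\<^sub>\<Omega> (v \<partial>\<^sub>e\<phi> + \<phi> \<partial>\<^sub>e v)\<close> is the boundary integral of \<open>v (n \<bullet> e) \<phi>\<close>. Letting \<open>\<phi>\<close> range over the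
  test functions that vanish near \<open>N\<close>, the following says that the trace \<open>v (n \<bullet> e)\<close> is zero on
  the part of the boundary outside \<open>N\<close>.\<close>

definition zero_trace_outside ::
  "pt2 set \<Rightarrow> (pt2 \<Rightarrow> real) \<Rightarrow> pt3 \<Rightarrow> pt3 set \<Rightarrow> (pt3 \<Rightarrow> 'b::euclidean_space) \<Rightarrow> bool" where
  "zero_trace_outside S D e N v \<longleftrightarrow> (\<forall>\<phi>\<in>test_functions UNIV. fun_support \<phi> \<inter> N = {} \<longrightarrow>
     (LINT p|lebesgue_on (Omega S D).
        pderiv_fun e \<phi> p *\<^sub>R v p + \<phi> p *\<^sub>R wderiv (Omega S D) e v p) = 0)"

text \<open>\<open>v = 0\<close> on \<open>\<Gamma>\<^sub>b \<union> \<Gamma>\<^sub>l\<close>, the boundary outside \<open>\<Gamma>\<^sub>s\<close>: here \<open>v (n \<bullet> e) = 0\<close> for every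
  direction \<open>e\<close>, that is \<open>v = 0\<close>.\<close>

definition H1_bl :: "pt2 set \<Rightarrow> (pt2 \<Rightarrow> real) \<Rightarrow> (pt3 \<Rightarrow> pt2) set" where
  "H1_bl S D = {v. H1 (Omega S D) v \<and> (\<forall>e\<in>Basis. zero_trace_outside S D e (Gamma_s S) v)}"

definition H_dz :: "pt2 set \<Rightarrow> (pt2 \<Rightarrow> real) \<Rightarrow> (pt3 \<Rightarrow> real) set" where
  "H_dz S D = {v. L2 (Omega S D) v \<and> has_L2_deriv (Omega S D) e_z v}"

definition H_dz_norm :: "pt2 set \<Rightarrow> (pt2 \<Rightarrow> real) \<Rightarrow> (pt3 \<Rightarrow> real) \<Rightarrow> real" where
  "H_dz_norm S D v = sqrt ((L2_norm (Omega S D) v)\<^sup>2 + (L2_norm (Omega S D) (dz S D v))\<^sup>2)"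

text \<open>\<open>v n\<^sub>z = 0\<close> on the whole boundary, that is \<open>v = 0\<close> on \<open>\<Gamma>\<^sub>s \<union> \<Gamma>\<^sub>b\<close>, as \<open>n\<^sub>z\<close> vanishes
  exactly on \<open>\<Gamma>\<^sub>l\<close>.\<close>

definition H0_dz :: "pt2 set \<Rightarrow> (pt2 \<Rightarrow> real) \<Rightarrow> (pt3 \<Rightarrow> real) set" where
  "H0_dz S D = {v \<in> H_dz S D. zero_trace_outside S D e_z {} v}"

text \<open>The second condition is \<open>\<nabla>\<^sub>x \<cdot> \<langle>v\<rangle> = 0\<close> in \<open>S\<close> in the sense of distributions; given it, the
  third one is \<open>\<langle>v\<rangle> \<cdot> n = 0\<close> on \<open>\<partial>S\<close>, again in the sense of Green's formula.\<close>

definition H_space :: "pt2 set \<Rightarrow> (pt2 \<Rightarrow> real) \<Rightarrow> (pt3 \<Rightarrow> pt2) set" where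
  "H_space S D = {v. L2 (Omega S D) v
     \<and> (\<forall>\<phi>\<in>test_functions S.
          (LINT x|lebesgue_on S. (\<Sum>e\<in>Basis. (vint D v x \<bullet> e) * pderiv_fun e \<phi> x)) = 0)
     \<and> (\<forall>\<phi>\<in>test_functions UNIV.
          (LINT x|lebesgue_on S. (\<Sum>e\<in>Basis. (vint D v x \<bullet> e) * pderiv_fun e \<phi> x)) = 0)}"

definition L2_0 :: "pt2 set \<Rightarrow> (pt2 \<Rightarrow> real) set" where
  "L2_0 S = {q. L2 S q \<and> (LINT x|lebesgue_on S. q x) = 0}"

text \<open>\<open>H\<^sup>1\<^sup>/\<^sup>2(\<Gamma>\<^sub>s)\<close> with the Sobolev-Slobodeckij norm, \<open>\<Gamma>\<^sub>s\<close> being identified with \<open>S\<close>.\<close>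

definition H12 :: "pt2 set \<Rightarrow> (pt2 \<Rightarrow> pt2) set" where
  "H12 S = {g. L2 S g \<and> integrable (lebesgue_on (S \<times> S))
                 (\<lambda>(x, y). (norm (g x - g y))\<^sup>2 / norm (x - y) ^ 3)}"

definition H12_norm :: "pt2 set \<Rightarrow> (pt2 \<Rightarrow> pt2) \<Rightarrow> real" where
  "H12_norm S g = sqrt ((L2_norm S g)\<^sup>2
     + (LINT (x, y)|lebesgue_on (S \<times> S). (norm (g x - g y))\<^sup>2 / norm (x - y) ^ 3))"

text \<open>\<open>L\<^sup>\<infinity>\<close> in \<open>z\<close> with values in \<open>L\<^sup>2\<close> in \<open>x\<close>.\<close>

definition LinfL2_norm_ereal :: "pt2 set \<Rightarrow> (pt2 \<Rightarrow> real) \<Rightarrow> (pt3 \<Rightarrow> real) \<Rightarrow> ereal" where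
  "LinfL2_norm_ereal S D u = esssup (lebesgue_on {- D_max S D<..<0})
     (\<lambda>z. ereal (L2_norm (slice S D z) (\<lambda>x. u (x, z))))"

definition LinfL2 :: "pt2 set \<Rightarrow> (pt2 \<Rightarrow> real) \<Rightarrow> (pt3 \<Rightarrow> real) set" where
  "LinfL2 S D = {u. u \<in> borel_measurable (lebesgue_on (Omega S D))
     \<and> (AE z in lebesgue_on {- D_max S D<..<0}. L2 (slice S D z) (\<lambda>x. u (x, z)))
     \<and> LinfL2_norm_ereal S D u < \<infinity>}"

definition LinfL2_norm :: "pt2 set \<Rightarrow> (pt2 \<Rightarrow> real) \<Rightarrow> (pt3 \<Rightarrow> real) \<Rightarrow> real" where
  "LinfL2_norm S D u = real_of_ereal (LinfL2_norm_ereal S D u)"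


section \<open>Dual spaces and Bochner spaces of dual-valued functions\<close>

text \<open>\<open>V\<close> is a space of functions with (semi)norm \<open>nrm\<close>. A bounded functional takes the same value
  on functions whose difference has norm zero, hence on almost everywhere equal functions.\<close>

definition dual_space ::
  "('a \<Rightarrow> 'b::real_vector) set \<Rightarrow> (('a \<Rightarrow> 'b) \<Rightarrow> real) \<Rightarrow> (('a \<Rightarrow> 'b) \<Rightarrow> real) set" where
  "dual_space V nrm = {F.
     (\<forall>v\<in>V. \<forall>w\<in>V. \<forall>a b. F (\<lambda>x. a *\<^sub>R v x + b *\<^sub>R w x) = a * F v + b * F w)
     \<and> (\<exists>B. \<forall>v\<in>V. \<bar>F v\<bar> \<le> B * nrm v)}"

definition dual_norm ::
  "('a \<Rightarrow> 'b::real_vector) set \<Rightarrow> (('a \<Rightarrow> 'b) \<Rightarrow> real) \<Rightarrow> (('a \<Rightarrow> 'b) \<Rightarrow> real) \<Rightarrow> real" where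
  "dual_norm V nrm F = (SUP v\<in>{v\<in>V. nrm v \<le> 1}. \<bar>F v\<bar>)"

text \<open>\<open>L\<^sup>2(0,T;V')\<close>: Bochner measurable, with square integrable norm.\<close>

definition L2_time_dual ::
  "real \<Rightarrow> ('a \<Rightarrow> 'b::real_vector) set \<Rightarrow> (('a \<Rightarrow> 'b) \<Rightarrow> real) \<Rightarrow> (real \<Rightarrow> ('a \<Rightarrow> 'b) \<Rightarrow> real) set"
  where
  "L2_time_dual T V nrm = {f.
     (AE t in lebesgue_on {0..T}. f t \<in> dual_space V nrm)
     \<and> (\<exists>s :: nat \<Rightarrow> real \<Rightarrow> ('a \<Rightarrow> 'b) \<Rightarrow> real.
          (\<forall>n. simple_function (lebesgue_on {0..T}) (s n) \<and> (\<forall>t. s n t \<in> dual_space V nrm))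
          \<and> (AE t in lebesgue_on {0..T}.
               (\<lambda>n. dual_norm V nrm (\<lambda>v. s n t v - f t v)) \<longlonglongrightarrow> 0))
     \<and> integrable (lebesgue_on {0..T}) (\<lambda>t. (dual_norm V nrm (f t))\<^sup>2)}"

text \<open>The mean over \<open>(m k, (m + 1) k)\<close>; evaluation at \<open>v\<close> commutes with the Bochner integral.\<close>

definition time_mean :: "real \<Rightarrow> (real \<Rightarrow> 'c \<Rightarrow> real) \<Rightarrow> nat \<Rightarrow> 'c \<Rightarrow> real" where
  "time_mean k f m v = (1 / k) * (LINT t|lebesgue_on {real m * k..real (Suc m) * k}. f t v)"


section \<open>Meshes and finite element spaces\<close>

definition simplicial_mesh :: "'a::euclidean_space set \<Rightarrow> 'a set set \<Rightarrow> bool" where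
  "simplicial_mesh A \<T> \<longleftrightarrow> triangulation \<T> \<and> (\<forall>K\<in>\<T>. int DIM('a) simplex K) \<and> \<Union>\<T> = closure A"

definition surface_mesh :: "pt3 set set \<Rightarrow> pt2 set set" where
  "surface_mesh \<T> = {t. 2 simplex t \<and> (\<exists>K\<in>\<T>. (t \<times> {0}) face_of K)}"

text \<open>The elements form vertical columns: each one has its vertices on the vertical lines through
  the vertices of one surface triangle.\<close>

definition vertically_structured :: "pt3 set set \<Rightarrow> bool" where
  "vertically_structured \<T> \<longleftrightarrow> (\<forall>K\<in>\<T>. \<exists>t\<in>surface_mesh \<T>.
     fst ` {p. p extreme_point_of K} \<subseteq> {x. x extreme_point_of t})"

text \<open>\<open>\<H>\<close> is the set of mesh sizes of the family.\<close>

definition mesh_family :: "pt2 set \<Rightarrow> (pt2 \<Rightarrow> real) \<Rightarrow> real set \<Rightarrow> (real \<Rightarrow> pt3 set set) \<Rightarrow> bool" where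
  "mesh_family S D \<H> \<T> \<longleftrightarrow>
     (\<forall>h\<in>\<H>. h > 0 \<and> simplicial_mesh (Omega S D) (\<T> h) \<and> vertically_structured (\<T> h)
            \<and> h = Max (diameter ` \<T> h))
     \<and> (\<exists>\<sigma>. \<forall>h\<in>\<H>. \<forall>K\<in>\<T> h. \<exists>c r. r > 0 \<and> cball c r \<subseteq> K \<and> diameter K \<le> \<sigma> * r)
     \<and> (\<exists>\<tau>>0. \<forall>h\<in>\<H>. \<forall>K\<in>\<T> h. \<tau> * h \<le> diameter K)"

definition finite_dim_space :: "('a \<Rightarrow> 'b::real_vector) set \<Rightarrow> bool" where
  "finite_dim_space X \<longleftrightarrow>
     (\<exists>n (B :: nat \<Rightarrow> 'a \<Rightarrow> 'b). X = {(\<lambda>x. \<Sum>i<n. c i *\<^sub>R B i x) |c. True})"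

definition piecewise_polynomial ::
  "'a::euclidean_space set set \<Rightarrow> ('a \<Rightarrow> 'b::euclidean_space) \<Rightarrow> bool" where
  "piecewise_polynomial \<T> v \<longleftrightarrow>
     (\<forall>K\<in>\<T>. \<exists>P. polynomial_function P \<and> (\<forall>x\<in>interior K. v x = P x))"

definition fe_velocity_space ::
  "pt2 set \<Rightarrow> (pt2 \<Rightarrow> real) \<Rightarrow> pt3 set set \<Rightarrow> (pt3 \<Rightarrow> pt2) set \<Rightarrow> bool" where
  "fe_velocity_space S D \<T> X \<longleftrightarrow> finite_dim_space X \<and> X \<subseteq> H1_bl S D
     \<and> (\<forall>v\<in>X. piecewise_polynomial \<T> v \<and> continuous_on (closure (Omega S D)) v)"

text \<open>Vertical continuity is required along the lines that avoid the vertical faces of the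
  columns: functions of this space may jump across those faces.\<close>

definition fe_vertical_space ::
  "pt2 set \<Rightarrow> (pt2 \<Rightarrow> real) \<Rightarrow> pt3 set set \<Rightarrow> (pt3 \<Rightarrow> real) set \<Rightarrow> bool" where
  "fe_vertical_space S D \<T> Y \<longleftrightarrow> finite_dim_space Y \<and> Y \<subseteq> H0_dz S D
     \<and> (\<forall>y\<in>Y. piecewise_polynomial \<T> y
           \<and> (\<forall>t\<in>surface_mesh \<T>. \<forall>x\<in>interior t. continuous_on {- D x..0} (\<lambda>z. y (x, z))))"

definition fe_pressure_space :: "pt2 set \<Rightarrow> pt3 set set \<Rightarrow> (pt2 \<Rightarrow> real) set \<Rightarrow> bool" where
  "fe_pressure_space S \<T> Q \<longleftrightarrow> finite_dim_space Q \<and> Q \<subseteq> L2_0 S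
     \<and> (\<forall>q\<in>Q. piecewise_polynomial (surface_mesh \<T>) q)"

text \<open>The hydrostatic inf-sup condition with constant \<open>\<beta>\<close> for one pair of spaces. The supremum is
  taken in the extended reals; for the continuous functions of \<open>X\<close>, being nonzero means being
  nonzero at some point of \<open>\<Omega>\<close>.\<close>

definition hydrostatic_inf_sup ::
  "pt2 set \<Rightarrow> (pt2 \<Rightarrow> real) \<Rightarrow> real \<Rightarrow> (pt3 \<Rightarrow> pt2) set \<Rightarrow> (pt2 \<Rightarrow> real) set \<Rightarrow> bool" where
  "hydrostatic_inf_sup S D \<beta> X Q \<longleftrightarrow>
     (\<forall>q\<in>Q. \<not> (AE x in lebesgue_on S. q x = 0) \<longrightarrow>
        (SUP v\<in>{v\<in>X. \<exists>p\<in>Omega S D. v p \<noteq> 0}.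
           ereal (L2_inner S q (wdiv S (vint D v))
                  / (grad_x_norm S D v + Lp_norm 3 (Omega S D) (dz S D v))))
        \<ge> ereal (\<beta> * L2_norm S q))"


section \<open>The scheme\<close>

text \<open>\<open>c(U, v, w)\<close> for \<open>U = (u, u\<^sub>3)\<close>, whose component in the direction \<open>e\<close> is \<open>U \<bullet> e\<close>.\<close>

definition tri_form ::
  "pt2 set \<Rightarrow> (pt2 \<Rightarrow> real) \<Rightarrow> (pt3 \<Rightarrow> pt3) \<Rightarrow> (pt3 \<Rightarrow> pt2) \<Rightarrow> (pt3 \<Rightarrow> pt2) \<Rightarrow> real" where
  "tri_form S D U v w = (LINT p|lebesgue_on (Omega S D).
     (\<Sum>e\<in>Basis. (U p \<bullet> e) *\<^sub>R wderiv (Omega S D) e v p) \<bullet> w p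
     + 1 / 2 * wdiv (Omega S D) U p * (v p \<bullet> w p))"

definition substep0 ::
  "pt2 set \<Rightarrow> (pt2 \<Rightarrow> real) \<Rightarrow> (pt3 \<Rightarrow> real) set \<Rightarrow> (pt3 \<Rightarrow> pt2) \<Rightarrow> (pt3 \<Rightarrow> real) \<Rightarrow> bool" where
  "substep0 S D Y u u3 \<longleftrightarrow> u3 \<in> Y
     \<and> (\<forall>y\<in>Y. L2_inner (Omega S D) (dz S D u3) (dz S D y)
              = - L2_inner (Omega S D) (div_x S D u) (dz S D y))"

text \<open>\<open>F\<close> and \<open>G\<close> are the data \<open>f\<^sup>m\<^sup>+\<^sup>1\<close> and \<open>g\<^sub>s\<^sup>m\<^sup>+\<^sup>1\<close>, \<open>uh\<close> is \<open>u\<^sup>m\<^sup>+\<^sup>1\<^sup>/\<^sup>2\<close>. Test functions are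
  continuous up to the boundary, so their trace on \<open>\<Gamma>\<^sub>s\<close> is the restriction.\<close>

definition substep1 ::
  "pt2 set \<Rightarrow> (pt2 \<Rightarrow> real) \<Rightarrow> ((pt3 \<Rightarrow> pt2) \<Rightarrow> real) \<Rightarrow> ((pt2 \<Rightarrow> pt2) \<Rightarrow> real) \<Rightarrow> real
   \<Rightarrow> (pt3 \<Rightarrow> pt2) set \<Rightarrow> (pt3 \<Rightarrow> pt2) \<Rightarrow> (pt3 \<Rightarrow> real) \<Rightarrow> (pt3 \<Rightarrow> pt2) \<Rightarrow> bool" where
  "substep1 S D F G k X u u3 uh \<longleftrightarrow> uh \<in> X
     \<and> (\<forall>v\<in>X. (1 / k) * L2_inner (Omega S D) (\<lambda>p. uh p - u p) v
              + tri_form S D (\<lambda>p. (u p, u3 p)) uh v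
              + grad_inner (Omega S D) uh v
            = F v + G (\<lambda>x. v (x, 0)))"

definition substep2 ::
  "pt2 set \<Rightarrow> (pt2 \<Rightarrow> real) \<Rightarrow> real \<Rightarrow> (pt3 \<Rightarrow> pt2) set \<Rightarrow> (pt2 \<Rightarrow> real) set
   \<Rightarrow> (pt3 \<Rightarrow> pt2) \<Rightarrow> (pt3 \<Rightarrow> pt2) \<Rightarrow> (pt2 \<Rightarrow> real) \<Rightarrow> bool" where
  "substep2 S D k X Q uh u' p' \<longleftrightarrow> u' \<in> X \<and> p' \<in> Q
     \<and> (\<forall>v\<in>X. (1 / k) * L2_inner (Omega S D) (\<lambda>p. u' p - uh p) v
              + grad_inner (Omega S D) (\<lambda>p. u' p - uh p) v
              - L2_inner S p' (wdiv S (vint D v)) = 0)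
     \<and> (\<forall>q\<in>Q. L2_inner S (wdiv S (vint D u')) q = 0)"

text \<open>\<open>u m\<close>, \<open>u3 m\<close>, \<open>p m\<close> are the unknowns at time \<open>t\<^sub>m\<close>, and \<open>uh m\<close> is \<open>u\<^sup>m\<^sup>+\<^sup>1\<^sup>/\<^sup>2\<close>.\<close>

definition scheme_solution ::
  "pt2 set \<Rightarrow> (pt2 \<Rightarrow> real) \<Rightarrow> (real \<Rightarrow> (pt3 \<Rightarrow> pt2) \<Rightarrow> real) \<Rightarrow> (real \<Rightarrow> (pt2 \<Rightarrow> pt2) \<Rightarrow> real)
   \<Rightarrow> real \<Rightarrow> nat \<Rightarrow> (pt3 \<Rightarrow> pt2) set \<Rightarrow> (pt3 \<Rightarrow> real) set \<Rightarrow> (pt2 \<Rightarrow> real) set \<Rightarrow> (pt3 \<Rightarrow> pt2)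
   \<Rightarrow> (nat \<Rightarrow> pt3 \<Rightarrow> pt2) \<Rightarrow> (nat \<Rightarrow> pt3 \<Rightarrow> pt2) \<Rightarrow> (nat \<Rightarrow> pt3 \<Rightarrow> real) \<Rightarrow> (nat \<Rightarrow> pt2 \<Rightarrow> real) \<Rightarrow> bool"
  where
  "scheme_solution S D f gs k M X Y Q u_init u uh u3 p \<longleftrightarrow> u 0 = u_init
     \<and> (\<forall>m\<le>M. substep0 S D Y (u m) (u3 m))
     \<and> (\<forall>m<M. substep1 S D (time_mean k f m) (time_mean k gs m) k X (u m) (u3 m) (uh m)
            \<and> substep2 S D k X Q (uh m) (u (Suc m)) (p (Suc m)))"


section \<open>Discrete-in-time norms\<close>

definition l2_norm :: "real \<Rightarrow> nat \<Rightarrow> ('c \<Rightarrow> real) \<Rightarrow> (nat \<Rightarrow> 'c) \<Rightarrow> real" where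
  "l2_norm k M nrm w = sqrt (k * (\<Sum>m<M. (nrm (w m))\<^sup>2))"

definition linf_norm :: "nat \<Rightarrow> ('c \<Rightarrow> real) \<Rightarrow> (nat \<Rightarrow> 'c) \<Rightarrow> real" where
  "linf_norm M nrm w = (MAX m\<in>{..<M}. nrm (w m))"

end

theory Submission
  imports Defs
begin

text \<open>Testing sub-step 1 with \<open>u\<^sup>m\<^sup>+\<^sup>1\<^sup>/\<^sup>2\<close> and sub-step 2 with \<open>u\<^sup>m\<^sup>+\<^sup>1\<close> gives two energy identities in which the
  advection and the pressure drop out; their sum telescopes in \<open>m\<close>. Sub-step 0 tested with
  \<open>u\<^sub>3\<close> then bounds \<open>\<partial>\<^sub>z u\<^sub>3\<close> by the horizontal divergence.

  What remains are facts about functions with zero trace: \<open>c(U, v, v) = 0\<close>, the trace estimate from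
  \<open>H\<^sup>1\<close> to \<open>H\<^sup>1\<^sup>/\<^sup>2(\<Gamma>\<^sub>s)\<close>, and the \<open>L\<^sup>\<infinity>\<close> bound in \<open>z\<close>. All of them follow from one observation. The
  extension \<open>w\<close> of such a function by zero has the extension \<open>g\<close> of the weak derivative in direction \<open>e\<close>
  as weak derivative outside the closed set where the trace is free, so that
  \<open>w p - w (p - \<tau> e) = \<integral>\<^sub>0\<^sup>\<tau> g (p - t e) dt\<close> for almost every \<open>p\<close>. On a
  bounded domain the left-hand side becomes \<open>w p\<close> for large \<open>\<tau>\<close>. With such line integrals, integration
  by parts is Fubini's theorem, and Poincare's inequality is the Cauchy-Schwarz inequality.\<close>

section \<open>Smooth bump functions\<close>

text \<open>Boundary values are given by Green's formula against test functions supported away from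
  the surface. This says exactly that the zero extension has a weak derivative in the open lower
  half space, so neither a trace operator nor density of smooth functions enters. That half space is
  closed under backward steps in every coordinate direction, but under forward steps only in the
  horizontal ones: a velocity can be integrated up from the bottom, not down from the surface.
  Integration by parts needs one factor represented from each side. For \<open>c(U, v, v)\<close>
  this succeeds because each component of \<open>U\<close> is differentiated only in its own
  direction: the horizontal components use horizontal lines, and \<open>u3\<close> vanishes at the
  surface too. The factor \<open>|v|^2\<close> and its derivatives are square integrable because
  members of the velocity space are continuous up to the boundary, hence bounded. The final constant
  does not depend on \<open>k\<close>: averaging the data over one step costs
  \<open>k^(-1/2)\<close>, which enters squared and meets the factor \<open>k\<close> of the energy
  identity.\<close>

lemma C_k_continuous: "C_k n f \<Longrightarrow> continuous_on UNIV f"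
  by (cases n) (auto simp: differentiable_imp_continuous_on differentiable_on_def)

lemma C_k_SucD: "C_k (Suc n) f \<Longrightarrow> C_k n f"
proof (induction n arbitrary: f)
  case 0
  then show ?case using C_k_continuous[OF 0] by simp
next
  case (Suc n)
  then show ?case by (metis C_k.simps(2))
qed

text \<open>\<open>C_k\<close> is phrased with the chosen \<open>frechet_derivative\<close>; this
  rule admits any explicitly computed derivative in its place.\<close>

lemma C_k_SucI:
  assumes "\<And>x. (f has_derivative F x) (at x)" and "\<And>e. e \<in> Basis \<Longrightarrow> C_k n (\<lambda>x. F x e)"
  shows "C_k (Suc n) f"
proof -
  have "frechet_derivative f (at x) = F x" for x
    using frechet_derivative_at[OF assms(1)] by simp
  with assms show ?thesis by (auto simp: differentiable_def)
qed

lemma C_k_SucE: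
  assumes "C_k (Suc n) f"
  shows "(f has_derivative frechet_derivative f (at x)) (at x)"
    and "e \<in> Basis \<Longrightarrow> C_k n (\<lambda>x. frechet_derivative f (at x) e)"
  using assms by (auto simp: frechet_derivative_works)

lemma C_k_const [simp]: "C_k n (\<lambda>x. c)"
proof (induction n arbitrary: c)
  case (Suc n)
  then show ?case by (intro C_k_SucI[where F="\<lambda>x h. 0"]) auto
qed simp

lemma C_k_add: "C_k n f \<Longrightarrow> C_k n g \<Longrightarrow> C_k n (\<lambda>x. f x + g x)"
proof (induction n arbitrary: f g)
  case (Suc n)
  show ?case
    by (rule C_k_SucI[OF has_derivative_add[OF C_k_SucE(1)[OF Suc(2)] C_k_SucE(1)[OF Suc(3)]]])
       (intro Suc.IH C_k_SucE(2)[OF Suc(2)] C_k_SucE(2)[OF Suc(3)])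
qed (auto intro: continuous_on_add)

lemma C_k_mult: "C_k n f \<Longrightarrow> C_k n g \<Longrightarrow> C_k n (\<lambda>x. f x * g x)"
proof (induction n arbitrary: f g)
  case (Suc n)
  show ?case
    by (rule C_k_SucI[OF has_derivative_mult[OF C_k_SucE(1)[OF Suc(2)] C_k_SucE(1)[OF Suc(3)]]])
       (intro Suc.IH C_k_add C_k_SucE(2)[OF Suc(2)] C_k_SucE(2)[OF Suc(3)] C_k_SucD[OF Suc(2)]
          C_k_SucD[OF Suc(3)])
qed (auto intro: continuous_on_mult)

lemma C_k_prod:
  assumes "\<And>i. i \<in> I \<Longrightarrow> C_k n (f i)"
  shows "C_k n (\<lambda>x. \<Prod>i\<in>I. f i x)"
  using assms by (induction I rule: infinite_finite_induct) (auto intro: C_k_mult)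

text \<open>The one chain rule required: all bump functions are products of one-dimensional
  functions of affine functions of a single coordinate. Differentiating only replaces
  \<open>f\<close> by its derivative and adds a constant factor, so the induction runs over all
  \<open>f\<close>.\<close>

lemma C_k_affine:
  fixes f :: "real \<Rightarrow> real" and i :: "'a::euclidean_space"
  shows "C_k n f \<Longrightarrow> C_k n (\<lambda>x. f (\<alpha> * (x \<bullet> i) + \<beta>))"
proof (induction n arbitrary: f)
  case 0
  then show ?case
    by (auto intro!: continuous_intros continuous_on_compose2[of UNIV f])
next
  case (Suc n)
  let ?f' = "\<lambda>t. frechet_derivative f (at t) 1"
  have f': "(f has_derivative (\<lambda>h. h * ?f' t)) (at t)" for t
  proof -
    have d: "(f has_derivative frechet_derivative f (at t)) (at t)"
      by (rule C_k_SucE(1)[OF Suc(2)])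
    have "frechet_derivative f (at t) h = h * ?f' t" for h
      using linear_cmul[OF has_derivative_linear[OF d], of h 1] by simp
    then show ?thesis using d by (metis (no_types, lifting) ext)
  qed
  have "((\<lambda>x. f (\<alpha> * (x \<bullet> i) + \<beta>)) has_derivative (\<lambda>h. (\<alpha> * (h \<bullet> i)) * ?f' (\<alpha> * (x \<bullet> i) + \<beta>))) (at x)" for x
    by (rule has_derivative_compose[OF _ f']) (auto intro!: derivative_eq_intros)
  then show ?case
  proof (rule C_k_SucI)
    show "C_k n (\<lambda>x. (\<alpha> * (e \<bullet> i)) * ?f' (\<alpha> * (x \<bullet> i) + \<beta>))" for e
      by (intro C_k_mult C_k_const Suc.IH C_k_SucE(2)[OF Suc(2)]) simp
  qed
qed

lemma C_k_SucI_real: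
  fixes f :: "real \<Rightarrow> real"
  assumes "\<And>t. (f has_real_derivative f' t) (at t)" and "C_k n f'"
  shows "C_k (Suc n) f"
  by (rule C_k_SucI[OF assms(1)[unfolded has_field_derivative_def]])
     (use assms(2) in \<open>simp add: ac_simps\<close>)

text \<open>For \<open>j = 0\<close> this is the classical smooth function that is flat at the
  origin. The extra power makes the family closed under differentiation up to linear combinations,
  so smoothness of all members follows by one induction.\<close>

definition flat_exp :: "nat \<Rightarrow> real \<Rightarrow> real" where
  "flat_exp j t = (if t > 0 then (1 / t) ^ j * exp (- 1 / t) else 0)"

text \<open>In the variable \<open>1 / t\<close>, the exponential beats every power.\<close>

lemma flat_exp_tendsto_0: "(flat_exp j \<longlongrightarrow> 0) (at 0)"
proof -
  have "((\<lambda>t. (inverse t) ^ j / exp (inverse t)) \<longlongrightarrow> (0::real)) (at_right 0)"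
    by (rule filterlim_compose[OF tendsto_power_div_exp_0 filterlim_inverse_at_top_right])
  moreover have "\<forall>\<^sub>F t in at_right 0. (inverse t) ^ j / exp (inverse t) = flat_exp j t"
    using eventually_at_right_less[of "0::real"]
    by eventually_elim (simp add: flat_exp_def exp_minus field_simps)
  ultimately have "(flat_exp j \<longlongrightarrow> 0) (at_right 0)"
    by (rule Lim_transform_eventually)
  moreover have "(flat_exp j \<longlongrightarrow> 0) (at_left 0)"
    by (rule Lim_transform_eventually[OF tendsto_const])
       (auto simp: flat_exp_def eventually_at_left_field intro!: exI[of _ "-1"])
  ultimately show ?thesis by (simp add: filterlim_at_split)
qed

lemma flat_exp_deriv:
  "(flat_exp j has_real_derivative - real j * flat_exp (Suc j) t + flat_exp (j + 2) t) (at t)"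
proof (rule linorder_cases[of t 0])
  assume "t < 0"
  then have "(flat_exp j has_real_derivative 0) (at t)"
    by (intro has_field_derivative_transform_within_open[OF DERIV_const[of 0], where S="{..<0}"])
       (auto simp: flat_exp_def)
  with \<open>t < 0\<close> show ?thesis by (simp add: flat_exp_def)
next
  assume "t = 0"
  \<comment> \<open>The difference quotient of \<open>flat_exp j\<close> at 0 is
    \<open>flat_exp (Suc j)\<close>, whose limit is known.\<close>
  have "((\<lambda>h. (flat_exp j (0 + h) - flat_exp j 0) / h) \<longlongrightarrow> 0) (at 0)"
    by (rule Lim_transform_eventually[OF flat_exp_tendsto_0[of "Suc j"]])
       (auto simp: flat_exp_def eventually_at_filter field_simps)
  then have "(flat_exp j has_real_derivative 0) (at 0)" unfolding DERIV_def .
  with \<open>t = 0\<close> show ?thesis by (simp add: flat_exp_def)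
next
  assume t: "t > 0"
  have "((\<lambda>t. (1 / t) ^ j * exp (- 1 / t)) has_real_derivative
      - real j * flat_exp (Suc j) t + flat_exp (j + 2) t) (at t)"
  \<comment> \<open>The power rule produces the exponent \<open>j - 1\<close>, which is truncated
    for \<open>j = 0\<close>.\<close>
  proof (cases j)
    case (Suc i)
    show ?thesis using t unfolding Suc
      by (auto intro!: derivative_eq_intros simp: flat_exp_def field_simps power2_eq_square)
         (metis One_nat_def power_eq_if)
  qed (use t in \<open>auto intro!: derivative_eq_intros simp: flat_exp_def field_simps power2_eq_square\<close>)
  then show ?thesis
    by (rule has_field_derivative_transform_within_open[where S="{0<..}"]) (use t in \<open>auto simp: flat_exp_def\<close>)
qed

lemma C_k_flat_exp: "C_k n (flat_exp j)"
proof (induction n arbitrary: j)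
  case 0
  have "isCont (flat_exp j) t" for t using DERIV_isCont[OF flat_exp_deriv] .
  then show ?case by (simp add: continuous_on_eq_continuous_at)
next
  case (Suc n)
  show ?case by (rule C_k_SucI_real[OF flat_exp_deriv]) (intro C_k_add C_k_mult C_k_const Suc)
qed

text \<open>For \<open>n \<rightarrow> \<infinity>\<close> these functions increase to the indicator of the open interval \<open>(a, c)\<close>.\<close>

definition bump :: "real \<Rightarrow> real \<Rightarrow> nat \<Rightarrow> real \<Rightarrow> real" where
  "bump a c n t = flat_exp 0 (real (Suc n) * (t - a)) * flat_exp 0 (real (Suc n) * (c - t))"

lemma bump_nonneg: "0 \<le> bump a c n t" and bump_le_1: "bump a c n t \<le> 1"
  by (auto simp: bump_def flat_exp_def intro!: mult_le_one)

lemma bump_eq_0: "t \<le> a \<or> c \<le> t \<Longrightarrow> bump a c n t = 0"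
  by (auto simp: bump_def flat_exp_def mult_le_0_iff zero_less_mult_iff)

lemma C_k_bump: "C_k k (bump a c n)"
proof -
  have "C_k k (\<lambda>t::real. flat_exp 0 (real (Suc n) * (t \<bullet> 1) + - real (Suc n) * a) *
                  flat_exp 0 (- real (Suc n) * (t \<bullet> 1) + real (Suc n) * c))"
    by (intro C_k_mult C_k_affine C_k_flat_exp)
  moreover have "bump a c n = (\<lambda>t::real. flat_exp 0 (real (Suc n) * (t \<bullet> 1) + - real (Suc n) * a) *
                  flat_exp 0 (- real (Suc n) * (t \<bullet> 1) + real (Suc n) * c))"
    unfolding bump_def by (simp add: algebra_simps fun_eq_iff)
  ultimately show ?thesis by (simp only:)
qed

lemma bump_tendsto: "(\<lambda>n. bump a c n t) \<longlonglongrightarrow> indicator {a<..<c} t"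
proof (cases "a < t \<and> t < c")
  case True
  have *: "(\<lambda>n. flat_exp 0 (real (Suc n) * s)) \<longlonglongrightarrow> 1" if "s > 0" for s
  proof -
    have "(\<lambda>n. exp (- (1 / s) * (1 / real (Suc n)))) \<longlonglongrightarrow> exp (- (1 / s) * 0)"
      by (intro tendsto_intros LIMSEQ_Suc[OF lim_1_over_n])
    moreover have "flat_exp 0 (real (Suc n) * s) = exp (- (1 / s) * (1 / real (Suc n)))" for n
      using that by (simp add: flat_exp_def mult.commute)
    ultimately show ?thesis by simp
  qed
  have "(\<lambda>n. bump a c n t) \<longlonglongrightarrow> 1 * 1"
    unfolding bump_def using True by (intro tendsto_mult *) auto
  then show ?thesis using True by simp
next
  case False
  then show ?thesis using bump_eq_0[of t a c] by (auto simp: not_less)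
qed

text \<open>A line integral of a box bump is a difference of two values of this antiderivative times
  a factor that is constant along the line. Its constancy outside \<open>(a, c)\<close> keeps the
  support of that difference compact.\<close>

lemma bump_antiderivative:
  obtains B where "\<And>t. (B has_real_derivative bump a c n t) (at t)" "\<And>t. t \<le> a \<Longrightarrow> B t = 0"
    "\<And>t. c \<le> t \<Longrightarrow> B t = B c" "\<And>k. C_k k B"
proof -
  let ?b = "bump a c n" and ?B = "\<lambda>t. integral {a..t} (bump a c n)"
  have cont: "continuous_on A ?b" for A
    using C_k_continuous[OF C_k_bump[of 0 a c n]] continuous_on_subset by blast
  have z: "?B t = 0" if "t \<le> a" for t
    using that by (cases "t = a") auto
  have d: "(?B has_real_derivative ?b t) (at t)" for t
  proof (cases "t < a")
    case True
    then have "(?B has_real_derivative 0) (at t)"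
      by (intro has_field_derivative_transform_within_open[OF DERIV_const[of 0], where S="{..<a}"])
         (auto simp: z)
    with True show ?thesis by (simp add: bump_eq_0)
  next
    case False
    \<comment> \<open>Starting the integral one unit earlier makes the fundamental theorem of
      calculus yield a two-sided derivative at \<open>t = a\<close> as well.\<close>
    let ?a = "a - 1"
    have eq: "integral {?a..x} ?b = ?B x" if "x \<ge> a" for x
    proof -
      have "integral {?a..a} ?b + ?B x = integral {?a..x} ?b"
        using that by (intro Henstock_Kurzweil_Integration.integral_combine
            integrable_continuous_real cont) auto
      moreover have "integral {?a..a} ?b = integral {?a..a} (\<lambda>x. 0)"
        by (rule integral_cong) (auto simp: bump_eq_0)
      ultimately show ?thesis by simp
    qed
    have eq': "integral {?a..x} ?b = ?B x" if "x < a" for x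
    proof -
      have "integral {?a..x} ?b = integral {?a..x} (\<lambda>x. 0)"
        by (rule integral_cong) (use that in \<open>auto simp: bump_eq_0\<close>)
      then show ?thesis using z[of x] that by simp
    qed
    have "((\<lambda>x. integral {?a..x} ?b) has_real_derivative ?b t) (at t within {?a..t+1})"
      using integral_has_real_derivative[OF cont, of t ?a "t + 1"] False by auto
    then have "((\<lambda>x. integral {?a..x} ?b) has_real_derivative ?b t) (at t)"
      using False by (simp add: at_within_Icc_at)
    moreover have "(\<lambda>x. integral {?a..x} ?b) = ?B" using eq eq' by (metis linorder_not_less)
    ultimately show ?thesis by simp
  qed
  have "?B t = ?B c" if "c \<le> t" for t
  proof (cases "c = t")
    case False
    show ?thesis
    proof (rule DERIV_isconst2[of c t])
      show "c < t" using that False by simp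
      show "continuous_on {c..t} ?B"
        by (intro continuous_at_imp_continuous_on ballI DERIV_isCont[OF d])
      show "(?B has_real_derivative 0) (at x)" if "c < x" "x < t" for x
        using d[of x] bump_eq_0[of x a c n] that by simp
    qed (use that in simp_all)
  qed auto
  moreover have "C_k k ?B" for k
    by (rule C_k_SucD, rule C_k_SucI_real[OF d C_k_bump])
  ultimately show ?thesis using that d z by blast
qed

definition box_bump :: "'a::euclidean_space \<Rightarrow> 'a \<Rightarrow> nat \<Rightarrow> 'a \<Rightarrow> real" where
  "box_bump a c n p = (\<Prod>i\<in>Basis. bump (a \<bullet> i) (c \<bullet> i) n (p \<bullet> i))"

lemma C_k_comp_inner:
  fixes f :: "real \<Rightarrow> real"
  shows "C_k n f \<Longrightarrow> C_k n (\<lambda>x. f (x \<bullet> i))"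
  using C_k_affine[of n f 1 i 0] by simp

lemma C_k_box_bump: "C_k k (box_bump a c n)"
  unfolding box_bump_def by (intro C_k_prod C_k_comp_inner C_k_bump)

lemma box_bump_nonneg: "0 \<le> box_bump a c n p" and box_bump_le_1: "box_bump a c n p \<le> 1"
  unfolding box_bump_def by (auto intro!: prod_nonneg prod_le_1 bump_nonneg bump_le_1)

lemma box_bump_eq_0: "p \<notin> box a c \<Longrightarrow> box_bump a c n p = 0"
  unfolding box_bump_def mem_box by (auto simp: not_less intro!: prod_zero bump_eq_0)

lemma box_bump_tendsto: "(\<lambda>n. box_bump a c n p) \<longlonglongrightarrow> indicator (box a c) p"
proof -
  have "(\<lambda>n. box_bump a c n p) \<longlonglongrightarrow> (\<Prod>i\<in>Basis. indicator {a \<bullet> i<..<c \<bullet> i} (p \<bullet> i))"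
    unfolding box_bump_def by (intro tendsto_prod bump_tendsto)
  moreover have "(\<Prod>i\<in>Basis. indicator {a \<bullet> i<..<c \<bullet> i} (p \<bullet> i) :: real) = indicator (box a c) p"
    by (cases "p \<in> box a c") (auto simp: mem_box indicator_def)
  ultimately show ?thesis by simp
qed

lemma test_functionI:
  assumes "\<And>n. C_k n \<phi>" "\<And>x. \<phi> x \<noteq> 0 \<Longrightarrow> x \<in> K" "compact K" "K \<subseteq> G"
  shows "\<phi> \<in> test_functions G" and "fun_support \<phi> \<subseteq> K"
proof -
  show K: "fun_support \<phi> \<subseteq> K"
    unfolding fun_support_def using assms by (intro closure_minimal) (auto intro: compact_imp_closed)
  then have "fun_support \<phi> = K \<inter> fun_support \<phi>" by auto
  also have "compact \<dots>"
    using assms(3) by (intro compact_Int_closed) (auto simp: fun_support_def)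
  finally show "\<phi> \<in> test_functions G"
    unfolding test_functions_def using assms K by auto
qed

lemma box_bump_test: "cbox a c \<subseteq> G \<Longrightarrow> box_bump a c n \<in> test_functions G"
  using box_bump_eq_0[of _ a c n] box_subset_cbox[of a c]
  by (intro test_functionI(1)[of _ "cbox a c"] C_k_box_bump) auto

lemma borel_measurable_box_bump [measurable]: "box_bump a c n \<in> borel_measurable borel"
  using C_k_continuous[OF C_k_box_bump] by (rule borel_measurable_continuous_onI)

text \<open>Open boxes are stable under intersection and generate the Borel sets, so Dynkin's
  argument spreads the vanishing of the integral to every Borel set. Then \<open>k\<close> and 0 are
  densities of the same set function.\<close>

lemma AE_zero_if_box_integrals_zero:
  fixes k :: "'a::euclidean_space \<Rightarrow> real"
  assumes k: "integrable lborel k" and z: "\<And>a c. (\<integral>x\<in>box a c. k x \<partial>lborel) = 0"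
  shows "AE x in lborel. k x = 0"
proof (rule density_unique_real[OF k])
  show "integrable lborel (\<lambda>x. 0 :: real)" by simp
  have si: "set_integrable lborel A k" if "A \<in> sets borel" for A
    unfolding set_integrable_def using k that by (intro integrable_mult_indicator) auto
  \<comment> \<open>Passing to complements requires the integral over the whole space, obtained as a
    limit over growing boxes.\<close>
  have UN: "(\<integral>x\<in>UNIV. k x \<partial>lborel) = 0"
  proof (rule LIMSEQ_unique)
    let ?b = "\<lambda>n. box (- real n *\<^sub>R One) (real n *\<^sub>R One) :: 'a set"
    have "(\<lambda>n. \<integral>x\<in>?b n. k x \<partial>lborel) \<longlonglongrightarrow> (\<integral>x\<in>(\<Union>n. ?b n). k x \<partial>lborel)"
    proof (rule set_integral_cont_up)
      show "incseq ?b"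
        unfolding incseq_def by (auto intro!: subset_box_imp)
      show "set_integrable lborel (\<Union>n. ?b n) k" by (rule si) simp
    qed simp
    then show "(\<lambda>n. \<integral>x\<in>?b n. k x \<partial>lborel) \<longlonglongrightarrow> (\<integral>x\<in>UNIV. k x \<partial>lborel)"
      by (simp add: UN_box_eq_UNIV)
  qed (simp add: z)
  fix A :: "'a set" assume "A \<in> sets lborel"
  then have A: "A \<in> sigma_sets UNIV (range (\<lambda>(a, b). box a b))"
    by (simp add: borel_eq_box)
  have "Int_stable (range (\<lambda>(a, b). box a b :: 'a set))"
    by (auto simp: Int_stable_def box_Int_box)
  moreover have "range (\<lambda>(a, b). box a b :: 'a set) \<subseteq> Pow UNIV" by simp
  ultimately have "(\<integral>x\<in>A. k x \<partial>lborel) = 0"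
    using A
  proof (induction rule: sigma_sets_induct_disjoint)
    case (basic A)
    then show ?case using z by auto
  next
    case empty
    then show ?case by (simp add: set_lebesgue_integral_def)
  next
    case (compl A)
    then have [measurable]: "A \<in> sets borel" by (simp add: borel_eq_box)
    have "(\<integral>x\<in>UNIV. k x \<partial>lborel) = (\<integral>x\<in>A \<union> (UNIV - A). k x \<partial>lborel)" by simp
    also have "\<dots> = (\<integral>x\<in>A. k x \<partial>lborel) + (\<integral>x\<in>UNIV - A. k x \<partial>lborel)"
      by (intro set_integral_Un si) auto
    finally show ?case using UN compl by simp
  next
    case (union A)
    then have A: "range A \<subseteq> sets lborel" by (auto simp: borel_eq_box)
    have "(\<integral>x\<in>(\<Union>i. A i). k x \<partial>lborel) = (\<Sum>i. \<integral>x\<in>A i. k x \<partial>lborel)"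
      by (rule lebesgue_integral_countable_add)
         (use A union in \<open>auto simp: disjoint_family_on_def intro!: si\<close>)
    with union show ?case by simp
  qed
  then show "(\<integral>x\<in>A. k x \<partial>lborel) = (\<integral>x\<in>A. 0 \<partial>lborel)" by (simp add: set_lebesgue_integral_def)
qed

lemma AE_cbox_iff_box: "AE x in lebesgue. x \<in> cbox a c \<longleftrightarrow> x \<in> box a c"
proof -
  have "cbox a c - box a c \<in> null_sets lebesgue"
    using negligible_frontier_interval negligible_iff_null_sets by blast
  from AE_not_in[OF this] show ?thesis
    by eventually_elim (use box_subset_cbox in auto)
qed

text \<open>The box bumps converge boundedly to indicators of open boxes, so testing with them
  already determines all box integrals. Since \<open>h\<close> is integrable only on compact boxes
  inside \<open>U\<close>, the argument is made on one such box at a time; countably many of them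
  cover \<open>U\<close>.\<close>

lemma fundamental_lemma:
  fixes h :: "'a::euclidean_space \<Rightarrow> real"
  assumes U: "open U"
    and int: "\<And>a c. cbox a c \<subseteq> U \<Longrightarrow> integrable lebesgue (\<lambda>x. indicator (cbox a c) x * h x)"
    and z: "\<And>a c n. cbox a c \<subseteq> U \<Longrightarrow> (\<integral>x. box_bump a c n x * h x \<partial>lebesgue) = 0"
  shows "AE x in lebesgue. x \<in> U \<longrightarrow> h x = 0"
proof -
  have box0: "(\<integral>x. indicator (box a c) x * h x \<partial>lebesgue) = 0" if "cbox a c \<subseteq> U" for a c
  proof (rule LIMSEQ_unique)
    let ?k = "\<lambda>x. indicator (cbox a c) x * h x"
    have eq: "box_bump a c n x * h x = box_bump a c n x * ?k x"
         "indicator (box a c) x * h x = indicator (box a c) x * ?k x" for n x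
      using box_bump_eq_0[of x a c n] box_subset_cbox[of a c] by (auto simp: indicator_def)
    show "(\<lambda>n. \<integral>x. box_bump a c n x * h x \<partial>lebesgue) \<longlonglongrightarrow> (\<integral>x. indicator (box a c) x * h x \<partial>lebesgue)"
      unfolding eq
    proof (rule integral_dominated_convergence[where w="\<lambda>x. norm (?k x)"])
      show "integrable lebesgue (\<lambda>x. norm (?k x))"
        using int[OF that] by (rule integrable_norm)
      note [measurable] = borel_measurable_integrable[OF int[OF that]]
      have [measurable]: "box_bump a c n \<in> borel_measurable lebesgue" for n
        by (rule measurable_completion) simp
      have [measurable]: "box a c \<in> sets lebesgue" by simp
      show "(\<lambda>x. indicator (box a c) x * ?k x) \<in> borel_measurable lebesgue" by measurable
      show "(\<lambda>x. box_bump a c n x * ?k x) \<in> borel_measurable lebesgue" for n by measurable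
      show "AE x in lebesgue. (\<lambda>n. box_bump a c n x * ?k x) \<longlonglongrightarrow> indicator (box a c) x * ?k x"
        by (intro AE_I2 tendsto_intros box_bump_tendsto)
      show "AE x in lebesgue. norm (box_bump a c n x * ?k x) \<le> norm (?k x)" for n
        using box_bump_nonneg[of a c n] box_bump_le_1[of a c n]
        by (intro AE_I2) (simp add: abs_mult mult_left_le_one_le)
    qed
  qed (simp add: z[OF that])
  have *: "AE x in lebesgue. x \<in> cbox a c \<longrightarrow> h x = 0" if K: "cbox a c \<subseteq> U" for a c
  proof -
    let ?k = "\<lambda>x. indicator (cbox a c) x * h x"
    \<comment> \<open>The box argument concerns Borel functions, so \<open>h\<close> cut off to the
      compact box is replaced by a Borel representative.\<close>
    obtain k' where [measurable]: "k' \<in> borel_measurable lborel" and k': "AE x in lborel. ?k x = k' x"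
      using completion_ex_borel_measurable_real[OF borel_measurable_integrable[OF int[OF K]]] by blast
    have k'l: "AE x in lebesgue. ?k x = k' x" using k' by (rule AE_completion)
    have ik: "integrable lborel k'"
      using integrable_cong_AE[THEN iffD1, OF _ _ k'l int[OF K]] int[OF K]
      by (auto simp: integrable_completion measurable_completion)
    have "(\<integral>x\<in>box a' c'. k' x \<partial>lborel) = 0" for a' c'
    proof -
      obtain a'' c'' where b: "box a c \<inter> box a' c' = box a'' c''" using box_Int_box by blast
      have "(\<integral>x\<in>box a' c'. k' x \<partial>lborel) = (\<integral>x. indicator (box a' c') x * k' x \<partial>lebesgue)"
        by (simp add: set_lebesgue_integral_def integral_completion)
      also have "\<dots> = (\<integral>x. indicator (box a'' c'') x * h x \<partial>lebesgue)"
      proof (rule Bochner_Integration.integral_cong_AE)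
        show "AE x in lebesgue. indicator (box a' c') x * k' x = indicator (box a'' c'') x * h x"
          using k'l AE_cbox_iff_box[of a c]
        proof eventually_elim
          case (elim x)
          have "x \<in> box a'' c'' \<longleftrightarrow> x \<in> box a c \<and> x \<in> box a' c'" using b by blast
          with elim show ?case by (cases "x \<in> box a c"; cases "x \<in> box a' c'") auto
        qed
        have "(\<lambda>x. indicator (box a'' c'') x * ?k x) \<in> borel_measurable lebesgue"
          by (rule borel_measurable_times[OF borel_measurable_indicator borel_measurable_integrable[OF int[OF K]]]) simp
        moreover have "(\<lambda>x. indicator (box a'' c'') x * ?k x) = (\<lambda>x. indicator (box a'' c'') x * h x)"
          using b box_subset_cbox[of a c] by (auto simp: indicator_def fun_eq_iff)
        ultimately show "(\<lambda>x. indicator (box a'' c'') x * h x) \<in> borel_measurable lebesgue" by simp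
      qed (auto intro!: measurable_completion)
      also have "\<dots> = 0"
      proof (cases "box a'' c'' = {}")
        case False
        then have "cbox a'' c'' \<subseteq> cbox a c"
          using b box_subset_cbox[of a c] closure_box[OF False]
            closure_minimal[of "box a'' c''" "cbox a c"] by auto
        then show ?thesis using K by (intro box0) auto
      qed simp
      finally show ?thesis .
    qed
    from AE_completion[OF AE_zero_if_box_integrals_zero[OF ik this]] k'l
    show ?thesis by eventually_elim auto
  qed
  obtain \<D> where \<D>: "countable \<D>" "\<D> \<subseteq> Pow U" "\<And>X. X \<in> \<D> \<Longrightarrow> \<exists>a b. X = cbox a b" "\<Union>\<D> = U"
    using open_countable_Union_open_cbox[OF U] by metis
  have "\<forall>X\<in>\<D>. AE x in lebesgue. x \<in> X \<longrightarrow> h x = 0"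
    using \<D>(2,3) * by blast
  then have "AE x in lebesgue. \<forall>X\<in>\<D>. x \<in> X \<longrightarrow> h x = 0"
    by (subst AE_ball_countable[OF \<D>(1)])
  then show ?thesis by eventually_elim (use \<D>(4) in auto)
qed

section \<open>Weak derivatives\<close>

lemma not_in_fun_support: "x \<notin> fun_support \<phi> \<Longrightarrow> \<phi> x = 0"
  using closure_subset[of "{x. \<phi> x \<noteq> 0}"] by (auto simp: fun_support_def)

lemma closed_fun_support: "closed (fun_support \<phi>)"
  by (simp add: fun_support_def)

lemma test_function_pderiv:
  assumes "\<phi> \<in> test_functions G" "e \<in> Basis"
  shows "(\<lambda>x. pderiv_fun e \<phi> x) \<in> test_functions G"
    and "x \<notin> fun_support \<phi> \<Longrightarrow> pderiv_fun e \<phi> x = 0"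
proof -
  show z: "pderiv_fun e \<phi> x = 0" if "x \<notin> fun_support \<phi>" for x
  proof -
    have "(\<phi> has_derivative (\<lambda>h. 0)) (at x)"
      by (rule has_derivative_transform_within_open[OF has_derivative_const[of 0], where s="- fun_support \<phi>"])
         (use that in \<open>simp_all add: not_in_fun_support open_Compl closed_fun_support\<close>)
    from frechet_derivative_at[OF this] show ?thesis by metis
  qed
  show "(\<lambda>x. pderiv_fun e \<phi> x) \<in> test_functions G"
  proof (rule test_functionI)
    show "C_k n (\<lambda>x. pderiv_fun e \<phi> x)" for n
      using assms C_k.simps(2)[of n \<phi>] unfolding test_functions_def by blast
    show "compact (fun_support \<phi>)" "fun_support \<phi> \<subseteq> G"
      using assms by (auto simp: test_functions_def)
  qed (use z in blast)
qed

lemma test_function_continuous: "\<phi> \<in> test_functions G \<Longrightarrow> continuous_on A \<phi>"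
  unfolding test_functions_def using C_k_continuous continuous_on_subset by blast

lemma test_function_bounded:
  assumes "\<phi> \<in> test_functions G"
  obtains B where "\<And>x. \<bar>\<phi> x\<bar> \<le> B" "B \<ge> 0"
proof -
  have "compact (\<phi> ` fun_support \<phi>)"
    using assms by (intro compact_continuous_image test_function_continuous) (auto simp: test_functions_def)
  then obtain B where B: "\<And>x. x \<in> fun_support \<phi> \<Longrightarrow> \<bar>\<phi> x\<bar> \<le> B"
    using compact_imp_bounded by (fastforce simp: bounded_iff)
  show thesis
    by (rule that[of "max B 0"]) (metis B abs_zero max.coboundedI1 max.cobounded2 not_in_fun_support, simp)
qed

lemma borel_measurable_test_function:
  "\<phi> \<in> test_functions G \<Longrightarrow> \<phi> \<in> borel_measurable borel"
  by (intro borel_measurable_continuous_onI test_function_continuous)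

lemma integrable_test_scaleR:
  fixes g :: "'a::euclidean_space \<Rightarrow> 'b::euclidean_space"
  assumes \<phi>: "\<phi> \<in> test_functions G" and g: "locally_integrable G g" and G: "open G"
  shows "integrable (lebesgue_on G) (\<lambda>x. \<phi> x *\<^sub>R g x)"
proof -
  let ?K = "fun_support \<phi>"
  have K: "compact ?K" "?K \<subseteq> G" using \<phi> by (auto simp: test_functions_def)
  have [measurable]: "?K \<in> sets lebesgue" using K(1) by (simp add: borel_compact)
  obtain B where B: "\<And>x. \<bar>\<phi> x\<bar> \<le> B" using test_function_bounded[OF \<phi>] by metis
  have gK: "integrable (lebesgue_on ?K) g" using g K by (auto simp: locally_integrable_def)
  have "integrable (lebesgue_on ?K) (\<lambda>x. \<phi> x *\<^sub>R g x)"
  proof (rule Bochner_Integration.integrable_bound)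
    show "integrable (lebesgue_on ?K) (\<lambda>x. B *\<^sub>R g x)" using gK by simp
    have "\<phi> \<in> borel_measurable (lebesgue_on ?K)"
      by (intro measurable_restrict_space1 measurable_completion)
         (simp add: borel_measurable_test_function[OF \<phi>])
    with gK show "(\<lambda>x. \<phi> x *\<^sub>R g x) \<in> borel_measurable (lebesgue_on ?K)" by measurable
    have "\<bar>\<phi> x\<bar> \<le> \<bar>B\<bar>" for x using B[of x] by linarith
    then show "AE x in lebesgue_on ?K. norm (\<phi> x *\<^sub>R g x) \<le> norm (B *\<^sub>R g x)"
      by (auto intro!: AE_I2 mult_right_mono)
  qed
  then have "integrable lebesgue (\<lambda>x. indicator ?K x *\<^sub>R (\<phi> x *\<^sub>R g x))"
    by (simp add: integrable_restrict_space)
  moreover have "(\<lambda>x. indicator ?K x *\<^sub>R (\<phi> x *\<^sub>R g x)) = (\<lambda>x. indicator G x *\<^sub>R (\<phi> x *\<^sub>R g x))"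
    using K(2) not_in_fun_support[of _ \<phi>] by (auto simp: indicator_def fun_eq_iff)
  ultimately show ?thesis using G by (simp add: integrable_restrict_space borel_open)
qed

text \<open>\<open>wderiv\<close> is an arbitrary choice among weak derivatives, so every identity
  between chosen derivatives rests on this uniqueness. The fundamental lemma is applied to each
  coordinate of the difference.\<close>

lemma has_weak_deriv_unique:
  fixes v :: "'a::euclidean_space \<Rightarrow> 'b::euclidean_space"
  assumes g: "has_weak_deriv G e v g" and g': "has_weak_deriv G e v g'" and G: "open G"
  shows "AE x in lebesgue_on G. g x = g' x"
proof -
  have L: "locally_integrable G g" "locally_integrable G g'"
    using g g' by (auto simp: has_weak_deriv_def)
  have [measurable]: "G \<in> sets lebesgue" using G by (simp add: borel_open)
  have "AE x in lebesgue. x \<in> G \<longrightarrow> (g x - g' x) \<bullet> b = 0" if "b \<in> Basis" for b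
  proof (rule fundamental_lemma[OF G])
    fix a c :: 'a and n :: nat assume K: "cbox a c \<subseteq> G"
    have "integrable (lebesgue_on (cbox a c)) (\<lambda>x. (g x - g' x) \<bullet> b)"
      using L K by (auto simp: locally_integrable_def)
    then show "integrable lebesgue (\<lambda>x. indicator (cbox a c) x * ((g x - g' x) \<bullet> b))"
      by (simp add: integrable_restrict_space)
    note \<phi> = box_bump_test[OF K, of n]
    note I = integrable_test_scaleR[OF \<phi> L(1) G] integrable_test_scaleR[OF \<phi> L(2) G]
    have "(\<integral>x. box_bump a c n x * ((g x - g' x) \<bullet> b) \<partial>lebesgue)
        = (\<integral>x. indicator G x *\<^sub>R ((box_bump a c n x *\<^sub>R g x - box_bump a c n x *\<^sub>R g' x) \<bullet> b) \<partial>lebesgue)"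
    proof (intro Bochner_Integration.integral_cong refl)
      show "box_bump a c n x * ((g x - g' x) \<bullet> b)
        = indicator G x *\<^sub>R ((box_bump a c n x *\<^sub>R g x - box_bump a c n x *\<^sub>R g' x) \<bullet> b)" for x
      proof (cases "x \<in> G")
        case False
        then have "x \<notin> box a c" using K box_subset_cbox by blast
        then show ?thesis by (simp add: box_bump_eq_0)
      qed (simp add: inner_diff_left right_diff_distrib)
    qed
    also have "\<dots> = (LINT x|lebesgue_on G. (box_bump a c n x *\<^sub>R g x - box_bump a c n x *\<^sub>R g' x) \<bullet> b)"
      by (subst integral_restrict_space) auto
    also have "\<dots> = ((LINT x|lebesgue_on G. box_bump a c n x *\<^sub>R g x) - (LINT x|lebesgue_on G. box_bump a c n x *\<^sub>R g' x)) \<bullet> b"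
      using I by simp
    also have "\<dots> = 0"
    proof -
      have "- (LINT x|lebesgue_on G. box_bump a c n x *\<^sub>R g x) = - (LINT x|lebesgue_on G. box_bump a c n x *\<^sub>R g' x)"
        using g g' \<phi> unfolding has_weak_deriv_def by auto
      then show ?thesis by simp
    qed
    finally show "(\<integral>x. box_bump a c n x * ((g x - g' x) \<bullet> b) \<partial>lebesgue) = 0" .
  qed
  then have "AE x in lebesgue. \<forall>b\<in>Basis. x \<in> G \<longrightarrow> (g x - g' x) \<bullet> b = 0"
    by (subst AE_ball_countable) (auto intro: countable_finite)
  then show ?thesis
    by (subst AE_restrict_space_iff) (auto elim!: eventually_mono simp: euclidean_eq_iff[where 'a='b] inner_diff_left)
qed

lemma locally_integrable_lincomb:
  assumes "locally_integrable G v" "locally_integrable G w"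
  shows "locally_integrable G (\<lambda>x. a *\<^sub>R v x + b *\<^sub>R w x)"
  using assms by (auto simp: locally_integrable_def)

lemma has_weak_deriv_lincomb:
  assumes v: "has_weak_deriv G e v g" and w: "has_weak_deriv G e w g'"
    and G: "open G" and e: "e \<in> Basis"
  shows "has_weak_deriv G e (\<lambda>x. a *\<^sub>R v x + b *\<^sub>R w x) (\<lambda>x. a *\<^sub>R g x + b *\<^sub>R g' x)"
  unfolding has_weak_deriv_def
proof (intro conjI ballI)
  have L: "locally_integrable G v" "locally_integrable G w" "locally_integrable G g" "locally_integrable G g'"
    using v w by (auto simp: has_weak_deriv_def)
  show "locally_integrable G (\<lambda>x. a *\<^sub>R v x + b *\<^sub>R w x)" "locally_integrable G (\<lambda>x. a *\<^sub>R g x + b *\<^sub>R g' x)"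
    using L by (auto intro: locally_integrable_lincomb)
  fix \<phi> assume \<phi>: "\<phi> \<in> test_functions G"
  have lin: "(LINT x|lebesgue_on G. \<psi> x *\<^sub>R (a *\<^sub>R p x + b *\<^sub>R q x))
      = a *\<^sub>R (LINT x|lebesgue_on G. \<psi> x *\<^sub>R p x) + b *\<^sub>R (LINT x|lebesgue_on G. \<psi> x *\<^sub>R q x)"
    if "\<psi> \<in> test_functions G" "locally_integrable G p" "locally_integrable G q"
    for \<psi> and p q :: "'a \<Rightarrow> 'b"
  proof -
    have "(LINT x|lebesgue_on G. \<psi> x *\<^sub>R (a *\<^sub>R p x + b *\<^sub>R q x))
        = (LINT x|lebesgue_on G. a *\<^sub>R (\<psi> x *\<^sub>R p x) + b *\<^sub>R (\<psi> x *\<^sub>R q x))"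
      by (simp add: algebra_simps)
    also have "\<dots> = a *\<^sub>R (LINT x|lebesgue_on G. \<psi> x *\<^sub>R p x) + b *\<^sub>R (LINT x|lebesgue_on G. \<psi> x *\<^sub>R q x)"
      using integrable_test_scaleR[OF that(1) that(2) G] integrable_test_scaleR[OF that(1) that(3) G]
      by (subst Bochner_Integration.integral_add) (simp_all only: integrable_scaleR_right integral_scaleR_right simp_thms)
    finally show ?thesis .
  qed
  show "(LINT x|lebesgue_on G. pderiv_fun e \<phi> x *\<^sub>R (a *\<^sub>R v x + b *\<^sub>R w x))
      = - (LINT x|lebesgue_on G. \<phi> x *\<^sub>R (a *\<^sub>R g x + b *\<^sub>R g' x))"
    unfolding lin[OF \<phi> L(3,4)] lin[OF test_function_pderiv(1)[OF \<phi> e] L(1,2)]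
    using v w \<phi> by (simp add: has_weak_deriv_def)
qed

lemma has_weak_deriv_inner:
  assumes v: "has_weak_deriv G e v g" and G: "open G" and e: "e \<in> Basis"
  shows "has_weak_deriv G e (\<lambda>x. v x \<bullet> b) (\<lambda>x. g x \<bullet> b)"
  unfolding has_weak_deriv_def
proof (intro conjI ballI)
  have L: "locally_integrable G v" "locally_integrable G g"
    using v by (auto simp: has_weak_deriv_def)
  then show "locally_integrable G (\<lambda>x. v x \<bullet> b)" "locally_integrable G (\<lambda>x. g x \<bullet> b)"
    by (auto simp: locally_integrable_def)
  fix \<phi> assume \<phi>: "\<phi> \<in> test_functions G"
  have inn: "(LINT x|lebesgue_on G. \<psi> x *\<^sub>R (p x \<bullet> b)) = (LINT x|lebesgue_on G. \<psi> x *\<^sub>R p x) \<bullet> b"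
    if "\<psi> \<in> test_functions G" "locally_integrable G p" for \<psi> p
    using integrable_test_scaleR[OF that G] by (simp flip: inner_scaleR_left)
  show "(LINT x|lebesgue_on G. pderiv_fun e \<phi> x *\<^sub>R (v x \<bullet> b)) = - (LINT x|lebesgue_on G. \<phi> x *\<^sub>R (g x \<bullet> b))"
    unfolding inn[OF \<phi> L(2)] inn[OF test_function_pderiv(1)[OF \<phi> e] L(1)]
    using v \<phi> by (simp add: has_weak_deriv_def)
qed

lemma wderiv_works: "has_L2_deriv G e v \<Longrightarrow> has_weak_deriv G e v (wderiv G e v)"
  unfolding has_L2_deriv_def wderiv_def by (metis someI_ex)

lemma wderiv_unique:
  assumes "has_weak_deriv G e v g" "open G"
  shows "AE x in lebesgue_on G. wderiv G e v x = g x"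
  using has_weak_deriv_unique[OF _ assms] someI[of "has_weak_deriv G e v", OF assms(1)]
  by (simp add: wderiv_def)

text \<open>Measurability transfers too, because Lebesgue measure is complete.\<close>

lemma L2_cong_AE:
  assumes ae: "AE x in lebesgue_on G. v x = w x" and w: "L2 G w" and G: "G \<in> sets lebesgue"
  shows "L2 G v"
proof -
  have "v \<in> borel_measurable (lebesgue_on G)"
  proof -
    have "(\<lambda>x. indicator G x *\<^sub>R w x) \<in> borel_measurable lebesgue"
      using w G by (simp add: L2_def borel_measurable_restrict_space_iff)
    moreover have "AE x in lebesgue. indicator G x *\<^sub>R w x = indicator G x *\<^sub>R v x"
      using ae G by (simp add: AE_restrict_space_iff) (auto elim!: eventually_mono simp: indicator_def)
    ultimately have "(\<lambda>x. indicator G x *\<^sub>R v x) \<in> borel_measurable lebesgue"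
      by (rule borel_measurable_AE)
    then show ?thesis using G by (simp add: borel_measurable_restrict_space_iff)
  qed
  moreover have "integrable (lebesgue_on G) (\<lambda>x. (norm (v x))\<^sup>2)"
  proof (rule integrable_cong_AE_imp)
    show "integrable (lebesgue_on G) (\<lambda>x. (norm (w x))\<^sup>2)" using w by (simp add: L2_def)
    show "AE x in lebesgue_on G. (norm (w x))\<^sup>2 = (norm (v x))\<^sup>2"
      using ae by eventually_elim simp
  qed (use calculation in measurable)
  ultimately show ?thesis by (simp add: L2_def)
qed

text \<open>\<open>has_L2_deriv\<close> provides some square integrable weak derivative; the chosen
  one agrees with it almost everywhere.\<close>

lemma wderiv_L2:
  assumes "has_L2_deriv G e v" "open G"
  shows "L2 G (wderiv G e v)"
proof -
  obtain g where "has_weak_deriv G e v g" "L2 G g" using assms(1) by (auto simp: has_L2_deriv_def)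
  moreover have "G \<in> sets lebesgue" using assms(2) by (simp add: borel_open)
  ultimately show ?thesis using L2_cong_AE[OF wderiv_unique[OF _ assms(2)]] by blast
qed

lemma wderiv_lincomb:
  assumes "has_L2_deriv G e v" "has_L2_deriv G e w" "open G" "e \<in> Basis"
  shows "AE x in lebesgue_on G. wderiv G e (\<lambda>x. a *\<^sub>R v x + b *\<^sub>R w x) x
     = a *\<^sub>R wderiv G e v x + b *\<^sub>R wderiv G e w x"
  using wderiv_unique[OF has_weak_deriv_lincomb[OF wderiv_works wderiv_works]] assms by blast

lemma wderiv_inner:
  assumes "has_L2_deriv G e v" "open G" "e \<in> Basis"
  shows "AE x in lebesgue_on G. wderiv G e (\<lambda>x. v x \<bullet> b) x = wderiv G e v x \<bullet> b"
  using wderiv_unique[OF has_weak_deriv_inner[OF wderiv_works]] assms by blast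

section \<open>The scalar product and norm of L2\<close>

lemma L2_integrable_inner:
  assumes "L2 G v" "L2 G w"
  shows "integrable (lebesgue_on G) (\<lambda>x. v x \<bullet> w x)"
proof (rule Bochner_Integration.integrable_bound)
  show "integrable (lebesgue_on G) (\<lambda>x. (norm (v x))\<^sup>2 + (norm (w x))\<^sup>2)"
    using assms by (auto simp: L2_def)
  show "(\<lambda>x. v x \<bullet> w x) \<in> borel_measurable (lebesgue_on G)"
    using assms by (auto simp: L2_def)
  have "\<bar>v x \<bullet> w x\<bar> \<le> (norm (v x))\<^sup>2 + (norm (w x))\<^sup>2" for x
  proof -
    have "\<bar>v x \<bullet> w x\<bar> \<le> norm (v x) * norm (w x)" by (rule Cauchy_Schwarz_ineq2)
    moreover have "2 * (norm (v x) * norm (w x)) \<le> (norm (v x))\<^sup>2 + (norm (w x))\<^sup>2"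
      using sum_squares_bound[of "norm (v x)" "norm (w x)"] by simp
    moreover have "0 \<le> norm (v x) * norm (w x)" by simp
    ultimately show ?thesis by linarith
  qed
  then show "AE x in lebesgue_on G. norm (v x \<bullet> w x) \<le> norm ((norm (v x))\<^sup>2 + (norm (w x))\<^sup>2)"
    by (intro AE_I2) simp
qed

lemma L2_lincomb:
  assumes v: "L2 G v" and w: "L2 G w"
  shows "L2 G (\<lambda>x. a *\<^sub>R v x + b *\<^sub>R w x)"
  unfolding L2_def
proof
  show "(\<lambda>x. a *\<^sub>R v x + b *\<^sub>R w x) \<in> borel_measurable (lebesgue_on G)"
    using assms by (auto simp: L2_def)
  have "(norm (a *\<^sub>R v x + b *\<^sub>R w x))\<^sup>2 = a\<^sup>2 * (v x \<bullet> v x) + 2 * a * b * (v x \<bullet> w x) + b\<^sup>2 * (w x \<bullet> w x)" for x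
    unfolding power2_norm_eq_inner
    by (simp add: inner_add inner_commute power2_eq_square algebra_simps)
  then show "integrable (lebesgue_on G) (\<lambda>x. (norm (a *\<^sub>R v x + b *\<^sub>R w x))\<^sup>2)"
    using L2_integrable_inner[OF v v] L2_integrable_inner[OF v w] L2_integrable_inner[OF w w] by simp
qed

lemma L2_norm_power2: "(L2_norm G v)\<^sup>2 = L2_inner G v v"
  by (simp add: L2_norm_def L2_inner_def power2_norm_eq_inner)

lemma L2_norm_nonneg [simp]: "0 \<le> L2_norm G v"
  by (simp add: L2_norm_def)

lemma L2_inner_commute: "L2_inner G v w = L2_inner G w v"
  by (simp add: L2_inner_def inner_commute)

lemma L2_inner_lincomb:
  assumes "L2 G v" "L2 G w" "L2 G z"
  shows "L2_inner G (\<lambda>x. a *\<^sub>R v x + b *\<^sub>R w x) z = a * L2_inner G v z + b * L2_inner G w z"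
  using L2_integrable_inner[OF assms(1,3)] L2_integrable_inner[OF assms(2,3)]
  by (simp add: L2_inner_def inner_add)

lemma L2_norm_lincomb:
  assumes "L2 G v" "L2 G w"
  shows "(L2_norm G (\<lambda>x. a *\<^sub>R v x + b *\<^sub>R w x))\<^sup>2
     = a\<^sup>2 * (L2_norm G v)\<^sup>2 + 2 * a * b * L2_inner G v w + b\<^sup>2 * (L2_norm G w)\<^sup>2"
proof -
  have l: "L2 G (\<lambda>x. a *\<^sub>R v x + b *\<^sub>R w x)" using assms by (rule L2_lincomb)
  have "(L2_norm G (\<lambda>x. a *\<^sub>R v x + b *\<^sub>R w x))\<^sup>2
      = a * L2_inner G (\<lambda>x. a *\<^sub>R v x + b *\<^sub>R w x) v + b * L2_inner G (\<lambda>x. a *\<^sub>R v x + b *\<^sub>R w x) w"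
    unfolding L2_norm_power2 L2_inner_lincomb[OF assms l] by (simp add: L2_inner_commute)
  also have "\<dots> = a\<^sup>2 * (L2_norm G v)\<^sup>2 + 2 * a * b * L2_inner G v w + b\<^sup>2 * (L2_norm G w)\<^sup>2"
    unfolding L2_inner_lincomb[OF assms assms(1)] L2_inner_lincomb[OF assms assms(2)] L2_norm_power2
    by (simp add: L2_inner_commute[of G w v] power2_eq_square algebra_simps)
  finally show ?thesis .
qed

text \<open>The quadratic form \<open>|a v + b w|^2\<close> in \<open>a\<close> and \<open>b\<close>
  is nonnegative. On functions \<open>L2_norm\<close> is only a seminorm, so the degenerate case has
  to be treated separately.\<close>

lemma L2_Cauchy_Schwarz:
  assumes "L2 G v" "L2 G w"
  shows "\<bar>L2_inner G v w\<bar> \<le> L2_norm G v * L2_norm G w"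
proof -
  let ?A = "(L2_norm G v)\<^sup>2" and ?B = "L2_inner G v w" and ?C = "(L2_norm G w)\<^sup>2"
  have q: "0 \<le> a\<^sup>2 * ?A + 2 * a * b * ?B + b\<^sup>2 * ?C" for a b
    unfolding L2_norm_lincomb[OF assms, symmetric] by simp
  have "?B\<^sup>2 \<le> ?A * ?C"
  proof (cases "?C = 0")
    case True
    have "?B = 0"
    proof (rule ccontr)
      assume "?B \<noteq> 0"
      \<comment> \<open>With \<open>|w| = 0\<close> and \<open>a = 1\<close> the form is affine in
        \<open>b\<close>; this \<open>b\<close> would give it the value -1.\<close>
      then have "2 * (- (?A + 1) / (2 * ?B)) * ?B = - (?A + 1)" by (simp add: field_simps)
      then show False using q[of 1 "- (?A + 1) / (2 * ?B)"] True by simp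
    qed
    then show ?thesis by simp
  next
    case False
    then have "0 < ?C" by simp
    \<comment> \<open>The choice \<open>a = |w|^2\<close>, \<open>b = - (v, w)\<close> minimises the
      form along its direction and leaves the discriminant times \<open>|w|^2\<close>.\<close>
    moreover have "0 \<le> ?C * (?A * ?C - ?B\<^sup>2)"
      using q[of ?C "- ?B"] by (simp add: power2_eq_square algebra_simps)
    ultimately show ?thesis by (simp add: zero_le_mult_iff)
  qed
  then have "\<bar>?B\<bar>\<^sup>2 \<le> (L2_norm G v * L2_norm G w)\<^sup>2" by (simp add: power_mult_distrib)
  then show ?thesis by (rule power2_le_imp_le) simp
qed

section \<open>Absolute continuity along lines\<close>

text \<open>Elements of the function spaces are given on \<open>G\<close> only, up to null sets and
  up to completion, whereas translations and Fubini's theorem call for Borel functions on the whole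
  space. This lemma leads there, and \<open>lebesgue_on_transfer\<close> leads back.\<close>

lemma borel_zero_extension:
  fixes v :: "'a::euclidean_space \<Rightarrow> real"
  assumes v: "v \<in> borel_measurable (lebesgue_on G)" and G: "G \<in> sets borel"
  obtains w where "w \<in> borel_measurable borel" "\<And>x. x \<notin> G \<Longrightarrow> w x = 0"
    "AE x in lborel. x \<in> G \<longrightarrow> w x = v x"
proof -
  have "(\<lambda>x. indicator G x *\<^sub>R v x) \<in> borel_measurable lebesgue"
    using v G by (subst (asm) borel_measurable_restrict_space_iff) auto
  from completion_ex_borel_measurable_real[OF this] obtain w
    where w: "w \<in> borel_measurable lborel" "AE x in lborel. indicator G x *\<^sub>R v x = w x" by blast
  show thesis
  proof (rule that)
    show "(\<lambda>x. indicator G x * w x) \<in> borel_measurable borel" using w(1) G by simp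
    show "AE x in lborel. x \<in> G \<longrightarrow> indicator G x * w x = v x"
      using w(2) by eventually_elim auto
  qed simp
qed

lemma lebesgue_on_transfer:
  fixes F W :: "'a::euclidean_space \<Rightarrow> 'b::euclidean_space"
  assumes G: "G \<in> sets borel" and W: "W \<in> borel_measurable borel" "\<And>x. x \<notin> G \<Longrightarrow> W x = 0"
    and ae: "AE x in lborel. x \<in> G \<longrightarrow> F x = W x"
  shows "F \<in> borel_measurable (lebesgue_on G)"
    and "integrable (lebesgue_on G) F \<longleftrightarrow> integrable lborel W"
    and "(LINT x|lebesgue_on G. F x) = (\<integral>x. W x \<partial>lborel)"
proof -
  have [simp]: "G \<in> sets lebesgue" using G by simp
  have Wl: "W \<in> borel_measurable lebesgue" by (rule measurable_completion) (use W in simp)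
  have ae': "AE x in lebesgue. W x = indicator G x *\<^sub>R F x"
    using AE_completion[OF ae]
  proof eventually_elim
    case (elim x)
    then show ?case using W(2)[of x] by (cases "x \<in> G") auto
  qed
  have m: "(\<lambda>x. indicator G x *\<^sub>R F x) \<in> borel_measurable lebesgue"
    by (rule borel_measurable_AE[OF Wl ae'])
  then show "F \<in> borel_measurable (lebesgue_on G)"
    by (simp add: borel_measurable_restrict_space_iff)
  have "integrable (lebesgue_on G) F \<longleftrightarrow> integrable lebesgue W"
    unfolding integrable_restrict_space[of G lebesgue F, simplified] using ae' by (intro integrable_cong_AE m Wl) auto
  then show "integrable (lebesgue_on G) F \<longleftrightarrow> integrable lborel W"
    using W by (simp add: integrable_completion)
  have "(LINT x|lebesgue_on G. F x) = (\<integral>x. W x \<partial>lebesgue)"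
    unfolding integral_restrict_space[of G lebesgue F, simplified] using ae' by (intro integral_cong_AE m Wl) auto
  then show "(LINT x|lebesgue_on G. F x) = (\<integral>x. W x \<partial>lborel)"
    using W by (simp add: integral_completion)
qed

section \<open>Translation invariance of Lebesgue measure\<close>

lemma lborel_translate: "distr lborel borel (\<lambda>x::'a::euclidean_space. x + c) = lborel"
proof -
  have "(\<lambda>x. x + c) = (+) c" by (auto simp: add.commute)
  then show ?thesis using lborel_distr_plus[of c] by simp
qed

lemma nn_integral_translate:
  fixes c :: "'a::euclidean_space"
  assumes [measurable]: "f \<in> borel_measurable borel"
  shows "(\<integral>\<^sup>+x. f (x + c) \<partial>lborel) = (\<integral>\<^sup>+x. f x \<partial>lborel)"
  by (subst (2) lborel_translate[of c, symmetric]) (simp add: nn_integral_distr)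

lemma integrable_translate:
  fixes c :: "'a::euclidean_space" and f :: "'a \<Rightarrow> real"
  assumes [measurable]: "f \<in> borel_measurable borel"
  shows "integrable lborel (\<lambda>x. f (x + c)) \<longleftrightarrow> integrable lborel f"
  by (subst (2) lborel_translate[of c, symmetric]) (simp add: integrable_distr_eq)

lemma integral_translate:
  fixes c :: "'a::euclidean_space" and f :: "'a \<Rightarrow> real"
  assumes [measurable]: "f \<in> borel_measurable borel"
  shows "(\<integral>x. f (x + c) \<partial>lborel) = (\<integral>x. f x \<partial>lborel)"
  by (subst (2) lborel_translate[of c, symmetric]) (simp add: integral_distr)

lemma AE_translate:
  fixes c :: "'a::euclidean_space"
  assumes "AE x in lborel. P x"
  shows "AE x in lborel. P (x + c)"
proof -
  obtain N where N: "N \<in> null_sets lborel" "{x. \<not> P x} \<subseteq> N"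
    using assms by (auto simp: eventually_ae_filter)
  then have [measurable]: "N \<in> sets borel" by auto
  have "(\<integral>\<^sup>+x. indicator N (x + c) \<partial>lborel) = (\<integral>\<^sup>+x. indicator N x \<partial>lborel)"
    by (rule nn_integral_translate) simp
  also have "\<dots> = 0" using N by (simp add: null_sets_def)
  finally have "AE x in lborel. indicator N (x + c) = (0::ennreal)"
    by (subst (asm) nn_integral_0_iff_AE) auto
  then show ?thesis
    by eventually_elim (use N in \<open>auto simp: indicator_def split: if_splits\<close>)
qed

text \<open>Tested with the bump \<open>\<psi>\<close>, the difference \<open>w p - w (p - L e)\<close> gives
  \<open>\<integral> w (\<psi> - \<psi> (\<cdot> + L e))\<close>, and \<open>\<psi> - \<psi> (\<cdot> + L e)\<close> is the derivative in direction \<open>e\<close> of the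
  test function \<open>- \<integral>\<^sub>0\<^sup>L \<psi> (\<cdot> + t e) dt\<close>.\<close>

lemma box_bump_line_integral:
  fixes e :: "'a::euclidean_space"
  assumes e: "e \<in> Basis" and L: "L \<ge> 0" and ne: "box a c \<noteq> {}"
    and K: "cbox a c \<subseteq> H" and down: "\<And>p t. p \<in> H \<Longrightarrow> t \<ge> 0 \<Longrightarrow> p - t *\<^sub>R e \<in> H"
  obtains \<phi> where "\<phi> \<in> test_functions UNIV" "fun_support \<phi> \<subseteq> H"
    "\<And>p. pderiv_fun e \<phi> p = box_bump a c n p - box_bump a c n (p + L *\<^sub>R e)"
    "\<And>p. \<phi> p = - (\<integral>t\<in>{0..L}. box_bump a c n (p + t *\<^sub>R e) \<partial>lborel)"
proof -
  let ?b = "bump (a \<bullet> e) (c \<bullet> e) n"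
  \<comment> \<open>The product over the other coordinates is constant along lines in direction
    \<open>e\<close>, so everything reduces to one variable.\<close>
  define R where "R p = (\<Prod>i\<in>Basis - {e}. bump (a \<bullet> i) (c \<bullet> i) n (p \<bullet> i))" for p :: 'a
  obtain B where B: "\<And>t. (B has_real_derivative ?b t) (at t)" "\<And>t. t \<le> a \<bullet> e \<Longrightarrow> B t = 0"
    "\<And>t. c \<bullet> e \<le> t \<Longrightarrow> B t = B (c \<bullet> e)" "\<And>k. C_k k B"
    by (rule bump_antiderivative[of "a \<bullet> e" "c \<bullet> e" n]) (rule that)
  have split: "box_bump a c n p = ?b (p \<bullet> e) * R p" for p
    unfolding box_bump_def R_def using e by (subst prod.remove[of _ e]) auto
  have R_shift: "R (p + t *\<^sub>R e) = R p" for p t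
    unfolding R_def using e by (intro prod.cong) (auto simp: inner_add_left inner_Basis)
  have split': "box_bump a c n (p + t *\<^sub>R e) = ?b (p \<bullet> e + t) * R p" for p t
    using e by (simp add: split R_shift inner_add_left)
  \<comment> \<open>The line integral written through the antiderivative: smoothness becomes a
    matter of composition, without differentiating under an integral.\<close>
  define \<phi> where "\<phi> p = (-1) * (B (1 * (p \<bullet> e) + L) + (-1) * B (p \<bullet> e)) * R p" for p
  have Ck: "C_k k \<phi>" for k
  proof -
    have "C_k k (\<lambda>p. B (1 * (p \<bullet> e) + L))" by (rule C_k_affine[OF B(4)])
    moreover have "C_k k (\<lambda>p. B (p \<bullet> e))" by (rule C_k_comp_inner[OF B(4)])
    moreover have "C_k k (\<lambda>p. R p)"
      unfolding R_def by (rule C_k_prod) (rule C_k_comp_inner[OF C_k_bump])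
    ultimately have "C_k k (\<lambda>p. \<phi> p)"
      unfolding \<phi>_def by (intro C_k_mult[of k _ R] C_k_mult[of k "\<lambda>p. -1"] C_k_add C_k_const)
    then show ?thesis .
  qed
  have ac: "a \<bullet> i < c \<bullet> i" if "i \<in> Basis" for i
    using ne that by (auto simp: box_ne_empty)
  \<comment> \<open>Where the two values of \<open>B\<close> differ, the segment from
    \<open>p\<close> to \<open>p + L e\<close> meets the box. The support thus lies in the box
    prolonged backwards by \<open>L\<close>, and \<open>H\<close> contains that because it is closed
    under backward steps.\<close>
  have supp: "p \<in> cbox (a - L *\<^sub>R e) c" if "\<phi> p \<noteq> 0" for p
  proof -
    from that have "R p \<noteq> 0" and B0: "B (p \<bullet> e + L) \<noteq> B (p \<bullet> e)" by (auto simp: \<phi>_def)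
    then have i: "a \<bullet> i < p \<bullet> i \<and> p \<bullet> i < c \<bullet> i" if "i \<in> Basis" "i \<noteq> e" for i
    proof -
      have "bump (a \<bullet> i) (c \<bullet> i) n (p \<bullet> i) \<noteq> 0"
        using that \<open>R p \<noteq> 0\<close> unfolding R_def by (auto simp: prod_zero_iff)
      then show ?thesis using bump_eq_0[of "p \<bullet> i" "a \<bullet> i" "c \<bullet> i" n] by linarith
    qed
    have "a \<bullet> e \<le> p \<bullet> e + L" using B0 L B(2)[of "p \<bullet> e + L"] B(2)[of "p \<bullet> e"] by force
    moreover have "p \<bullet> e \<le> c \<bullet> e" using B0 L B(3)[of "p \<bullet> e + L"] B(3)[of "p \<bullet> e"] by force
    ultimately show ?thesis
      unfolding mem_box
    proof (intro ballI conjI)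
      fix j :: 'a assume j: "j \<in> Basis"
      show "(a - L *\<^sub>R e) \<bullet> j \<le> p \<bullet> j"
        using \<open>a \<bullet> e \<le> p \<bullet> e + L\<close> i[OF j] j e by (cases "j = e") (auto simp: inner_diff_left inner_Basis)
      show "p \<bullet> j \<le> c \<bullet> j"
        using \<open>p \<bullet> e \<le> c \<bullet> e\<close> i[OF j] by (cases "j = e") auto
    qed
  qed
  have KH: "cbox (a - L *\<^sub>R e) c \<subseteq> H"
  proof
    fix p assume p: "p \<in> cbox (a - L *\<^sub>R e) c"
    \<comment> \<open>The least forward step that lifts \<open>p\<close> into the original box;
      going back by it remains in \<open>H\<close>.\<close>
    define s where "s = max 0 (a \<bullet> e - p \<bullet> e)"
    have "p + s *\<^sub>R e \<in> cbox a c"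
      unfolding mem_box
    proof
      fix j :: 'a assume j: "j \<in> Basis"
      have "(a - L *\<^sub>R e) \<bullet> j \<le> p \<bullet> j" "p \<bullet> j \<le> c \<bullet> j" using p j by (auto simp: mem_box)
      then show "a \<bullet> j \<le> (p + s *\<^sub>R e) \<bullet> j \<and> (p + s *\<^sub>R e) \<bullet> j \<le> c \<bullet> j"
        using j e ac[OF j] by (cases "j = e") (auto simp: inner_diff_left inner_add_left inner_Basis s_def)
    qed
    then have "(p + s *\<^sub>R e) - s *\<^sub>R e \<in> H" using K by (intro down) (auto simp: s_def)
    then show "p \<in> H" by simp
  qed
  show thesis
  proof
    show "\<phi> \<in> test_functions UNIV" "fun_support \<phi> \<subseteq> H"
      using test_functionI[of \<phi> "cbox (a - L *\<^sub>R e) c" UNIV, OF Ck supp] KH by auto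
    show "pderiv_fun e \<phi> p = box_bump a c n p - box_bump a c n (p + L *\<^sub>R e)" for p
    proof -
      have "(\<phi> has_derivative frechet_derivative \<phi> (at p)) (at p)"
        using C_k_SucE(1)[OF Ck[of 1, unfolded One_nat_def]] .
      then have "((\<lambda>s. \<phi> (p + s *\<^sub>R e)) has_derivative (\<lambda>s. frechet_derivative \<phi> (at p) (s *\<^sub>R e))) (at 0)"
        by (intro has_derivative_compose[of "\<lambda>s. p + s *\<^sub>R e" "\<lambda>s. s *\<^sub>R e" 0 UNIV \<phi>])
           (auto intro!: derivative_eq_intros)
      moreover have "linear (frechet_derivative \<phi> (at p))"
        by (rule has_derivative_linear) fact
      ultimately have 1: "((\<lambda>s. \<phi> (p + s *\<^sub>R e)) has_real_derivative pderiv_fun e \<phi> p) (at 0)"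
        by (simp add: has_field_derivative_def linear_cmul mult_commute_abs)
      have "((\<lambda>s. - (B (p \<bullet> e + s + L) + (-1) * B (p \<bullet> e + s)) * R p) has_real_derivative
         - (?b (p \<bullet> e + 0 + L) + (-1) * ?b (p \<bullet> e + 0)) * R p) (at 0)"
        by (auto intro!: derivative_eq_intros DERIV_chain2[OF B(1)])
      moreover have "(\<lambda>s. \<phi> (p + s *\<^sub>R e)) = (\<lambda>s. - (B (p \<bullet> e + s + L) + (-1) * B (p \<bullet> e + s)) * R p)"
        using e by (simp add: \<phi>_def R_shift inner_add_left fun_eq_iff)
      ultimately have "pderiv_fun e \<phi> p = - (?b (p \<bullet> e + 0 + L) + (-1) * ?b (p \<bullet> e + 0)) * R p"
        using 1 DERIV_unique by metis
      then show ?thesis unfolding split'[of p L] split[of p] by (simp add: algebra_simps)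
    qed
    show "\<phi> p = - (\<integral>t\<in>{0..L}. box_bump a c n (p + t *\<^sub>R e) \<partial>lborel)" for p
    proof -
      have "(\<integral>t. indicator {0..L} t *\<^sub>R ?b (p \<bullet> e + t) \<partial>lborel) = B (p \<bullet> e + L) - B (p \<bullet> e + 0)"
      proof (rule integral_FTC_Icc[OF L])
        fix t
        show "((\<lambda>t. B (p \<bullet> e + t)) has_vector_derivative ?b (p \<bullet> e + t)) (at t within {0..L})"
          unfolding has_real_derivative_iff_has_vector_derivative[symmetric]
          by (rule DERIV_chain2[OF B(1), of _ 1, simplified]) (auto intro!: derivative_eq_intros)
        show "continuous_on {0..L} (\<lambda>t. ?b (p \<bullet> e + t))"
          by (rule continuous_on_compose2[OF C_k_continuous[OF C_k_bump[of 0]]]) (auto intro!: continuous_intros)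
      qed
      then have "(\<integral>t\<in>{0..L}. ?b (p \<bullet> e + t) \<partial>lborel) * R p = (B (p \<bullet> e + L) - B (p \<bullet> e)) * R p"
        by (simp add: set_lebesgue_integral_def)
      then have "(\<integral>t\<in>{0..L}. ?b (p \<bullet> e + t) * R p \<partial>lborel) = (B (p \<bullet> e + L) - B (p \<bullet> e)) * R p"
        by (simp only: set_integral_mult_left)
      then show ?thesis unfolding split' by (simp only: \<phi>_def) (simp add: algebra_simps)
    qed
  qed
qed

lemma borel_measurable_shift_pair [measurable]:
  fixes g :: "'a::euclidean_space \<Rightarrow> 'c::topological_space" and e :: 'a
  assumes "g \<in> borel_measurable borel"
  shows "(\<lambda>(t :: real, p). g (p - t *\<^sub>R e)) \<in> borel_measurable (lborel \<Otimes>\<^sub>M lborel)"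
proof -
  have "(\<lambda>(t :: real, p). p - t *\<^sub>R e) \<in> lborel \<Otimes>\<^sub>M lborel \<rightarrow>\<^sub>M borel"
    by measurable
  from measurable_compose[OF this assms] show ?thesis by (simp add: case_prod_unfold)
qed

text \<open>Every slice at fixed \<open>t\<close> has the same integral of \<open>|g|\<close> by
  translation invariance. This is the licence for each later use of Fubini's theorem on line
  integrals.\<close>

lemma integrable_shift_pair:
  fixes g :: "'a::euclidean_space \<Rightarrow> real" and e :: 'a
  assumes g: "integrable lborel g"
  shows "integrable (lborel \<Otimes>\<^sub>M lborel) (\<lambda>(t, p). indicator {0..L} t * g (p - t *\<^sub>R e))"
proof (rule lborel_pair.Fubini_integrable)
  have [measurable]: "g \<in> borel_measurable borel" using borel_measurable_integrable[OF g] by simp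
  show "(\<lambda>(t, p). indicator {0..L} t * g (p - t *\<^sub>R e)) \<in> borel_measurable (lborel \<Otimes>\<^sub>M lborel)"
    using borel_measurable_shift_pair[of g e] unfolding case_prod_unfold by measurable
  have *: "integrable lborel (\<lambda>p. g (p - t *\<^sub>R e))" for t
    using integrable_translate[of g "- (t *\<^sub>R e)"] g by simp
  then show "AE t in lborel. integrable lborel (\<lambda>p. case (t, p) of (t, p) \<Rightarrow> indicator {0..L} t * g (p - t *\<^sub>R e))"
    by (intro AE_I2) simp
  have "(\<integral>p. \<bar>g (p - t *\<^sub>R e)\<bar> \<partial>lborel) = (\<integral>p. \<bar>g p\<bar> \<partial>lborel)" for t
    using integral_translate[of "\<lambda>p. \<bar>g p\<bar>" "- (t *\<^sub>R e)"] by simp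
  then have "(\<lambda>t. \<integral>p. norm (case (t, p) of (t, p) \<Rightarrow> indicator {0..L} t * g (p - t *\<^sub>R e)) \<partial>lborel)
     = (\<lambda>t. indicator {0..L} t * (\<integral>p. \<bar>g p\<bar> \<partial>lborel))"
    by (simp add: abs_mult fun_eq_iff)
  moreover have "integrable lborel (indicator {0..L} :: real \<Rightarrow> real)"
    by (intro integrable_real_indicator) (auto simp: emeasure_lborel_Icc_eq)
  ultimately show "integrable lborel (\<lambda>t. \<integral>p. norm (case (t, p) of (t, p) \<Rightarrow> indicator {0..L} t * g (p - t *\<^sub>R e)) \<partial>lborel)"
    by simp
qed

text \<open>The shifts sit on the bump in the test function; translation invariance and Fubini's
  theorem move them onto \<open>w\<close> and \<open>g\<close>. The weak identity then says that
  \<open>?h\<close> integrates to zero against every box bump in \<open>H\<close>.\<close>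

lemma weak_deriv_increment:
  fixes w g :: "'a::euclidean_space \<Rightarrow> real"
  assumes w: "integrable lborel w" and g: "integrable lborel g" and e: "e \<in> Basis"
    and H: "open H" "\<And>p t. p \<in> H \<Longrightarrow> t \<ge> 0 \<Longrightarrow> p - t *\<^sub>R e \<in> H" and L: "L \<ge> 0"
    and weak: "\<And>\<phi>. \<phi> \<in> test_functions UNIV \<Longrightarrow> fun_support \<phi> \<subseteq> H \<Longrightarrow>
                 (\<integral>p. pderiv_fun e \<phi> p * w p + \<phi> p * g p \<partial>lborel) = 0"
  shows "AE p in lborel. p \<in> H \<longrightarrow> w p - w (p - L *\<^sub>R e) = (\<integral>t\<in>{0..L}. g (p - t *\<^sub>R e) \<partial>lborel)"
proof -
  have [measurable]: "w \<in> borel_measurable borel" "g \<in> borel_measurable borel"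
    using borel_measurable_integrable[OF g] borel_measurable_integrable[OF w] by simp_all
  define J where "J p = (\<integral>t\<in>{0..L}. g (p - t *\<^sub>R e) \<partial>lborel)" for p
  let ?h = "\<lambda>p. w p - w (p - L *\<^sub>R e) - J p"
  note pair = integrable_shift_pair[OF g, of L e]
  have J: "integrable lborel J"
    using lborel_pair.integrable_snd[OF pair] by (simp add: J_def[abs_def] set_lebesgue_integral_def)
  have wL: "integrable lborel (\<lambda>p. w (p - L *\<^sub>R e))"
    using integrable_translate[of w "- (L *\<^sub>R e)"] w by simp
  have h: "integrable lborel ?h" using w wL J by simp
  have bumpI: "integrable lborel (\<lambda>p. box_bump a c n p * f p)" if "integrable lborel f" for a c n and f :: "'a \<Rightarrow> real"
  proof (rule Bochner_Integration.integrable_bound[OF that])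
    show "(\<lambda>p. box_bump a c n p * f p) \<in> borel_measurable lborel"
      using borel_measurable_integrable[OF that] by simp
    show "AE p in lborel. norm (box_bump a c n p * f p) \<le> norm (f p)"
      using box_bump_nonneg[of a c n] box_bump_le_1[of a c n]
      by (intro AE_I2) (simp add: abs_mult mult_left_le_one_le)
  qed
  have "AE p in lebesgue. p \<in> H \<longrightarrow> ?h p = 0"
  proof (rule fundamental_lemma[OF H(1)])
    fix a c :: 'a and n
    have I: "integrable lborel (\<lambda>p. indicator (cbox a c) p * ?h p)"
      using integrable_mult_indicator[OF _ h, of "cbox a c"] by simp
    show "integrable lebesgue (\<lambda>p. indicator (cbox a c) p * ?h p)"
      using I integrable_completion[OF borel_measurable_integrable[OF I]] by (rule iffD2[rotated])
    assume K: "cbox a c \<subseteq> H"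
    let ?\<psi> = "box_bump a c n"
    have "(\<integral>p. ?\<psi> p * ?h p \<partial>lborel) = 0"
    proof (cases "box a c = {}")
      case True
      then show ?thesis by (simp add: box_bump_eq_0)
    next
      case False
      obtain \<phi> where \<phi>: "\<phi> \<in> test_functions UNIV" "fun_support \<phi> \<subseteq> H"
        "\<And>p. pderiv_fun e \<phi> p = ?\<psi> p - ?\<psi> (p + L *\<^sub>R e)"
        "\<And>p. \<phi> p = - (\<integral>t\<in>{0..L}. ?\<psi> (p + t *\<^sub>R e) \<partial>lborel)"
      proof (rule box_bump_line_integral[OF e L False K, of n])
        show "p - t *\<^sub>R e \<in> H" if "p \<in> H" "t \<ge> 0" for p t using H(2) that by blast
      qed (rule that)
      have pair_mult: "integrable (lborel \<Otimes>\<^sub>M lborel) (\<lambda>(t, p). indicator {0..L} t * (g (p - t *\<^sub>R e) * ?\<psi> p))"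
      proof (rule Bochner_Integration.integrable_bound[OF pair])
        show "(\<lambda>(t, p). indicator {0..L} t * (g (p - t *\<^sub>R e) * ?\<psi> p)) \<in> borel_measurable (lborel \<Otimes>\<^sub>M lborel)"
          using borel_measurable_shift_pair[of g e] unfolding case_prod_unfold by measurable
        show "AE x in lborel \<Otimes>\<^sub>M lborel. norm (case x of (t, p) \<Rightarrow> indicator {0..L} t * (g (p - t *\<^sub>R e) * ?\<psi> p))
           \<le> norm (case x of (t, p) \<Rightarrow> indicator {0..L} t * g (p - t *\<^sub>R e))"
          using box_bump_nonneg[of a c n] box_bump_le_1[of a c n]
          by (intro AE_I2) (auto simp: abs_mult intro!: mult_left_mono mult_left_le)
      qed
      have pair_mult': "integrable (lborel \<Otimes>\<^sub>M lborel) (\<lambda>(t, p). indicator {0..L} t * (g p * ?\<psi> (p + t *\<^sub>R e)))"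
      proof (rule Bochner_Integration.integrable_bound)
        \<comment> \<open>The direction 0 turns the lemma on shifted functions into integrability of
          \<open>g\<close> over the strip, without any shift.\<close>
        show "integrable (lborel \<Otimes>\<^sub>M lborel) (\<lambda>(t, p). indicator {0..L} t * g (p - t *\<^sub>R 0))"
          by (rule integrable_shift_pair[OF g])
        show "(\<lambda>(t, p). indicator {0..L} t * (g p * ?\<psi> (p + t *\<^sub>R e))) \<in> borel_measurable (lborel \<Otimes>\<^sub>M lborel)"
          using borel_measurable_shift_pair[of "?\<psi>" "- e"] unfolding case_prod_unfold by simp
        show "AE x in lborel \<Otimes>\<^sub>M lborel. norm (case x of (t, p) \<Rightarrow> indicator {0..L} t * (g p * ?\<psi> (p + t *\<^sub>R e)))
           \<le> norm (case x of (t, p) \<Rightarrow> indicator {0..L} t * g (p - t *\<^sub>R 0))"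
          using box_bump_nonneg[of a c n] box_bump_le_1[of a c n]
          by (intro AE_I2) (auto simp: abs_mult intro!: mult_left_mono mult_left_le)
      qed
      have "(\<integral>p. ?\<psi> p * J p \<partial>lborel) = (\<integral>p. (\<integral>t. indicator {0..L} t * (g (p - t *\<^sub>R e) * ?\<psi> p) \<partial>lborel) \<partial>lborel)"
        unfolding J_def set_lebesgue_integral_def
        by (simp flip: integral_mult_right_zero integral_mult_left_zero add: ac_simps)
      also have "\<dots> = (\<integral>t. (\<integral>p. indicator {0..L} t * (g (p - t *\<^sub>R e) * ?\<psi> p) \<partial>lborel) \<partial>lborel)"
        by (rule lborel_pair.Fubini_integral[OF pair_mult])
      also have "\<dots> = (\<integral>t. (\<integral>p. indicator {0..L} t * (g p * ?\<psi> (p + t *\<^sub>R e)) \<partial>lborel) \<partial>lborel)"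
      proof (rule Bochner_Integration.integral_cong[OF refl])
        fix t :: real
        show "(\<integral>p. indicator {0..L} t * (g (p - t *\<^sub>R e) * ?\<psi> p) \<partial>lborel)
           = (\<integral>p. indicator {0..L} t * (g p * ?\<psi> (p + t *\<^sub>R e)) \<partial>lborel)"
          using integral_translate[of "\<lambda>p. indicator {0..L} t * (g (p - t *\<^sub>R e) * ?\<psi> p)" "t *\<^sub>R e", symmetric] by simp
      qed
      also have "\<dots> = (\<integral>p. (\<integral>t. indicator {0..L} t * (g p * ?\<psi> (p + t *\<^sub>R e)) \<partial>lborel) \<partial>lborel)"
        by (rule lborel_pair.Fubini_integral[OF pair_mult', symmetric])
      also have "\<dots> = (\<integral>p. - (\<phi> p * g p) \<partial>lborel)"
        unfolding \<phi>(4) set_lebesgue_integral_def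
        by (simp flip: integral_mult_right_zero integral_mult_left_zero add: ac_simps)
      finally have 1: "(\<integral>p. ?\<psi> p * J p \<partial>lborel) = - (\<integral>p. \<phi> p * g p \<partial>lborel)" by simp
      have 2: "(\<integral>p. ?\<psi> p * w (p - L *\<^sub>R e) \<partial>lborel) = (\<integral>p. ?\<psi> (p + L *\<^sub>R e) * w p \<partial>lborel)"
        using integral_translate[of "\<lambda>p. ?\<psi> p * w (p - L *\<^sub>R e)" "L *\<^sub>R e"] by simp
      have I1: "integrable lborel (\<lambda>p. ?\<psi> (p + L *\<^sub>R e) * w p)"
        using integrable_translate[of "\<lambda>p. ?\<psi> p * w (p - L *\<^sub>R e)" "L *\<^sub>R e"] bumpI[OF wL] by simp
      have I2: "integrable lborel (\<lambda>p. \<phi> p * g p)"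
      proof -
        obtain B where B: "\<And>p. \<bar>\<phi> p\<bar> \<le> B" using test_function_bounded[OF \<phi>(1)] by metis
        show ?thesis
        proof (rule Bochner_Integration.integrable_bound)
          show "integrable lborel (\<lambda>p. B * g p)" using g by simp
          have "\<bar>\<phi> p\<bar> \<le> \<bar>B\<bar>" for p using B[of p] by linarith
          then show "AE p in lborel. norm (\<phi> p * g p) \<le> norm (B * g p)"
            by (intro AE_I2) (simp add: abs_mult mult_right_mono)
          show "(\<lambda>p. \<phi> p * g p) \<in> borel_measurable lborel"
            using borel_measurable_test_function[OF \<phi>(1)] by simp
        qed
      qed
      have "0 = (\<integral>p. pderiv_fun e \<phi> p * w p + \<phi> p * g p \<partial>lborel)"
        using weak[OF \<phi>(1,2)] by simp
      also have "\<dots> = (\<integral>p. ?\<psi> p * w p - ?\<psi> (p + L *\<^sub>R e) * w p + \<phi> p * g p \<partial>lborel)"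
        by (simp add: \<phi>(3) left_diff_distrib)
      also have "\<dots> = (\<integral>p. ?\<psi> p * w p \<partial>lborel) - (\<integral>p. ?\<psi> (p + L *\<^sub>R e) * w p \<partial>lborel) + (\<integral>p. \<phi> p * g p \<partial>lborel)"
        using bumpI[OF w] I1 I2 by simp
      also have "\<dots> = (\<integral>p. ?\<psi> p * w p \<partial>lborel) - (\<integral>p. ?\<psi> p * w (p - L *\<^sub>R e) \<partial>lborel) - (\<integral>p. ?\<psi> p * J p \<partial>lborel)"
        unfolding 1 2 by simp
      also have "\<dots> = (\<integral>p. ?\<psi> p * ?h p \<partial>lborel)"
        using bumpI[OF w] bumpI[OF wL] bumpI[OF J] by (simp add: right_diff_distrib)
      finally show ?thesis by simp
    qed
    then show "(\<integral>p. ?\<psi> p * ?h p \<partial>lebesgue) = 0"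
      using integral_completion[OF borel_measurable_integrable[OF bumpI[OF h, of a c n]]] by (rule trans[rotated])
  qed
  then have "AE p in lborel. p \<in> H \<longrightarrow> ?h p = 0" by (simp add: AE_completion_iff)
  then show ?thesis by eventually_elim (simp add: J_def)
qed

text \<open>Almost every line in direction \<open>e\<close> meets a null set in a null set. The
  exceptional set is first enlarged to a measurable one, so that the order of the two quantifiers
  can be exchanged.\<close>

lemma AE_AE_translate:
  fixes e :: "'a::euclidean_space"
  assumes "AE p in lborel. P p"
  shows "AE p in lborel. AE t :: real in lborel. P (p - t *\<^sub>R e)"
proof -
  obtain N where N: "N \<in> null_sets lborel" "{p. \<not> P p} \<subseteq> N"
    using assms by (auto simp: eventually_ae_filter)
  then have [measurable]: "N \<in> sets borel" by auto
  have "AE p in lborel. p \<notin> N" using N(1) by (rule AE_not_in)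
  then have "AE p in lborel. p - t *\<^sub>R e \<notin> N" for t
    using AE_translate[of "\<lambda>p. p \<notin> N" "- (t *\<^sub>R e)"] by simp
  then have *: "AE t :: real in lborel. AE p in lborel. p - t *\<^sub>R e \<notin> N" by simp
  have "{x \<in> space (lborel \<Otimes>\<^sub>M lborel). snd x - fst x *\<^sub>R e \<notin> N} \<in> sets (lborel \<Otimes>\<^sub>M lborel)"
    by measurable
  from lborel_pair.AE_commute[of "\<lambda>t p. p - t *\<^sub>R e \<notin> N", OF this] *
  have "AE p in lborel. AE t :: real in lborel. p - t *\<^sub>R e \<notin> N" by blast
  then show ?thesis
  proof eventually_elim
    case (elim p)
    then show ?case by eventually_elim (use N(2) in blast)
  qed
qed

text \<open>Stated with extended nonnegative integrals, so that it can be applied on every line: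
  where \<open>f\<close> is not integrable, the left-hand integral is 0 by convention.\<close>

lemma Cauchy_Schwarz_Icc:
  fixes f :: "real \<Rightarrow> real"
  assumes [measurable]: "f \<in> borel_measurable borel" and L: "L \<ge> 0"
  shows "ennreal ((\<integral>t\<in>{0..L}. f t \<partial>lborel)\<^sup>2) \<le> ennreal L * (\<integral>\<^sup>+t. indicator {0..L} t * ennreal ((f t)\<^sup>2) \<partial>lborel)"
proof -
  have "ennreal \<bar>\<integral>t\<in>{0..L}. f t \<partial>lborel\<bar> \<le> (\<integral>\<^sup>+t. ennreal (norm (indicator {0..L} t *\<^sub>R f t)) \<partial>lborel)"
  proof (cases "integrable lborel (\<lambda>t. indicator {0..L} t *\<^sub>R f t)")
    case True
    from integral_norm_bound_ennreal[OF this] show ?thesis by (simp add: set_lebesgue_integral_def)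
  qed (simp add: set_lebesgue_integral_def not_integrable_integral_eq)
  also have "\<dots> = (\<integral>\<^sup>+t. indicator {0..L} t * ennreal \<bar>f t\<bar> \<partial>lborel)"
    by (intro nn_integral_cong) (auto simp: indicator_def)
  finally have "(ennreal \<bar>\<integral>t\<in>{0..L}. f t \<partial>lborel\<bar>)\<^sup>2 \<le> (\<integral>\<^sup>+t. indicator {0..L} t * ennreal \<bar>f t\<bar> \<partial>lborel)\<^sup>2"
    by (rule power_mono) simp
  also have "\<dots> = (\<integral>\<^sup>+t. indicator {0..L} t * (indicator {0..L} t * ennreal \<bar>f t\<bar>) \<partial>lborel)\<^sup>2"
    by (intro arg_cong[where f="\<lambda>x. x\<^sup>2"] nn_integral_cong) (auto simp: indicator_def)
  also have "\<dots> \<le> (\<integral>\<^sup>+t. (indicator {0..L} t)\<^sup>2 \<partial>lborel) * (\<integral>\<^sup>+t. (indicator {0..L} t * ennreal \<bar>f t\<bar>)\<^sup>2 \<partial>lborel)"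
    by (rule Cauchy_Schwarz_nn_integral) auto
  also have "(\<integral>\<^sup>+t. (indicator {0..L} t)\<^sup>2 \<partial>lborel) = (\<integral>\<^sup>+t. indicator {0..L} t \<partial>lborel)"
    by (intro nn_integral_cong) (auto simp: indicator_def)
  also have "\<dots> = ennreal L" using L by simp
  also have "(\<integral>\<^sup>+t. (indicator {0..L} t * ennreal \<bar>f t\<bar>)\<^sup>2 \<partial>lborel) = (\<integral>\<^sup>+t. indicator {0..L} t * ennreal ((f t)\<^sup>2) \<partial>lborel)"
    by (intro nn_integral_cong) (auto simp: indicator_def ennreal_power)
  finally show ?thesis by (simp add: ennreal_power)
qed

text \<open>With \<open>- e\<close> and \<open>- g\<close> in place of \<open>e\<close> and \<open>g\<close>, this expresses that the extension of \<open>w\<close> by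
  zero is absolutely continuous with derivative \<open>g\<close> on the part beyond \<open>p\<close> of almost every line
  in direction \<open>e\<close>.\<close>

definition line_rep :: "'a::euclidean_space set \<Rightarrow> real \<Rightarrow> 'a \<Rightarrow> ('a \<Rightarrow> real) \<Rightarrow> ('a \<Rightarrow> real) \<Rightarrow> bool" where
  "line_rep G L e w g \<longleftrightarrow> w \<in> borel_measurable borel \<and> g \<in> borel_measurable borel
     \<and> (\<forall>p. p \<notin> G \<longrightarrow> w p = 0 \<and> g p = 0)
     \<and> integrable lborel (\<lambda>p. (w p)\<^sup>2) \<and> integrable lborel (\<lambda>p. (g p)\<^sup>2)
     \<and> (AE p in lborel. p \<in> G \<longrightarrow> w p = (\<integral>t\<in>{0..L}. g (p - t *\<^sub>R e) \<partial>lborel))"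

text \<open>\<open>L\<close> exceeds all distances within \<open>G\<close>, so a step of length
  \<open>L\<close> in a unit direction leaves \<open>G\<close> and arrives where the extension
  vanishes.\<close>

definition wide :: "'a::euclidean_space set \<Rightarrow> real \<Rightarrow> bool" where
  "wide G L \<longleftrightarrow> open G \<and> bounded G \<and> L \<ge> 0 \<and> (\<forall>p\<in>G. \<forall>q\<in>G. dist p q < L)"

lemma bounded_imp_wide:
  assumes "open G" "bounded G"
  obtains L where "wide G L" "L > 0"
proof -
  obtain R where R: "\<And>p. p \<in> G \<Longrightarrow> norm p \<le> R" using assms(2) by (auto simp: bounded_iff)
  define L where "L = 2 * \<bar>R\<bar> + 1"
  have "dist p q < L" if "p \<in> G" "q \<in> G" for p q
    using R[OF that(1)] R[OF that(2)] norm_triangle_ineq4[of p q] unfolding L_def dist_norm by linarith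
  then show thesis using assms by (intro that[of L]) (auto simp: wide_def L_def)
qed

lemma square_integrable_imp_integrable:
  fixes f :: "'a::euclidean_space \<Rightarrow> real"
  assumes [measurable]: "f \<in> borel_measurable borel" and sq: "integrable lborel (\<lambda>p. (f p)\<^sup>2)"
    and z: "\<And>p. p \<notin> G \<Longrightarrow> f p = 0" and G: "open G" "bounded G"
  shows "integrable lborel f"
proof (rule Bochner_Integration.integrable_bound)
  have "emeasure lborel G < \<infinity>" using emeasure_bounded_finite[OF G(2)] by simp
  then have "integrable lborel (indicator G :: 'a \<Rightarrow> real)"
    using G(1) by (intro integrable_real_indicator) auto
  then show "integrable lborel (\<lambda>p. indicator G p + (f p)\<^sup>2)" using sq by simp
  have "\<bar>f p\<bar> \<le> indicator G p + (f p)\<^sup>2" for p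
  proof (cases "p \<in> G")
    case True
    have "0 \<le> (\<bar>f p\<bar> - 1)\<^sup>2 + \<bar>f p\<bar>" by simp
    also have "\<dots> = 1 + (f p)\<^sup>2 - \<bar>f p\<bar>" by (simp add: power2_eq_square algebra_simps)
    finally show ?thesis using True by simp
  qed (simp add: z)
  then show "AE p in lborel. norm (f p) \<le> norm (indicator G p + (f p)\<^sup>2)"
    by (intro AE_I2) (simp add: abs_of_nonneg)
qed simp

lemma line_repD:
  assumes "line_rep G L e w g"
  shows "w \<in> borel_measurable borel" "g \<in> borel_measurable borel"
    "p \<notin> G \<Longrightarrow> w p = 0" "p \<notin> G \<Longrightarrow> g p = 0"
    "integrable lborel (\<lambda>p. (w p)\<^sup>2)" "integrable lborel (\<lambda>p. (g p)\<^sup>2)"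
    "AE p in lborel. p \<in> G \<longrightarrow> w p = (\<integral>t\<in>{0..L}. g (p - t *\<^sub>R e) \<partial>lborel)"
  using assms by (auto simp: line_rep_def)

text \<open>In the increment over length \<open>L\<close> one of the two values is zero, because one
  end of the segment lies outside \<open>G\<close>. Taking the increment at \<open>p + L e\<close>
  instead of \<open>p\<close> and substituting \<open>L - t\<close> for \<open>t\<close> gives the
  representation from the other side; for this the forward point must also lie in
  \<open>H\<close>.\<close>

lemma line_rep_of_weak_deriv:
  fixes w g :: "'a::euclidean_space \<Rightarrow> real"
  assumes m: "w \<in> borel_measurable borel" "g \<in> borel_measurable borel"
    and z: "\<And>p. p \<notin> G \<Longrightarrow> w p = 0" "\<And>p. p \<notin> G \<Longrightarrow> g p = 0"
    and sq: "integrable lborel (\<lambda>p. (w p)\<^sup>2)" "integrable lborel (\<lambda>p. (g p)\<^sup>2)"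
    and G: "wide G L" "G \<subseteq> H" and e: "e \<in> Basis"
    and H: "open H" "\<And>p t. p \<in> H \<Longrightarrow> t \<ge> 0 \<Longrightarrow> p - t *\<^sub>R e \<in> H"
    and weak: "\<And>\<phi>. \<phi> \<in> test_functions UNIV \<Longrightarrow> fun_support \<phi> \<subseteq> H \<Longrightarrow>
                 (\<integral>p. pderiv_fun e \<phi> p * w p + \<phi> p * g p \<partial>lborel) = 0"
  shows "line_rep G L e w g"
    and "(\<And>p t. p \<in> H \<Longrightarrow> t \<ge> 0 \<Longrightarrow> p + t *\<^sub>R e \<in> H) \<Longrightarrow> line_rep G L (- e) w (\<lambda>p. - g p)"
proof -
  have G': "open G" "bounded G" "L \<ge> 0" and far: "\<And>p q. p \<in> G \<Longrightarrow> q \<in> G \<Longrightarrow> dist p q < L"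
    using G(1) by (auto simp: wide_def)
  have I: "integrable lborel w" "integrable lborel g"
    using square_integrable_imp_integrable[OF m(1) sq(1) z(1) G'(1,2)]
      square_integrable_imp_integrable[OF m(2) sq(2) z(2) G'(1,2)] by auto
  have inc: "AE p in lborel. p \<in> H \<longrightarrow> w p - w (p - L *\<^sub>R e) = (\<integral>t\<in>{0..L}. g (p - t *\<^sub>R e) \<partial>lborel)"
    by (rule weak_deriv_increment[OF I e H(1) _ G'(3)]) (fact H(2), fact weak)
  have out: "p - L *\<^sub>R e \<notin> G" "p + L *\<^sub>R e \<notin> G" if "p \<in> G" for p
    using far[OF that, of "p - L *\<^sub>R e"] far[OF that, of "p + L *\<^sub>R e"] e G'(3) by (auto simp: dist_norm)
  have "AE p in lborel. p \<in> G \<longrightarrow> w p = (\<integral>t\<in>{0..L}. g (p - t *\<^sub>R e) \<partial>lborel)"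
    using inc by eventually_elim (use z(1) out(1) G(2) in auto)
  with m z sq show "line_rep G L e w g" by (auto simp: line_rep_def)
  assume H': "\<And>p t. p \<in> H \<Longrightarrow> t \<ge> 0 \<Longrightarrow> p + t *\<^sub>R e \<in> H"
  have reflect: "(\<integral>t\<in>{0..L}. g (p + L *\<^sub>R e - t *\<^sub>R e) \<partial>lborel) = (\<integral>t\<in>{0..L}. g (p + t *\<^sub>R e) \<partial>lborel)" for p
  proof -
    have "(\<integral>t. indicator {0..L} t *\<^sub>R g (p + L *\<^sub>R e - t *\<^sub>R e) \<partial>lborel)
       = (\<integral>t. indicator {0..L} (L + (-1) * t) *\<^sub>R g (p + L *\<^sub>R e - (L + (-1) * t) *\<^sub>R e) \<partial>lborel)"
      using lborel_integral_real_affine[of "-1" "\<lambda>t. indicator {0..L} t *\<^sub>R g (p + L *\<^sub>R e - t *\<^sub>R e)" L] by simp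
    also have "\<dots> = (\<integral>t. indicator {0..L} t *\<^sub>R g (p + t *\<^sub>R e) \<partial>lborel)"
      by (intro Bochner_Integration.integral_cong) (auto simp: indicator_def algebra_simps)
    finally show ?thesis by (simp add: set_lebesgue_integral_def)
  qed
  have "AE p in lborel. p + L *\<^sub>R e \<in> H \<longrightarrow> w (p + L *\<^sub>R e) - w p = (\<integral>t\<in>{0..L}. g (p + L *\<^sub>R e - t *\<^sub>R e) \<partial>lborel)"
    using AE_translate[OF inc, of "L *\<^sub>R e"] by simp
  then have "AE p in lborel. p \<in> G \<longrightarrow> w p = (\<integral>t\<in>{0..L}. - g (p - t *\<^sub>R (- e)) \<partial>lborel)"
  proof eventually_elim
    case (elim p)
    show ?case
    proof
      assume p: "p \<in> G"
      then have "p + L *\<^sub>R e \<in> H" using G(2) H' G'(3) by blast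
      with elim z(1)[OF out(2)[OF p]] show "w p = (\<integral>t\<in>{0..L}. - g (p - t *\<^sub>R (- e)) \<partial>lborel)"
        using reflect[of p] by (simp add: set_lebesgue_integral_def)
    qed
  qed
  with m z sq show "line_rep G L (- e) w (\<lambda>p. - g p)" by (auto simp: line_rep_def)
qed

section \<open>Poincare's inequality, squares and integration by parts along lines\<close>

lemma nn_integral_line:
  fixes g :: "'a::euclidean_space \<Rightarrow> ennreal"
  assumes [measurable]: "g \<in> borel_measurable borel" and L: "L \<ge> 0"
  shows "(\<integral>\<^sup>+p. (\<integral>\<^sup>+t. indicator {0..L} t * g (p - t *\<^sub>R e) \<partial>lborel) \<partial>lborel) = ennreal L * (\<integral>\<^sup>+p. g p \<partial>lborel)"
proof -
  have "(\<integral>\<^sup>+p. (\<integral>\<^sup>+t. indicator {0..L} t * g (p - t *\<^sub>R e) \<partial>lborel) \<partial>lborel)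
     = (\<integral>\<^sup>+t. (\<integral>\<^sup>+p. indicator {0..L} t * g (p - t *\<^sub>R e) \<partial>lborel) \<partial>lborel)"
    by (rule lborel_pair.Fubini')
       (use borel_measurable_shift_pair[of g e] in \<open>unfold case_prod_unfold, measurable\<close>)
  also have "\<dots> = (\<integral>\<^sup>+t. indicator {0..L} t * (\<integral>\<^sup>+p. g p \<partial>lborel) \<partial>lborel)"
    using nn_integral_translate[of g "- (_ *\<^sub>R e)"] by (simp add: nn_integral_cmult)
  also have "\<dots> = ennreal L * (\<integral>\<^sup>+p. g p \<partial>lborel)"
    using L by (simp add: nn_integral_multc)
  finally show ?thesis .
qed

lemma line_rep_pointwise:
  assumes "line_rep G L e w g" "L \<ge> 0"
  shows "AE p in lborel. ennreal ((w p)\<^sup>2) \<le> ennreal L * (\<integral>\<^sup>+t. indicator {0..L} t * ennreal ((g (p - t *\<^sub>R e))\<^sup>2) \<partial>lborel)"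
  using line_repD(7)[OF assms(1)]
proof eventually_elim
  case (elim p)
  note [measurable] = line_repD(2)[OF assms(1)]
  show ?case
  proof (cases "p \<in> G")
    case True
    then show ?thesis using Cauchy_Schwarz_Icc[of "\<lambda>t. g (p - t *\<^sub>R e)" L] elim assms(2) by simp
  qed (simp add: line_repD(3)[OF assms(1)])
qed

lemma line_rep_poincare:
  assumes "line_rep G L e w g" "L \<ge> 0"
  shows "(\<integral>\<^sup>+p. ennreal ((w p)\<^sup>2) \<partial>lborel) \<le> ennreal (L\<^sup>2) * (\<integral>\<^sup>+p. ennreal ((g p)\<^sup>2) \<partial>lborel)"
proof -
  note [measurable] = line_repD(2)[OF assms(1)]
  have "(\<integral>\<^sup>+p. ennreal ((w p)\<^sup>2) \<partial>lborel)
      \<le> (\<integral>\<^sup>+p. ennreal L * (\<integral>\<^sup>+t. indicator {0..L} t * ennreal ((g (p - t *\<^sub>R e))\<^sup>2) \<partial>lborel) \<partial>lborel)"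
    by (rule nn_integral_mono_AE[OF line_rep_pointwise[OF assms]])
  also have "\<dots> = ennreal L * (\<integral>\<^sup>+p. (\<integral>\<^sup>+t. indicator {0..L} t * ennreal ((g (p - t *\<^sub>R e))\<^sup>2) \<partial>lborel) \<partial>lborel)"
    using borel_measurable_shift_pair[of "\<lambda>p. ennreal ((g p)\<^sup>2)" e]
    by (intro nn_integral_cmult lborel.borel_measurable_nn_integral) (unfold case_prod_unfold, measurable)
  also have "\<dots> = ennreal L * (ennreal L * (\<integral>\<^sup>+p. ennreal ((g p)\<^sup>2) \<partial>lborel))"
    by (subst nn_integral_line[of "\<lambda>p. ennreal ((g p)\<^sup>2)"]) (use assms(2) in auto)
  also have "\<dots> = ennreal (L\<^sup>2) * (\<integral>\<^sup>+p. ennreal ((g p)\<^sup>2) \<partial>lborel)"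
    using assms(2) by (simp add: power2_eq_square ennreal_mult mult.assoc)
  finally show ?thesis .
qed

lemma abs_mult_le_squares:
  fixes x y :: real
  shows "\<bar>x * y\<bar> \<le> x\<^sup>2 + y\<^sup>2"
proof -
  have "2 * (\<bar>x\<bar> * \<bar>y\<bar>) \<le> x\<^sup>2 + y\<^sup>2"
    using sum_squares_bound[of "\<bar>x\<bar>" "\<bar>y\<bar>"] by (simp add: mult.assoc)
  moreover have "0 \<le> \<bar>x\<bar> * \<bar>y\<bar>" by simp
  ultimately show ?thesis unfolding abs_mult by linarith
qed

text \<open>The square is the integral of \<open>F t * F r\<close> over the plane, and reflection in
  the diagonal exchanges the two half planes.\<close>

lemma integral_square_eq:
  fixes F :: "real \<Rightarrow> real"
  assumes F: "integrable lborel F"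
  shows "(\<integral>t. F t \<partial>lborel)\<^sup>2 = 2 * (\<integral>t. F t * (\<integral>r. (if t \<le> r then F r else 0) \<partial>lborel) \<partial>lborel)"
proof -
  have [measurable]: "F \<in> borel_measurable borel" using borel_measurable_integrable[OF F] by simp
  have pair: "integrable (lborel \<Otimes>\<^sub>M lborel) (\<lambda>(t, r). F t * F r)"
  proof (rule lborel_pair.Fubini_integrable)
    show "(\<lambda>(t, r). F t * F r) \<in> borel_measurable (lborel \<Otimes>\<^sub>M lborel)" by measurable
    show "integrable lborel (\<lambda>t. \<integral>r. norm (case (t, r) of (t, r) \<Rightarrow> F t * F r) \<partial>lborel)"
      using F by (simp add: abs_mult)
    show "AE t in lborel. integrable lborel (\<lambda>r. case (t, r) of (t, r) \<Rightarrow> F t * F r)"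
      using F by simp
  qed
  let ?P = "\<lambda>t r. F t * (if t \<le> r then F r else 0)" and ?Q = "\<lambda>t r. F r * (if r < t then F t else 0)"
  have "(\<lambda>(t, r). ?P t r) \<in> borel_measurable (lborel \<Otimes>\<^sub>M lborel)" by measurable
  then have P: "integrable (lborel \<Otimes>\<^sub>M lborel) (\<lambda>(t, r). ?P t r)"
    by (intro Bochner_Integration.integrable_bound[OF pair]) (auto intro!: AE_I2)
  have "(\<lambda>(t, r). ?Q t r) \<in> borel_measurable (lborel \<Otimes>\<^sub>M lborel)" by measurable
  then have Q: "integrable (lborel \<Otimes>\<^sub>M lborel) (\<lambda>(t, r). ?Q t r)"
    by (intro Bochner_Integration.integrable_bound[OF pair]) (auto intro!: AE_I2 simp: mult.commute)
  have "(\<integral>t. F t \<partial>lborel)\<^sup>2 = (\<integral>t. (\<integral>r. F t * F r \<partial>lborel) \<partial>lborel)"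
    by (simp add: power2_eq_square)
  also have "\<dots> = (\<integral>x. (case x of (t, r) \<Rightarrow> F t * F r) \<partial>(lborel \<Otimes>\<^sub>M lborel))"
    by (rule lborel_pair.integral_fst[OF pair])
  also have "\<dots> = (\<integral>x. (case x of (t, r) \<Rightarrow> ?P t r) + (case x of (t, r) \<Rightarrow> ?Q t r) \<partial>(lborel \<Otimes>\<^sub>M lborel))"
    by (intro Bochner_Integration.integral_cong) auto
  also have "\<dots> = (\<integral>x. (case x of (t, r) \<Rightarrow> ?P t r) \<partial>(lborel \<Otimes>\<^sub>M lborel)) + (\<integral>x. (case x of (t, r) \<Rightarrow> ?Q t r) \<partial>(lborel \<Otimes>\<^sub>M lborel))"
    by (rule Bochner_Integration.integral_add[OF P Q])
  also have "\<dots> = (\<integral>t. (\<integral>r. ?P t r \<partial>lborel) \<partial>lborel) + (\<integral>r. (\<integral>t. ?Q t r \<partial>lborel) \<partial>lborel)"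
    unfolding lborel_pair.integral_fst[OF P] lborel_pair.integral_snd[OF Q] ..
  also have "(\<integral>r. (\<integral>t. ?Q t r \<partial>lborel) \<partial>lborel) = (\<integral>r. (\<integral>t. ?P r t \<partial>lborel) \<partial>lborel)"
  proof (rule Bochner_Integration.integral_cong[OF refl])
    fix r :: real
    \<comment> \<open>The two integrands differ only on the diagonal, which one of the half planes
      includes and the other excludes.\<close>
    have "AE t in lborel. ?Q t r = ?P r t"
      using AE_lborel_singleton[of r] by eventually_elim auto
    then show "(\<integral>t. ?Q t r \<partial>lborel) = (\<integral>t. ?P r t \<partial>lborel)"
      by (intro integral_cong_AE) auto
  qed
  finally show ?thesis by simp
qed

text \<open>The chain rule for \<open>w^2\<close> without smooth approximation: along a line
  \<open>w\<close> is an integral of \<open>g\<close>, and the square of an integral is twice the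
  integral of \<open>g\<close> times the remaining part, which is again a value of \<open>w\<close>.
  The bound on \<open>w\<close> keeps \<open>w^2\<close> and \<open>g w\<close> square
  integrable.\<close>

lemma line_rep_square:
  fixes w g :: "'a::euclidean_space \<Rightarrow> real"
  assumes r: "line_rep G L e w g" and G: "wide G L" and e: "norm e = 1" and B: "\<And>p. \<bar>w p\<bar> \<le> B"
  shows "line_rep G L e (\<lambda>p. (w p)\<^sup>2) (\<lambda>p. 2 * (g p * w p))"
proof -
  note [measurable] = line_repD(1,2)[OF r]
  have G': "open G" "bounded G" "L \<ge> 0" and far: "\<And>p q. p \<in> G \<Longrightarrow> q \<in> G \<Longrightarrow> dist p q < L"
    using G by (auto simp: wide_def)
  have gI: "integrable lborel g"
    using square_integrable_imp_integrable[OF line_repD(2)[OF r] line_repD(6)[OF r] line_repD(4)[OF r] G'(1,2)] .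
  have bsq: "(w p)\<^sup>2 \<le> B\<^sup>2" for p using B[of p] by (metis abs_ge_zero power2_abs power_mono)
  have 1: "integrable lborel (\<lambda>p. ((w p)\<^sup>2)\<^sup>2)"
  proof (rule Bochner_Integration.integrable_bound)
    show "integrable lborel (\<lambda>p. B\<^sup>2 * (w p)\<^sup>2)" using line_repD(5)[OF r] by simp
    show "AE p in lborel. norm (((w p)\<^sup>2)\<^sup>2) \<le> norm (B\<^sup>2 * (w p)\<^sup>2)"
    proof (intro AE_I2)
      fix p
      have "((w p)\<^sup>2)\<^sup>2 \<le> B\<^sup>2 * (w p)\<^sup>2"
        unfolding power2_eq_square[of "(w p)\<^sup>2"] by (intro mult_right_mono bsq) simp
      then show "norm (((w p)\<^sup>2)\<^sup>2) \<le> norm (B\<^sup>2 * (w p)\<^sup>2)" by simp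
    qed
  qed simp
  have 2: "integrable lborel (\<lambda>p. (2 * (g p * w p))\<^sup>2)"
  proof (rule Bochner_Integration.integrable_bound)
    show "integrable lborel (\<lambda>p. 4 * B\<^sup>2 * (g p)\<^sup>2)" using line_repD(6)[OF r] by simp
    show "AE p in lborel. norm ((2 * (g p * w p))\<^sup>2) \<le> norm (4 * B\<^sup>2 * (g p)\<^sup>2)"
    proof (intro AE_I2)
      fix p
      have "(2 * (g p * w p))\<^sup>2 = 4 * (g p)\<^sup>2 * (w p)\<^sup>2" by (simp add: power_mult_distrib)
      also have "\<dots> \<le> 4 * (g p)\<^sup>2 * B\<^sup>2" by (intro mult_left_mono bsq) simp
      finally show "norm ((2 * (g p * w p))\<^sup>2) \<le> norm (4 * B\<^sup>2 * (g p)\<^sup>2)" by (simp add: ac_simps)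
    qed
  qed simp
  have F_int: "AE p in lborel. integrable lborel (\<lambda>t. indicator {0..L} t * g (p - t *\<^sub>R e))"
    by (rule lborel_pair.AE_integrable_snd[OF integrable_shift_pair[OF gI]])
  \<comment> \<open>The representation of \<open>w\<close> is needed at \<open>p\<close> and also at
    almost every further point of the line through \<open>p\<close>.\<close>
  have 3: "AE p in lborel. p \<in> G \<longrightarrow> (w p)\<^sup>2 = (\<integral>t\<in>{0..L}. 2 * (g (p - t *\<^sub>R e) * w (p - t *\<^sub>R e)) \<partial>lborel)"
    using line_repD(7)[OF r] F_int AE_AE_translate[OF line_repD(7)[OF r], of e]
  proof eventually_elim
    case (elim p)
    show ?case
    proof
      assume p: "p \<in> G"
      define F where "F t = indicator {0..L} t * g (p - t *\<^sub>R e)" for t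
      have F: "integrable lborel F" using elim(2) by (simp add: F_def[abs_def])
      have [measurable]: "F \<in> borel_measurable borel" using borel_measurable_integrable[OF F] by simp
      \<comment> \<open>At \<open>p - t e\<close> the representation runs over the parameters from
        \<open>t\<close> to \<open>t + L\<close>; beyond \<open>L\<close> the line has left
        \<open>G\<close>, so it ends at \<open>L\<close> for all \<open>t\<close>.\<close>
      have out: "g (p - s *\<^sub>R e) = 0" if "s \<ge> L" for s
      proof (rule line_repD(4)[OF r])
        show "p - s *\<^sub>R e \<notin> G"
          using far[OF p, of "p - s *\<^sub>R e"] that e G'(3) by (auto simp: dist_norm)
      qed
      have ae: "AE t in lborel. indicator {0..L} t *\<^sub>R (g (p - t *\<^sub>R e) * w (p - t *\<^sub>R e))
          = F t * (\<integral>s. (if t \<le> s then F s else 0) \<partial>lborel)"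
        using elim(3)
      proof eventually_elim
        case (elim t)
        show ?case
        proof (cases "t \<in> {0..L} \<and> g (p - t *\<^sub>R e) \<noteq> 0")
          case True
          then have t: "p - t *\<^sub>R e \<in> G" "0 \<le> t" "t \<le> L" using line_repD(4)[OF r] by auto
          have "w (p - t *\<^sub>R e) = (\<integral>s. indicator {0..L} s *\<^sub>R g (p - t *\<^sub>R e - s *\<^sub>R e) \<partial>lborel)"
            using elim t(1) by (simp add: set_lebesgue_integral_def)
          also have "\<dots> = (\<integral>s. indicator {0..L} (- t + 1 * s) *\<^sub>R g (p - t *\<^sub>R e - (- t + 1 * s) *\<^sub>R e) \<partial>lborel)"
            using lborel_integral_real_affine[of 1 "\<lambda>s. indicator {0..L} s *\<^sub>R g (p - t *\<^sub>R e - s *\<^sub>R e)" "- t"] by simp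
          also have "\<dots> = (\<integral>s. (if t \<le> s then F s else 0) \<partial>lborel)"
          proof (intro Bochner_Integration.integral_cong refl)
            fix s
            have "p - t *\<^sub>R e - (- t + 1 * s) *\<^sub>R e = p - s *\<^sub>R e" by (simp add: algebra_simps)
            then have "g (p - t *\<^sub>R e - (- t + 1 * s) *\<^sub>R e) = g (p - s *\<^sub>R e)" by (rule arg_cong)
            then show "indicator {0..L} (- t + 1 * s) *\<^sub>R g (p - t *\<^sub>R e - (- t + 1 * s) *\<^sub>R e) = (if t \<le> s then F s else 0)"
              using t out[of s] unfolding F_def by (cases "s \<ge> L") (auto simp: indicator_def)
          qed
          finally show ?thesis using True by (simp add: F_def)
        qed (auto simp: F_def)
      qed
      have "(w p)\<^sup>2 = (\<integral>t. F t \<partial>lborel)\<^sup>2"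
        using elim(1) p by (simp add: set_lebesgue_integral_def F_def)
      also have "\<dots> = 2 * (\<integral>t. F t * (\<integral>s. (if t \<le> s then F s else 0) \<partial>lborel) \<partial>lborel)"
        by (rule integral_square_eq[OF F])
      also have "(\<integral>t. F t * (\<integral>s. (if t \<le> s then F s else 0) \<partial>lborel) \<partial>lborel)
        = (\<integral>t. indicator {0..L} t *\<^sub>R (g (p - t *\<^sub>R e) * w (p - t *\<^sub>R e)) \<partial>lborel)"
        using ae by (intro integral_cong_AE) (measurable, auto elim: eventually_mono)
      finally show "(w p)\<^sup>2 = (\<integral>t\<in>{0..L}. 2 * (g (p - t *\<^sub>R e) * w (p - t *\<^sub>R e)) \<partial>lborel)"
        by (simp add: set_integral_mult_right) (simp add: set_lebesgue_integral_def)
    qed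
  qed
  show ?thesis
    unfolding line_rep_def
  proof (intro conjI allI impI)
    show "(\<lambda>p. (w p)\<^sup>2) \<in> borel_measurable borel" "(\<lambda>p. 2 * (g p * w p)) \<in> borel_measurable borel"
      by measurable
    show "(w p)\<^sup>2 = 0" "2 * (g p * w p) = 0" if "p \<notin> G" for p using line_repD(3,4)[OF r that] by auto
  qed (fact 1 2 3)+
qed

text \<open>Integration by parts: representing one factor from below and the other one from above turns
  both integrals into the same double integral of \<open>g' p g (p - t e)\<close>.\<close>

lemma line_rep_pairing:
  fixes w g w' g' :: "'a::euclidean_space \<Rightarrow> real"
  assumes r: "line_rep G L e w g" and r': "line_rep G L (- e) w' g'"
  shows "(\<integral>p. g' p * w p \<partial>lborel) = (\<integral>p. w' p * g p \<partial>lborel)"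
proof -
  note [measurable] = line_repD(1,2)[OF r] line_repD(1,2)[OF r']
  note mg = borel_measurable_shift_pair[OF line_repD(2)[OF r], of e]
    and mg' = borel_measurable_shift_pair[OF line_repD(2)[OF r'], of "- e"]
  let ?K = "\<lambda>t p. indicator {0..L} t * (g' p * g (p - t *\<^sub>R e))"
    and ?K' = "\<lambda>t p. indicator {0..L} t * (g' (p - t *\<^sub>R (- e)) * g p)"
  have K: "integrable (lborel \<Otimes>\<^sub>M lborel) (\<lambda>(t, p). ?K t p)"
  proof (rule Bochner_Integration.integrable_bound)
    show "integrable (lborel \<Otimes>\<^sub>M lborel) (\<lambda>x. (case x of (t, p) \<Rightarrow> indicator {0..L} t * (g' (p - t *\<^sub>R 0))\<^sup>2)
       + (case x of (t, p) \<Rightarrow> indicator {0..L} t * (g (p - t *\<^sub>R e))\<^sup>2))"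
      by (intro Bochner_Integration.integrable_add integrable_shift_pair[of "\<lambda>p. (g p)\<^sup>2"]
          integrable_shift_pair[of "\<lambda>p. (g' p)\<^sup>2"] line_repD(6)[OF r] line_repD(6)[OF r'])
    show "(\<lambda>(t, p). ?K t p) \<in> borel_measurable (lborel \<Otimes>\<^sub>M lborel)"
      using mg unfolding case_prod_unfold by measurable
    show "AE x in lborel \<Otimes>\<^sub>M lborel. norm (case x of (t, p) \<Rightarrow> ?K t p) \<le> norm ((case x of (t, p) \<Rightarrow> indicator {0..L} t * (g' (p - t *\<^sub>R 0))\<^sup>2)
       + (case x of (t, p) \<Rightarrow> indicator {0..L} t * (g (p - t *\<^sub>R e))\<^sup>2))"
      using abs_mult_le_squares by (intro AE_I2) (auto simp: indicator_def)
  qed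
  have K': "integrable (lborel \<Otimes>\<^sub>M lborel) (\<lambda>(t, p). ?K' t p)"
  proof (rule Bochner_Integration.integrable_bound)
    show "integrable (lborel \<Otimes>\<^sub>M lborel) (\<lambda>x. (case x of (t, p) \<Rightarrow> indicator {0..L} t * (g' (p - t *\<^sub>R (- e)))\<^sup>2)
       + (case x of (t, p) \<Rightarrow> indicator {0..L} t * (g (p - t *\<^sub>R 0))\<^sup>2))"
      by (intro Bochner_Integration.integrable_add integrable_shift_pair[of "\<lambda>p. (g p)\<^sup>2"]
          integrable_shift_pair[of "\<lambda>p. (g' p)\<^sup>2"] line_repD(6)[OF r] line_repD(6)[OF r'])
    show "(\<lambda>(t, p). ?K' t p) \<in> borel_measurable (lborel \<Otimes>\<^sub>M lborel)"
      using mg' unfolding case_prod_unfold by measurable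
    show "AE x in lborel \<Otimes>\<^sub>M lborel. norm (case x of (t, p) \<Rightarrow> ?K' t p) \<le> norm ((case x of (t, p) \<Rightarrow> indicator {0..L} t * (g' (p - t *\<^sub>R (- e)))\<^sup>2)
       + (case x of (t, p) \<Rightarrow> indicator {0..L} t * (g (p - t *\<^sub>R 0))\<^sup>2))"
      using abs_mult_le_squares by (intro AE_I2) (auto simp: indicator_def)
  qed
  have "(\<integral>p. g' p * w p \<partial>lborel) = (\<integral>p. (\<integral>t. ?K t p \<partial>lborel) \<partial>lborel)"
  proof (rule integral_cong_AE)
    show "AE p in lborel. g' p * w p = (\<integral>t. ?K t p \<partial>lborel)"
      using line_repD(7)[OF r]
    proof eventually_elim
      case (elim p)
      show ?case
      proof (cases "p \<in> G")
        case True
        then have "g' p * w p = (\<integral>t. g' p * (indicator {0..L} t * g (p - t *\<^sub>R e)) \<partial>lborel)"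
          using elim by (simp add: set_lebesgue_integral_def)
        then show ?thesis by (simp add: ac_simps)
      qed (simp add: line_repD(4)[OF r'])
    qed
    show "(\<lambda>p. \<integral>t. ?K t p \<partial>lborel) \<in> borel_measurable lborel"
      using lborel_pair.integrable_snd[OF K] by (rule borel_measurable_integrable)
  qed simp
  also have "\<dots> = (\<integral>t. (\<integral>p. ?K t p \<partial>lborel) \<partial>lborel)"
    by (rule lborel_pair.Fubini_integral[OF K])
  also have "\<dots> = (\<integral>t. (\<integral>p. ?K' t p \<partial>lborel) \<partial>lborel)"
  proof (rule Bochner_Integration.integral_cong[OF refl])
    fix t :: real
    show "(\<integral>p. ?K t p \<partial>lborel) = (\<integral>p. ?K' t p \<partial>lborel)"
      using integral_translate[of "?K t" "t *\<^sub>R e", symmetric] by simp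
  qed
  also have "\<dots> = (\<integral>p. (\<integral>t. ?K' t p \<partial>lborel) \<partial>lborel)"
    by (rule lborel_pair.Fubini_integral[OF K', symmetric])
  also have "\<dots> = (\<integral>p. w' p * g p \<partial>lborel)"
  proof (rule integral_cong_AE)
    show "AE p in lborel. (\<integral>t. ?K' t p \<partial>lborel) = w' p * g p"
      using line_repD(7)[OF r']
    proof eventually_elim
      case (elim p)
      show ?case
      proof (cases "p \<in> G")
        case True
        then have "w' p * g p = (\<integral>t. (indicator {0..L} t * g' (p - t *\<^sub>R (- e))) * g p \<partial>lborel)"
          using elim by (simp add: set_lebesgue_integral_def)
        then show ?thesis by (auto simp: ac_simps)
      qed (simp add: line_repD(4)[OF r])
    qed
    show "(\<lambda>p. \<integral>t. ?K' t p \<partial>lborel) \<in> borel_measurable lborel"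
      using lborel_pair.integrable_snd[OF K'] by (rule borel_measurable_integrable)
  qed simp
  finally show ?thesis .
qed

lemma line_rep_integrable_mult:
  assumes "line_rep G L e w g" "line_rep G' L' e' w' g'"
  shows "integrable lborel (\<lambda>p. g p * w' p)" "integrable lborel (\<lambda>p. w p * g' p)"
proof -
  have *: "integrable lborel (\<lambda>p. f p * h p)"
    if [measurable]: "f \<in> borel_measurable borel" "h \<in> borel_measurable borel"
      and "integrable lborel (\<lambda>p. (f p)\<^sup>2)" "integrable lborel (\<lambda>p. (h p)\<^sup>2)" for f h :: "'a \<Rightarrow> real"
  proof (rule Bochner_Integration.integrable_bound)
    show "integrable lborel (\<lambda>p. (f p)\<^sup>2 + (h p)\<^sup>2)" using that by simp
    show "AE p in lborel. norm (f p * h p) \<le> norm ((f p)\<^sup>2 + (h p)\<^sup>2)"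
      using abs_mult_le_squares by (intro AE_I2) simp
  qed simp
  show "integrable lborel (\<lambda>p. g p * w' p)" "integrable lborel (\<lambda>p. w p * g' p)"
    using line_repD[OF assms(1)] line_repD[OF assms(2)] by (auto intro!: *)
qed

section \<open>From square integrable functions on an open set to Borel functions on the whole
  space\<close>

lemma L2_imp_integrable:
  fixes v :: "'a::euclidean_space \<Rightarrow> 'b::euclidean_space"
  assumes v: "L2 G v" and G: "open G" "bounded G"
  shows "integrable (lebesgue_on G) v"
proof (rule Bochner_Integration.integrable_bound)
  have "G \<in> lmeasurable" using G by (simp add: lmeasurable_open)
  then interpret finite_measure "lebesgue_on G" by (rule finite_measure_lebesgue_on)
  show "integrable (lebesgue_on G) (\<lambda>x. 1 + (norm (v x))\<^sup>2)"
    using v by (simp add: L2_def)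
  have "norm (v x) \<le> 1 + (norm (v x))\<^sup>2" for x
  proof -
    have "0 \<le> (norm (v x) - 1)\<^sup>2 + norm (v x)" by simp
    also have "\<dots> = 1 + (norm (v x))\<^sup>2 - norm (v x)" by (simp add: power2_eq_square algebra_simps)
    finally show ?thesis by simp
  qed
  then show "AE x in lebesgue_on G. norm (v x) \<le> norm (1 + (norm (v x))\<^sup>2)"
    by (intro AE_I2) (simp add: abs_of_nonneg)
  show "v \<in> borel_measurable (lebesgue_on G)" using v by (simp add: L2_def)
qed

lemma integrable_bounded_scaleR:
  fixes v :: "'a::euclidean_space \<Rightarrow> 'b::euclidean_space"
  assumes v: "integrable (lebesgue_on G) v" and \<phi>: "\<phi> \<in> test_functions UNIV"
  shows "integrable (lebesgue_on G) (\<lambda>x. \<phi> x *\<^sub>R v x)"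
proof -
  obtain B where B: "\<And>p. \<bar>\<phi> p\<bar> \<le> B" using test_function_bounded[OF \<phi>] by metis
  show ?thesis
  proof (rule Bochner_Integration.integrable_bound)
    show "integrable (lebesgue_on G) (\<lambda>x. B *\<^sub>R v x)" using v by simp
    have "\<bar>\<phi> p\<bar> \<le> \<bar>B\<bar>" for p using B[of p] by linarith
    then show "AE x in lebesgue_on G. norm (\<phi> x *\<^sub>R v x) \<le> norm (B *\<^sub>R v x)"
      by (intro AE_I2) (simp add: mult_right_mono)
    have "\<phi> \<in> borel_measurable (lebesgue_on G)"
      by (intro measurable_restrict_space1 measurable_completion)
         (simp add: borel_measurable_test_function[OF \<phi>])
    then show "(\<lambda>x. \<phi> x *\<^sub>R v x) \<in> borel_measurable (lebesgue_on G)"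
      using borel_measurable_integrable[OF v] by measurable
  qed
qed

lemma L2_extension:
  fixes v :: "'a::euclidean_space \<Rightarrow> 'b::euclidean_space"
  assumes v: "L2 G v" and G: "open G"
    and w: "w \<in> borel_measurable borel" "\<And>p. p \<notin> G \<Longrightarrow> w p = 0" "AE p in lborel. p \<in> G \<longrightarrow> w p = v p \<bullet> b"
  shows "integrable lborel (\<lambda>p. (w p)\<^sup>2)" "(\<integral>p. (w p)\<^sup>2 \<partial>lborel) = (LINT p|lebesgue_on G. (v p \<bullet> b)\<^sup>2)"
proof -
  have "integrable (lebesgue_on G) (\<lambda>p. (v p \<bullet> b)\<^sup>2)"
  proof (rule Bochner_Integration.integrable_bound)
    show "integrable (lebesgue_on G) (\<lambda>x. (norm b)\<^sup>2 * (norm (v x))\<^sup>2)" using v by (simp add: L2_def)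
    have "(v x \<bullet> b)\<^sup>2 \<le> (norm b)\<^sup>2 * (norm (v x))\<^sup>2" for x
      using power_mono[OF Cauchy_Schwarz_ineq2[of "v x" b], of 2] by (simp add: power_mult_distrib mult.commute)
    then show "AE x in lebesgue_on G. norm ((v x \<bullet> b)\<^sup>2) \<le> norm ((norm b)\<^sup>2 * (norm (v x))\<^sup>2)"
      by (intro AE_I2) simp
    show "(\<lambda>p. (v p \<bullet> b)\<^sup>2) \<in> borel_measurable (lebesgue_on G)"
      using v by (auto simp: L2_def intro!: borel_measurable_power borel_measurable_inner)
  qed
  moreover have "AE p in lborel. p \<in> G \<longrightarrow> (v p \<bullet> b)\<^sup>2 = (w p)\<^sup>2"
    using w(3) by eventually_elim auto
  note tr = lebesgue_on_transfer[of G "\<lambda>p. (w p)\<^sup>2" "\<lambda>p. (v p \<bullet> b)\<^sup>2", OF _ _ _ this]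
  ultimately show "integrable lborel (\<lambda>p. (w p)\<^sup>2)" using tr(2) w(1,2) G by auto
  show "(\<integral>p. (w p)\<^sup>2 \<partial>lborel) = (LINT p|lebesgue_on G. (v p \<bullet> b)\<^sup>2)"
    using tr(3) w(1,2) G by auto
qed

lemma L2_borel_extension:
  fixes v :: "'a::euclidean_space \<Rightarrow> 'b::euclidean_space"
  assumes v: "L2 G v" and G: "open G"
  obtains w where "w \<in> borel_measurable borel" "\<And>p. p \<notin> G \<Longrightarrow> w p = 0" "AE p in lborel. p \<in> G \<longrightarrow> w p = v p \<bullet> b"
  by (rule borel_zero_extension[of "\<lambda>p. v p \<bullet> b" G]) (use v G that in \<open>auto simp: L2_def\<close>)

lemma AE_lebesgue_on_iff:
  assumes "open G"
  shows "(AE p in lebesgue_on G. P p) \<longleftrightarrow> (AE p in lborel. p \<in> G \<longrightarrow> P p)"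
  using assms by (simp add: AE_restrict_space_iff borel_open AE_completion_iff)

section \<open>Functions on the basin\<close>

locale basin =
  fixes S :: "pt2 set" and D :: "pt2 \<Rightarrow> real"
  assumes S: "polygonal_domain S" and D: "depth_function S D"
begin

abbreviation "\<Omega> \<equiv> Omega S D"

lemma open_S: "open S" and bounded_S: "bounded S" and S_nonempty: "S \<noteq> {}"
  using S by (auto simp: polygonal_domain_def)

lemma D_cont: "continuous_on (closure S) D" and D_pos: "x \<in> S \<Longrightarrow> 0 < D x"
  using D by (auto simp: depth_function_def)

lemma D_le: "x \<in> closure S \<Longrightarrow> D x \<le> D_max S D"
proof -
  have "compact (D ` closure S)"
    using bounded_S D_cont by (intro compact_continuous_image) auto
  then show "x \<in> closure S \<Longrightarrow> D x \<le> D_max S D"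
    unfolding D_max_def by (intro cSup_upper) (auto intro: bounded_imp_bdd_above compact_imp_bounded)
qed

lemma open_Omega: "open \<Omega>"
proof -
  let ?f = "\<lambda>p::pt3. snd p + D (fst p)"
  have "continuous_on (S \<times> UNIV) ?f"
    by (intro continuous_intros continuous_on_compose2[OF D_cont]) (use closure_subset in auto)
  then have "open ((S \<times> UNIV) \<inter> ?f -` {0<..})"
    using open_S by (intro continuous_open_preimage) (auto intro: open_Times)
  then have "open (((S \<times> UNIV) \<inter> ?f -` {0<..}) \<inter> (UNIV \<times> {..<0}))"
    by (rule open_Int) (auto intro: open_Times)
  also have "((S \<times> UNIV) \<inter> ?f -` {0<..}) \<inter> (UNIV \<times> {..<0}) = \<Omega>"
    by (auto simp: Omega_def)
  finally show ?thesis .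
qed

lemma Omega_subset: "\<Omega> \<subseteq> S \<times> {- D_max S D<..<0}"
  using D_le closure_subset by (fastforce simp: Omega_def)

lemma bounded_Omega: "bounded \<Omega>"
  by (rule bounded_subset[OF _ Omega_subset]) (auto intro: bounded_Times bounded_S)

lemma sets_Omega [measurable]: "\<Omega> \<in> sets borel"
  using open_Omega by simp

text \<open>Fixed once for the basin, since integration by parts combines two representations of
  equal length.\<close>

definition width :: real where "width = (SOME L. wide \<Omega> L \<and> L > 0)"

lemma wide_width: "wide \<Omega> width" and width_pos: "width > 0"
proof -
  have "\<exists>L. wide \<Omega> L \<and> L > 0" using bounded_imp_wide[OF open_Omega bounded_Omega] by metis
  then have "wide \<Omega> width \<and> width > 0" unfolding width_def by (rule someI_ex)
  then show "wide \<Omega> width" "width > 0" by auto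
qed

text \<open>For test functions supported in \<open>H\<close>, which avoids \<open>N\<close>, the
  vanishing of the Green's formula integral is the weak derivative identity of the zero extensions,
  read off component by component through the inner product with \<open>b\<close>.\<close>

lemma line_rep_of_zero_trace:
  fixes v :: "pt3 \<Rightarrow> 'b::euclidean_space"
  assumes v: "L2 \<Omega> v" "has_L2_deriv \<Omega> e v" and tr: "zero_trace_outside S D e N v"
    and w: "w \<in> borel_measurable borel" "\<And>p. p \<notin> \<Omega> \<Longrightarrow> w p = 0" "AE p in lborel. p \<in> \<Omega> \<longrightarrow> w p = v p \<bullet> b"
    and e: "e \<in> Basis" and H: "open H" "\<And>p t. p \<in> H \<Longrightarrow> t \<ge> 0 \<Longrightarrow> p - t *\<^sub>R e \<in> H" "H \<inter> N = {}" "\<Omega> \<subseteq> H"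
  obtains g where "line_rep \<Omega> width e w g" "AE p in lborel. p \<in> \<Omega> \<longrightarrow> g p = wderiv \<Omega> e v p \<bullet> b"
    "(\<And>p t. p \<in> H \<Longrightarrow> t \<ge> 0 \<Longrightarrow> p + t *\<^sub>R e \<in> H) \<Longrightarrow> line_rep \<Omega> width (- e) w (\<lambda>p. - g p)"
    "\<And>\<tau>. 0 \<le> \<tau> \<Longrightarrow> AE p in lborel. p \<in> H \<longrightarrow> w p - w (p - \<tau> *\<^sub>R e) = (\<integral>t\<in>{0..\<tau>}. g (p - t *\<^sub>R e) \<partial>lborel)"
proof -
  have dv: "L2 \<Omega> (wderiv \<Omega> e v)" by (rule wderiv_L2[OF v(2) open_Omega])
  obtain g where g: "g \<in> borel_measurable borel" "\<And>p. p \<notin> \<Omega> \<Longrightarrow> g p = 0"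
      "AE p in lborel. p \<in> \<Omega> \<longrightarrow> g p = wderiv \<Omega> e v p \<bullet> b"
    by (rule L2_borel_extension[OF dv open_Omega, of b]) (rule that)
  have sq: "integrable lborel (\<lambda>p. (w p)\<^sup>2)" "integrable lborel (\<lambda>p. (g p)\<^sup>2)"
    by (rule L2_extension(1)[OF v(1) open_Omega], fact+) (rule L2_extension(1)[OF dv open_Omega], fact+)
  have weak: "(\<integral>p. pderiv_fun e \<phi> p * w p + \<phi> p * g p \<partial>lborel) = 0"
    if \<phi>: "\<phi> \<in> test_functions UNIV" "fun_support \<phi> \<subseteq> H" for \<phi>
  proof -
    note \<phi>' = test_function_pderiv(1)[OF \<phi>(1) e]
    have [measurable]: "\<phi> \<in> borel_measurable borel" "(\<lambda>p. pderiv_fun e \<phi> p) \<in> borel_measurable borel"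
      using borel_measurable_test_function \<phi>(1) \<phi>' by blast+
    note [measurable] = w(1) g(1)
    have I: "integrable (lebesgue_on \<Omega>) (\<lambda>p. pderiv_fun e \<phi> p *\<^sub>R v p + \<phi> p *\<^sub>R wderiv \<Omega> e v p)"
      by (intro Bochner_Integration.integrable_add integrable_bounded_scaleR \<phi>(1) \<phi>'
          L2_imp_integrable[OF v(1) open_Omega bounded_Omega] L2_imp_integrable[OF dv open_Omega bounded_Omega])
    have "(LINT p|lebesgue_on \<Omega>. pderiv_fun e \<phi> p *\<^sub>R v p + \<phi> p *\<^sub>R wderiv \<Omega> e v p) = 0"
      using tr \<phi> H(3) unfolding zero_trace_outside_def by blast
    then have "(LINT p|lebesgue_on \<Omega>. (pderiv_fun e \<phi> p *\<^sub>R v p + \<phi> p *\<^sub>R wderiv \<Omega> e v p) \<bullet> b) = 0"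
      using I by simp
    also have "(LINT p|lebesgue_on \<Omega>. (pderiv_fun e \<phi> p *\<^sub>R v p + \<phi> p *\<^sub>R wderiv \<Omega> e v p) \<bullet> b)
       = (\<integral>p. pderiv_fun e \<phi> p * w p + \<phi> p * g p \<partial>lborel)"
    proof (rule lebesgue_on_transfer(3)[OF sets_Omega])
      show "(\<lambda>p. pderiv_fun e \<phi> p * w p + \<phi> p * g p) \<in> borel_measurable borel" by measurable
      show "AE p in lborel. p \<in> \<Omega> \<longrightarrow> (pderiv_fun e \<phi> p *\<^sub>R v p + \<phi> p *\<^sub>R wderiv \<Omega> e v p) \<bullet> b
          = pderiv_fun e \<phi> p * w p + \<phi> p * g p"
        using w(3) g(3) by eventually_elim (simp add: inner_add_left)
    qed (simp add: w g)
    finally show ?thesis .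
  qed
  note assumps = w(1,2) g(1,2) sq wide_width H e weak
  show thesis
  proof (rule that[of g])
    show "line_rep \<Omega> width e w g"
      by (rule line_rep_of_weak_deriv(1)[where H=H]) (fact assumps)+
    show "line_rep \<Omega> width (- e) w (\<lambda>p. - g p)"
      if "\<And>p t. p \<in> H \<Longrightarrow> t \<ge> 0 \<Longrightarrow> p + t *\<^sub>R e \<in> H"
      by (rule line_rep_of_weak_deriv(2)[where H=H]) (fact assumps that)+
    have I: "integrable lborel w" "integrable lborel g"
      by (rule square_integrable_imp_integrable[OF w(1) sq(1) _ open_Omega bounded_Omega], fact w(2))
         (rule square_integrable_imp_integrable[OF g(1) sq(2) _ open_Omega bounded_Omega], fact g(2))
    show "AE p in lborel. p \<in> H \<longrightarrow> w p - w (p - \<tau> *\<^sub>R e) = (\<integral>t\<in>{0..\<tau>}. g (p - t *\<^sub>R e) \<partial>lborel)"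
      if "0 \<le> \<tau>" for \<tau>
      by (rule weak_deriv_increment) (fact I e H weak that)+
  qed (fact g(3))
qed

lemma Gamma_s_below: "{p. snd p < 0} \<inter> Gamma_s S = {}"
  by (auto simp: Gamma_s_def)

lemma open_below: "open {p :: pt3. snd p < 0}"
  by (intro open_Collect_less continuous_intros)

lemma Omega_below: "\<Omega> \<subseteq> {p. snd p < 0}"
  by (auto simp: Omega_def)

lemma Basis_snd: "e \<in> Basis \<Longrightarrow> 0 \<le> snd (e :: pt3)"
  by (auto simp: Basis_prod_def)

text \<open>Here \<open>H\<close> is the open lower half space. Forward steps remain in it only if
  \<open>e\<close> is horizontal, hence the condition on the reversed representation.\<close>

lemma H1_bl_line_rep:
  assumes v: "v \<in> H1_bl S D" and e: "e \<in> Basis"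
    and w: "w \<in> borel_measurable borel" "\<And>p. p \<notin> \<Omega> \<Longrightarrow> w p = 0" "AE p in lborel. p \<in> \<Omega> \<longrightarrow> w p = v p \<bullet> b"
  obtains g where "line_rep \<Omega> width e w g" "AE p in lborel. p \<in> \<Omega> \<longrightarrow> g p = wderiv \<Omega> e v p \<bullet> b"
    "snd e = 0 \<Longrightarrow> line_rep \<Omega> width (- e) w (\<lambda>p. - g p)"
    "\<And>\<tau>. 0 \<le> \<tau> \<Longrightarrow> AE p in lborel. snd p < 0 \<longrightarrow> w p - w (p - \<tau> *\<^sub>R e) = (\<integral>t\<in>{0..\<tau>}. g (p - t *\<^sub>R e) \<partial>lborel)"
proof -
  have v': "L2 \<Omega> v" "has_L2_deriv \<Omega> e v" "zero_trace_outside S D e (Gamma_s S) v"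
    using v e by (auto simp: H1_bl_def H1_def)
  show thesis
  proof (rule line_rep_of_zero_trace[OF v' w e open_below _ Gamma_s_below Omega_below])
    show "p - t *\<^sub>R e \<in> {p. snd p < 0}" if "p \<in> {p. snd p < 0}" "0 \<le> t" for p t
      using that mult_nonneg_nonneg[OF that(2) Basis_snd[OF e]] by simp
    fix g assume g: "line_rep \<Omega> width e w g" "AE p in lborel. p \<in> \<Omega> \<longrightarrow> g p = wderiv \<Omega> e v p \<bullet> b"
      "(\<And>p t. p \<in> {p. snd p < 0} \<Longrightarrow> t \<ge> 0 \<Longrightarrow> p + t *\<^sub>R e \<in> {p. snd p < 0}) \<Longrightarrow> line_rep \<Omega> width (- e) w (\<lambda>p. - g p)"
      "\<And>\<tau>. 0 \<le> \<tau> \<Longrightarrow> AE p in lborel. p \<in> {p. snd p < 0} \<longrightarrow> w p - w (p - \<tau> *\<^sub>R e) = (\<integral>t\<in>{0..\<tau>}. g (p - t *\<^sub>R e) \<partial>lborel)"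
    show thesis
    proof (rule that[OF g(1,2)])
      show "line_rep \<Omega> width (- e) w (\<lambda>p. - g p)" if "snd e = 0"
        by (rule g(3)) (use that in simp)
      show "AE p in lborel. snd p < 0 \<longrightarrow> w p - w (p - \<tau> *\<^sub>R e) = (\<integral>t\<in>{0..\<tau>}. g (p - t *\<^sub>R e) \<partial>lborel)"
        if "0 \<le> \<tau>" for \<tau> using g(4)[OF that] by simp
    qed
  qed
qed

lemma e_z_Basis: "e_z \<in> Basis"
  by (auto simp: Basis_prod_def)

text \<open>Vanishing at both ends of every column allows \<open>H\<close> to be the whole space, so
  both orientations are available.\<close>

lemma H0_dz_line_rep:
  assumes v: "v \<in> H0_dz S D"
    and w: "w \<in> borel_measurable borel" "\<And>p. p \<notin> \<Omega> \<Longrightarrow> w p = 0" "AE p in lborel. p \<in> \<Omega> \<longrightarrow> w p = v p"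
  obtains g where "line_rep \<Omega> width e_z w g" "AE p in lborel. p \<in> \<Omega> \<longrightarrow> g p = dz S D v p"
    "line_rep \<Omega> width (- e_z) w (\<lambda>p. - g p)"
proof -
  have v': "L2 \<Omega> v" "has_L2_deriv \<Omega> e_z v" "zero_trace_outside S D e_z {} v"
    using v by (auto simp: H0_dz_def H_dz_def)
  have w': "AE p in lborel. p \<in> \<Omega> \<longrightarrow> w p = v p \<bullet> 1" using w(3) by simp
  show thesis
  proof (rule line_rep_of_zero_trace[OF v' w(1,2) w' e_z_Basis open_UNIV])
    fix g assume g: "line_rep \<Omega> width e_z w g" "AE p in lborel. p \<in> \<Omega> \<longrightarrow> g p = dz S D v p \<bullet> 1"
      "(\<And>p t. p \<in> UNIV \<Longrightarrow> t \<ge> 0 \<Longrightarrow> p + t *\<^sub>R e_z \<in> UNIV) \<Longrightarrow> line_rep \<Omega> width (- e_z) w (\<lambda>p. - g p)"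
    show thesis by (rule that[OF g(1)]) (use g(2,3) in auto)
  qed auto
qed

end

lemma L2_norm_components:
  assumes "L2 G v"
  shows "(L2_norm G v)\<^sup>2 = (\<Sum>j\<in>Basis. LINT p|lebesgue_on G. (v p \<bullet> j)\<^sup>2)"
    and "j \<in> Basis \<Longrightarrow> integrable (lebesgue_on G) (\<lambda>p. (v p \<bullet> j)\<^sup>2)"
proof -
  have I: "integrable (lebesgue_on G) (\<lambda>p. (v p \<bullet> j)\<^sup>2)" if "j \<in> Basis" for j
  proof (rule Bochner_Integration.integrable_bound)
    show "integrable (lebesgue_on G) (\<lambda>x. (norm (v x))\<^sup>2)" using assms by (simp add: L2_def)
    show "(\<lambda>p. (v p \<bullet> j)\<^sup>2) \<in> borel_measurable (lebesgue_on G)"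
      using assms by (auto simp: L2_def intro!: borel_measurable_power borel_measurable_inner)
    show "AE x in lebesgue_on G. norm ((v x \<bullet> j)\<^sup>2) \<le> norm ((norm (v x))\<^sup>2)"
      using power_mono[OF Basis_le_norm[OF that], of _ 2] by (intro AE_I2) simp
  qed
  then show "j \<in> Basis \<Longrightarrow> integrable (lebesgue_on G) (\<lambda>p. (v p \<bullet> j)\<^sup>2)" .
  have "(norm (v p))\<^sup>2 = (\<Sum>j\<in>Basis. (v p \<bullet> j)\<^sup>2)" for p
    unfolding power2_norm_eq_inner by (subst euclidean_inner) (simp add: power2_eq_square)
  then have "(L2_norm G v)\<^sup>2 = (LINT p|lebesgue_on G. (\<Sum>j\<in>Basis. (v p \<bullet> j)\<^sup>2))"
    by (simp only: L2_norm_power2 L2_inner_def power2_norm_eq_inner[symmetric])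
  also have "\<dots> = (\<Sum>j\<in>Basis. LINT p|lebesgue_on G. (v p \<bullet> j)\<^sup>2)"
    by (rule Bochner_Integration.integral_sum) (rule I)
  finally show "(L2_norm G v)\<^sup>2 = (\<Sum>j\<in>Basis. LINT p|lebesgue_on G. (v p \<bullet> j)\<^sup>2)" .
qed

lemma line_rep_poincare_real:
  assumes "line_rep G L e w g" "L \<ge> 0"
  shows "(\<integral>p. (w p)\<^sup>2 \<partial>lborel) \<le> L\<^sup>2 * (\<integral>p. (g p)\<^sup>2 \<partial>lborel)"
proof -
  have "ennreal (\<integral>p. (w p)\<^sup>2 \<partial>lborel) \<le> ennreal (L\<^sup>2) * ennreal (\<integral>p. (g p)\<^sup>2 \<partial>lborel)"
    using line_rep_poincare[OF assms]
    by (simp add: nn_integral_eq_integral line_repD(5,6)[OF assms(1)])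
  then show ?thesis by (simp flip: ennreal_mult')
qed

lemma grad_norm_ge:
  assumes "e \<in> Basis"
  shows "L2_norm G (wderiv G e v) \<le> grad_norm G v"
proof -
  have "(L2_norm G (wderiv G e v))\<^sup>2 \<le> (\<Sum>e\<in>Basis. (L2_norm G (wderiv G e v))\<^sup>2)"
    using assms by (intro member_le_sum) auto
  then show ?thesis unfolding grad_norm_def by (rule real_le_rsqrt)
qed

lemma grad_norm_nonneg [simp]: "0 \<le> grad_norm G v"
  by (simp add: grad_norm_def sum_nonneg)

text \<open>\<open>P\<close> need not be measurable, so its exceptional set is enlarged to a
  measurable null set before the order of variables is exchanged.\<close>

lemma AE_lborel_prod_swap:
  fixes P :: "'a::euclidean_space \<times> 'b::euclidean_space \<Rightarrow> bool"
  assumes "AE p in lborel. P p"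
  shows "AE z in lborel. AE x in lborel. P (x, z)" "AE x in lborel. AE z in lborel. P (x, z)"
proof -
  have 1: "AE p in lborel \<Otimes>\<^sub>M lborel. P p" unfolding lborel_prod by (rule assms)
  then obtain N where N: "N \<in> null_sets (lborel \<Otimes>\<^sub>M lborel)" "{p. \<not> P p} \<subseteq> N"
    by (auto simp: eventually_ae_filter space_pair_measure)
  have "AE p in lborel \<Otimes>\<^sub>M lborel. p \<notin> N" using N(1) by (rule AE_not_in)
  then have 2: "AE x in lborel. AE z in lborel. (x, z) \<notin> N"
    by (rule lborel_pair.AE_pair)
  have [measurable]: "N \<in> sets (lborel \<Otimes>\<^sub>M lborel)" using N by auto
  have "{x \<in> space (lborel \<Otimes>\<^sub>M lborel). (fst x, snd x) \<notin> N} \<in> sets (lborel \<Otimes>\<^sub>M lborel)"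
    by measurable
  from lborel_pair.AE_commute[of "\<lambda>x z. (x, z) \<notin> N", OF this] 2
  have 3: "AE z in lborel. AE x in lborel. (x, z) \<notin> N" by blast
  show "AE x in lborel. AE z in lborel. P (x, z)"
    using 2
  proof eventually_elim
    case (elim x)
    then show ?case by eventually_elim (use N(2) in blast)
  qed
  show "AE z in lborel. AE x in lborel. P (x, z)"
    using 3
  proof eventually_elim
    case (elim x)
    then show ?case by eventually_elim (use N(2) in blast)
  qed
qed

section \<open>Skew-symmetry of the advection form\<close>

context basin begin

text \<open>Continuity up to the boundary supplies the uniform bound demanded by
  \<open>line_rep_square\<close>.\<close>

lemma continuous_extension:
  fixes v :: "pt3 \<Rightarrow> pt2"
  assumes v: "continuous_on (closure \<Omega>) v"
  defines "w \<equiv> \<lambda>b p. indicator \<Omega> p * (v p \<bullet> b)"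
  shows "w b \<in> borel_measurable borel" and "\<exists>B. \<forall>p. \<bar>w b p\<bar> \<le> B"
proof -
  have "continuous_on \<Omega> (\<lambda>p. v p \<bullet> b)"
    using continuous_on_subset[OF v closure_subset] by (intro continuous_intros)
  from borel_measurable_continuous_on_indicator[OF sets_Omega this]
  show "w b \<in> borel_measurable borel" by (simp add: w_def)
  have "compact ((\<lambda>p. v p \<bullet> b) ` closure \<Omega>)"
    using bounded_Omega v by (intro compact_continuous_image continuous_intros) auto
  then obtain B where B: "\<And>p. p \<in> closure \<Omega> \<Longrightarrow> \<bar>v p \<bullet> b\<bar> \<le> B"
    using compact_imp_bounded by (fastforce simp: bounded_iff)
  have "\<bar>w b p\<bar> \<le> \<bar>B\<bar>" for p
    using B[of p] closure_subset[of \<Omega>] by (cases "p \<in> \<Omega>") (auto simp: w_def)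
  then show "\<exists>B. \<forall>p. \<bar>w b p\<bar> \<le> B" by blast
qed

lemma Basis_pt3_cases:
  assumes "e \<in> (Basis :: pt3 set)"
  obtains i where "e = (i, 0)" "i \<in> Basis" | "e = e_z"
  using assms by (auto simp: Basis_prod_def)

text \<open>This is the factor represented from above. A component of \<open>u\<close> occurs with
  its own horizontal direction, where lines stay below the surface; in the vertical direction the
  component is \<open>u3\<close>, which vanishes at the surface.\<close>

lemma advection_component:
  assumes u: "u \<in> H1_bl S D" and u3: "u3 \<in> H0_dz S D" and e: "e \<in> Basis"
  defines "U \<equiv> \<lambda>p. (u p, u3 p)"
  obtains a h where "line_rep \<Omega> width (- e) a (\<lambda>p. - h p)" "AE p in lborel. p \<in> \<Omega> \<longrightarrow> a p = U p \<bullet> e"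
    "AE p in lborel. p \<in> \<Omega> \<longrightarrow> h p = wderiv \<Omega> e (\<lambda>y. U y \<bullet> e) p"
  using e
proof (cases rule: Basis_pt3_cases)
  case (1 i)
  have eq: "(\<lambda>y. U y \<bullet> e) = (\<lambda>y. u y \<bullet> i)" by (simp add: U_def 1)
  have u': "L2 \<Omega> u" "has_L2_deriv \<Omega> e u" using u e by (auto simp: H1_bl_def H1_def)
  obtain a where a: "a \<in> borel_measurable borel" "\<And>p. p \<notin> \<Omega> \<Longrightarrow> a p = 0" "AE p in lborel. p \<in> \<Omega> \<longrightarrow> a p = u p \<bullet> i"
    by (rule L2_borel_extension[OF u'(1) open_Omega, of i]) (rule that)
  obtain h where h: "line_rep \<Omega> width e a h" "AE p in lborel. p \<in> \<Omega> \<longrightarrow> h p = wderiv \<Omega> e u p \<bullet> i"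
    "snd e = 0 \<Longrightarrow> line_rep \<Omega> width (- e) a (\<lambda>p. - h p)"
    by (rule H1_bl_line_rep[OF u e a(1) _ a(3)]) (use a(2) in blast)+
  have "AE p in lborel. p \<in> \<Omega> \<longrightarrow> wderiv \<Omega> e (\<lambda>y. u y \<bullet> i) p = wderiv \<Omega> e u p \<bullet> i"
    using wderiv_inner[OF u'(2) open_Omega e] by (simp add: AE_lebesgue_on_iff[OF open_Omega])
  with h(2) have "AE p in lborel. p \<in> \<Omega> \<longrightarrow> h p = wderiv \<Omega> e (\<lambda>y. U y \<bullet> e) p"
    unfolding eq by eventually_elim auto
  moreover have "AE p in lborel. p \<in> \<Omega> \<longrightarrow> a p = U p \<bullet> e"
    using a(3) by (simp add: U_def 1)
  ultimately show thesis using that h(3) 1 by simp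
next
  case 2
  have eq: "(\<lambda>y. U y \<bullet> e_z) = u3" by (simp add: U_def)
  have u3': "L2 \<Omega> u3" using u3 by (auto simp: H0_dz_def H_dz_def)
  obtain a where a: "a \<in> borel_measurable borel" "\<And>p. p \<notin> \<Omega> \<Longrightarrow> a p = 0" "AE p in lborel. p \<in> \<Omega> \<longrightarrow> a p = u3 p \<bullet> 1"
    by (rule L2_borel_extension[OF u3' open_Omega, of 1]) (rule that)
  have a3: "AE p in lborel. p \<in> \<Omega> \<longrightarrow> a p = u3 p" using a(3) by simp
  obtain h where h: "AE p in lborel. p \<in> \<Omega> \<longrightarrow> h p = dz S D u3 p" "line_rep \<Omega> width (- e_z) a (\<lambda>p. - h p)"
    by (rule H0_dz_line_rep[OF u3 a(1) _ a3]) (use a(2) in blast)+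
  have "AE p in lborel. p \<in> \<Omega> \<longrightarrow> a p = U p \<bullet> e" using a3 by (simp add: U_def 2)
  then show thesis using that[of a h] h unfolding 2 eq by blast
qed

text \<open>For each direction \<open>e\<close> and component \<open>j\<close>, pairing
  \<open>U . e\<close> with the square of \<open>v . j\<close> is the integration by parts that
  makes transport and half the divergence cancel. Everything is done on scalar zero extensions and
  summed at the end.\<close>

lemma tri_form_self:
  assumes u: "u \<in> H1_bl S D" and u3: "u3 \<in> H0_dz S D"
    and v: "v \<in> H1_bl S D" and cont: "continuous_on (closure \<Omega>) v"
  shows "tri_form S D (\<lambda>p. (u p, u3 p)) v v = 0"
proof -
  let ?U = "\<lambda>p. (u p, u3 p)"
  define w where "w b p = indicator \<Omega> p * (v p \<bullet> b)" for b p
  have wb: "w b \<in> borel_measurable borel" "\<exists>B. \<forall>p. \<bar>w b p\<bar> \<le> B" for b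
    using continuous_extension[OF cont, of b] by (auto simp: w_def[abs_def])
  have w0: "w b p = 0" if "p \<notin> \<Omega>" for b p using that by (simp add: w_def)
  have wv: "w b p = v p \<bullet> b" if "p \<in> \<Omega>" for b p using that by (simp add: w_def)
  have comp: "\<exists>F. integrable lborel F \<and> (\<integral>p. F p \<partial>lborel) = 0 \<and> (\<forall>p. p \<notin> \<Omega> \<longrightarrow> F p = 0) \<and>
      (AE p in lborel. p \<in> \<Omega> \<longrightarrow> ((?U p \<bullet> e) *\<^sub>R wderiv \<Omega> e v p) \<bullet> v p
         + 1 / 2 * wderiv \<Omega> e (\<lambda>y. ?U y \<bullet> e) p * (v p \<bullet> v p) = F p)" if e: "e \<in> Basis" for e
  proof -
    obtain a h where a: "line_rep \<Omega> width (- e) a (\<lambda>p. - h p)" "AE p in lborel. p \<in> \<Omega> \<longrightarrow> a p = ?U p \<bullet> e"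
      "AE p in lborel. p \<in> \<Omega> \<longrightarrow> h p = wderiv \<Omega> e (\<lambda>y. ?U y \<bullet> e) p"
      by (rule advection_component[OF u u3 e]) (rule that)
    have "\<exists>g. line_rep \<Omega> width e (w j) g \<and> (AE p in lborel. p \<in> \<Omega> \<longrightarrow> g p = wderiv \<Omega> e v p \<bullet> j)" for j
      by (rule H1_bl_line_rep[OF v e wb(1)[of j]]) (use w0 wv in auto)
    then have "\<forall>j. \<exists>g. line_rep \<Omega> width e (w j) g \<and> (AE p in lborel. p \<in> \<Omega> \<longrightarrow> g p = wderiv \<Omega> e v p \<bullet> j)" ..
    then obtain g where "\<forall>j. line_rep \<Omega> width e (w j) (g j) \<and> (AE p in lborel. p \<in> \<Omega> \<longrightarrow> g j p = wderiv \<Omega> e v p \<bullet> j)"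
      by (rule choice[THEN exE])
    then have g: "\<And>j. line_rep \<Omega> width e (w j) (g j)"
      "\<And>j. AE p in lborel. p \<in> \<Omega> \<longrightarrow> g j p = wderiv \<Omega> e v p \<bullet> j" by simp_all
    have sq: "line_rep \<Omega> width e (\<lambda>p. (w j p)\<^sup>2) (\<lambda>p. 2 * (g j p * w j p))" for j
    proof -
      obtain B where "\<And>p. \<bar>w j p\<bar> \<le> B" using wb(2) by blast
      then show ?thesis by (rule line_rep_square[OF g(1) wide_width norm_Basis[OF e]])
    qed
    have i: "integrable lborel (\<lambda>p. a p * (2 * (g j p * w j p)))" "integrable lborel (\<lambda>p. - h p * (w j p)\<^sup>2)" for j
      using line_rep_integrable_mult[OF a(1) sq[of j]] by auto
    \<comment> \<open>Half the difference of the two integrands of the pairing; pointwise it is the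
      contribution of direction \<open>e\<close> to the integrand of the form.\<close>
    let ?F = "\<lambda>p. 1 / 2 * (\<Sum>j\<in>Basis. a p * (2 * (g j p * w j p)) - (- h p * (w j p)\<^sup>2))"
    have "integrable lborel ?F"
      by (intro integrable_mult_right Bochner_Integration.integrable_sum Bochner_Integration.integrable_diff i)
    moreover have "(\<integral>p. ?F p \<partial>lborel) = 0"
    proof -
      have "(\<integral>p. (\<Sum>j\<in>Basis. a p * (2 * (g j p * w j p)) - (- h p * (w j p)\<^sup>2)) \<partial>lborel)
          = (\<Sum>j\<in>Basis. \<integral>p. a p * (2 * (g j p * w j p)) - (- h p * (w j p)\<^sup>2) \<partial>lborel)"
        by (intro Bochner_Integration.integral_sum Bochner_Integration.integrable_diff i)
      also have "\<dots> = 0"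
      proof (rule sum.neutral, rule ballI)
        fix j
        have "(\<integral>p. a p * (2 * (g j p * w j p)) - (- h p * (w j p)\<^sup>2) \<partial>lborel)
           = (\<integral>p. a p * (2 * (g j p * w j p)) \<partial>lborel) - (\<integral>p. - h p * (w j p)\<^sup>2 \<partial>lborel)"
          by (rule Bochner_Integration.integral_diff[OF i])
        then show "(\<integral>p. a p * (2 * (g j p * w j p)) - (- h p * (w j p)\<^sup>2) \<partial>lborel) = 0"
          using line_rep_pairing[OF sq[of j] a(1)] by linarith
      qed
      finally show ?thesis by (simp only: integral_mult_right_zero mult_zero_right)
    qed
    moreover have "?F p = 0" if "p \<notin> \<Omega>" for p using w0[OF that] by simp
    moreover have "AE p in lborel. \<forall>j\<in>Basis. p \<in> \<Omega> \<longrightarrow> g j p = wderiv \<Omega> e v p \<bullet> j"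
      using g(2) by (subst AE_ball_countable) (auto intro: countable_finite)
    then have "AE p in lborel. p \<in> \<Omega> \<longrightarrow> ((?U p \<bullet> e) *\<^sub>R wderiv \<Omega> e v p) \<bullet> v p
         + 1 / 2 * wderiv \<Omega> e (\<lambda>y. ?U y \<bullet> e) p * (v p \<bullet> v p) = ?F p"
      using a(2,3)
    proof eventually_elim
      case (elim p)
      show ?case
      proof
        assume p: "p \<in> \<Omega>"
        have "((?U p \<bullet> e) *\<^sub>R wderiv \<Omega> e v p) \<bullet> v p = (\<Sum>j\<in>Basis. a p * (g j p * w j p))"
          by (subst euclidean_inner, intro sum.cong refl) (use elim p wv[OF p] in simp)
        moreover have "v p \<bullet> v p = (\<Sum>j\<in>Basis. (w j p)\<^sup>2)"
          by (subst euclidean_inner, intro sum.cong refl) (use wv[OF p] in \<open>simp add: power2_eq_square\<close>)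
        moreover have "wderiv \<Omega> e (\<lambda>y. ?U y \<bullet> e) p = h p" using elim p by simp
        moreover have "?F p = (\<Sum>j\<in>Basis. a p * (g j p * w j p)) + 1 / 2 * h p * (\<Sum>j\<in>Basis. (w j p)\<^sup>2)"
          by (simp add: sum.distrib sum_distrib_left algebra_simps)
        ultimately show "((?U p \<bullet> e) *\<^sub>R wderiv \<Omega> e v p) \<bullet> v p
         + 1 / 2 * wderiv \<Omega> e (\<lambda>y. ?U y \<bullet> e) p * (v p \<bullet> v p) = ?F p" by simp
      qed
    qed
    ultimately show ?thesis by blast
  qed
  define P where "P e F \<longleftrightarrow> integrable lborel F \<and> (\<integral>p. F p \<partial>lborel) = 0 \<and> (\<forall>p. p \<notin> \<Omega> \<longrightarrow> F p = 0) \<and>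
      (AE p in lborel. p \<in> \<Omega> \<longrightarrow> ((?U p \<bullet> e) *\<^sub>R wderiv \<Omega> e v p) \<bullet> v p
         + 1 / 2 * wderiv \<Omega> e (\<lambda>y. ?U y \<bullet> e) p * (v p \<bullet> v p) = F p)" for e F
  have "\<forall>e\<in>Basis. \<exists>F. P e F" using comp unfolding P_def by blast
  then obtain F where "\<forall>e\<in>Basis. P e (F e)" by (rule bchoice[THEN exE])
  then have F: "\<And>e. e \<in> Basis \<Longrightarrow> integrable lborel (F e)" "\<And>e. e \<in> Basis \<Longrightarrow> (\<integral>p. F e p \<partial>lborel) = 0"
    "\<And>e p. e \<in> Basis \<Longrightarrow> p \<notin> \<Omega> \<Longrightarrow> F e p = 0"
    "\<And>e. e \<in> Basis \<Longrightarrow> AE p in lborel. p \<in> \<Omega> \<longrightarrow> ((?U p \<bullet> e) *\<^sub>R wderiv \<Omega> e v p) \<bullet> v p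
         + 1 / 2 * wderiv \<Omega> e (\<lambda>y. ?U y \<bullet> e) p * (v p \<bullet> v p) = F e p"
    unfolding P_def by blast+
  have "tri_form S D ?U v v = (\<integral>p. (\<Sum>e\<in>Basis. F e p) \<partial>lborel)"
    unfolding tri_form_def
  proof (rule lebesgue_on_transfer(3)[OF sets_Omega])
    show "(\<lambda>p. \<Sum>e\<in>Basis. F e p) \<in> borel_measurable borel"
      using borel_measurable_integrable[OF F(1)] by (intro borel_measurable_sum) simp
    show "(\<Sum>e\<in>Basis. F e p) = 0" if "p \<notin> \<Omega>" for p using F(3)[OF _ that] by simp
    have "AE p in lborel. \<forall>e\<in>Basis. p \<in> \<Omega> \<longrightarrow> ((?U p \<bullet> e) *\<^sub>R wderiv \<Omega> e v p) \<bullet> v p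
         + 1 / 2 * wderiv \<Omega> e (\<lambda>y. ?U y \<bullet> e) p * (v p \<bullet> v p) = F e p"
      using F(4) by (subst AE_ball_countable) (auto intro: countable_finite)
    then show "AE p in lborel. p \<in> \<Omega> \<longrightarrow> (\<Sum>e\<in>Basis. (?U p \<bullet> e) *\<^sub>R wderiv \<Omega> e v p) \<bullet> v p
        + 1 / 2 * wdiv \<Omega> ?U p * (v p \<bullet> v p) = (\<Sum>e\<in>Basis. F e p)"
    proof eventually_elim
      case (elim p)
      show ?case
      proof
        assume p: "p \<in> \<Omega>"
        have "(\<Sum>e\<in>Basis. F e p) = (\<Sum>e\<in>Basis. ((?U p \<bullet> e) *\<^sub>R wderiv \<Omega> e v p) \<bullet> v p
            + 1 / 2 * wderiv \<Omega> e (\<lambda>y. ?U y \<bullet> e) p * (v p \<bullet> v p))"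
          using elim p by (intro sum.cong) auto
        then show "(\<Sum>e\<in>Basis. (?U p \<bullet> e) *\<^sub>R wderiv \<Omega> e v p) \<bullet> v p
          + 1 / 2 * wdiv \<Omega> ?U p * (v p \<bullet> v p) = (\<Sum>e\<in>Basis. F e p)"
          unfolding wdiv_def inner_sum_left sum.distrib by (simp only: sum_distrib_left sum_distrib_right)
      qed
    qed
  qed
  also have "\<dots> = 0" using F(1,2) by simp
  finally show ?thesis .
qed

section \<open>Bounds for the vertical velocity\<close>

lemma H0_dz_poincare:
  assumes v: "v \<in> H0_dz S D"
  shows "L2_norm \<Omega> v \<le> width * L2_norm \<Omega> (dz S D v)"
proof -
  have v': "L2 \<Omega> v" "has_L2_deriv \<Omega> e_z v" using v by (auto simp: H0_dz_def H_dz_def)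
  have dv: "L2 \<Omega> (dz S D v)" by (rule wderiv_L2[OF v'(2) open_Omega])
  obtain w where w: "w \<in> borel_measurable borel" "\<And>p. p \<notin> \<Omega> \<Longrightarrow> w p = 0" "AE p in lborel. p \<in> \<Omega> \<longrightarrow> w p = v p \<bullet> 1"
    by (rule L2_borel_extension[OF v'(1) open_Omega, of 1]) (rule that)
  have w3: "AE p in lborel. p \<in> \<Omega> \<longrightarrow> w p = v p" using w(3) by simp
  obtain g where g: "line_rep \<Omega> width e_z w g" "AE p in lborel. p \<in> \<Omega> \<longrightarrow> g p = dz S D v p"
    by (rule H0_dz_line_rep[OF v w(1) _ w3]) (use w(2) in blast)+
  have g2: "AE p in lborel. p \<in> \<Omega> \<longrightarrow> g p = dz S D v p \<bullet> 1" using g(2) by simp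
  have "(\<integral>p. (w p)\<^sup>2 \<partial>lborel) = (LINT p|lebesgue_on \<Omega>. (v p \<bullet> 1)\<^sup>2)"
    by (rule L2_extension(2)[OF v'(1) open_Omega]) (fact w)+
  moreover have "(\<integral>p. (g p)\<^sup>2 \<partial>lborel) = (LINT p|lebesgue_on \<Omega>. (dz S D v p \<bullet> 1)\<^sup>2)"
    by (rule L2_extension(2)[OF dv open_Omega line_repD(2)[OF g(1)] _ g2]) (rule line_repD(4)[OF g(1)])
  ultimately have "(L2_norm \<Omega> v)\<^sup>2 \<le> width\<^sup>2 * (L2_norm \<Omega> (dz S D v))\<^sup>2"
    using line_rep_poincare_real[OF g(1)] width_pos
    unfolding L2_norm_components(1)[OF v'(1)] L2_norm_components(1)[OF dv] by simp
  then have "(L2_norm \<Omega> v)\<^sup>2 \<le> (width * L2_norm \<Omega> (dz S D v))\<^sup>2"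
    by (simp add: power_mult_distrib)
  then show ?thesis
    by (rule power2_le_imp_le) (use width_pos in simp)
qed

lemma div_x_bound:
  assumes u: "u \<in> H1_bl S D"
  shows "L2 \<Omega> (div_x S D u)" and "L2_norm \<Omega> (div_x S D u) \<le> 2 * grad_norm \<Omega> u"
proof -
  let ?d = "\<lambda>e p. wderiv \<Omega> (e, 0) u p"
  have B: "(e, 0) \<in> (Basis :: pt3 set)" if "e \<in> Basis" for e using that by (auto simp: Basis_prod_def)
  have L: "has_L2_deriv \<Omega> (e, 0) u" if "e \<in> Basis" for e
    using u B[OF that] by (auto simp: H1_bl_def H1_def)
  have dL: "L2 \<Omega> (?d e)" if "e \<in> Basis" for e
    by (rule wderiv_L2[OF L[OF that] open_Omega])
  let ?f = "\<lambda>p. \<Sum>e\<in>Basis. ?d e p \<bullet> e"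
  have "AE p in lebesgue_on \<Omega>. \<forall>e\<in>Basis. wderiv \<Omega> (e, 0) (\<lambda>q. u q \<bullet> e) p = ?d e p \<bullet> e"
    using wderiv_inner[OF L open_Omega B] by (subst AE_ball_countable) (auto intro: countable_finite)
  then have ae: "AE p in lebesgue_on \<Omega>. div_x S D u p = ?f p"
    by eventually_elim (simp add: div_x_def)
  \<comment> \<open>The factor 2 is the number of horizontal directions.\<close>
  have sq: "(?f p)\<^sup>2 \<le> 2 * (\<Sum>e\<in>Basis. (norm (?d e p))\<^sup>2)" for p
  proof -
    have "(?f p)\<^sup>2 \<le> (\<Sum>e\<in>Basis. (?d e p \<bullet> e)\<^sup>2) * card (Basis :: pt2 set)"
      by (rule sum_squared_le_sum_of_squares)
    also have "\<dots> \<le> (\<Sum>e\<in>Basis. (norm (?d e p))\<^sup>2) * card (Basis :: pt2 set)"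
    proof (intro mult_right_mono sum_mono)
      fix e :: pt2 assume "e \<in> Basis"
      then show "(?d e p \<bullet> e)\<^sup>2 \<le> (norm (?d e p))\<^sup>2"
        using power_mono[OF Basis_le_norm, of e "?d e p" 2] by simp
    qed simp
    finally show ?thesis by (simp add: mult.commute)
  qed
  have I: "integrable (lebesgue_on \<Omega>) (\<lambda>p. 2 * (\<Sum>e\<in>Basis. (norm (?d e p))\<^sup>2))"
    using dL by (intro integrable_mult_right Bochner_Integration.integrable_sum) (auto simp: L2_def)
  have fL: "L2 \<Omega> ?f"
    unfolding L2_def
  proof
    show m: "?f \<in> borel_measurable (lebesgue_on \<Omega>)"
      using dL by (intro borel_measurable_sum borel_measurable_inner) (auto simp: L2_def)
    show "integrable (lebesgue_on \<Omega>) (\<lambda>p. (norm (?f p))\<^sup>2)"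
    proof (rule Bochner_Integration.integrable_bound[OF I])
      show "(\<lambda>p. (norm (?f p))\<^sup>2) \<in> borel_measurable (lebesgue_on \<Omega>)"
        using borel_measurable_power[OF m, of 2] by simp
      show "AE p in lebesgue_on \<Omega>. norm ((norm (?f p))\<^sup>2) \<le> norm (2 * (\<Sum>e\<in>Basis. (norm (?d e p))\<^sup>2))"
        using sq by (intro AE_I2) (simp add: abs_of_nonneg sum_nonneg)
    qed
  qed
  show dx: "L2 \<Omega> (div_x S D u)" by (rule L2_cong_AE[OF ae fL]) (use open_Omega in simp)
  have "(L2_norm \<Omega> (div_x S D u))\<^sup>2 = (LINT p|lebesgue_on \<Omega>. (div_x S D u p)\<^sup>2)"
    unfolding L2_norm_power2 L2_inner_def by (simp add: power2_eq_square)
  also have "\<dots> \<le> (LINT p|lebesgue_on \<Omega>. 2 * (\<Sum>e\<in>Basis. (norm (?d e p))\<^sup>2))"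
  proof (rule integral_mono_AE[OF _ I])
    show "integrable (lebesgue_on \<Omega>) (\<lambda>p. (div_x S D u p)\<^sup>2)" using dx by (simp add: L2_def)
    show "AE p in lebesgue_on \<Omega>. (div_x S D u p)\<^sup>2 \<le> 2 * (\<Sum>e\<in>Basis. (norm (?d e p))\<^sup>2)"
      using ae by eventually_elim (use sq in simp)
  qed
  also have "\<dots> = 2 * (\<Sum>e\<in>Basis. (L2_norm \<Omega> (?d e))\<^sup>2)"
  proof -
    have "(LINT p|lebesgue_on \<Omega>. (\<Sum>e\<in>Basis. (norm (?d e p))\<^sup>2)) = (\<Sum>e\<in>Basis. LINT p|lebesgue_on \<Omega>. (norm (?d e p))\<^sup>2)"
      using dL by (intro Bochner_Integration.integral_sum) (auto simp: L2_def)
    then show ?thesis by (simp add: L2_norm_power2 L2_inner_def power2_norm_eq_inner)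
  qed
  also have "(\<Sum>e\<in>Basis. (L2_norm \<Omega> (?d e))\<^sup>2) = (\<Sum>e\<in>(\<lambda>e. (e, 0)) ` Basis. (L2_norm \<Omega> (wderiv \<Omega> e u))\<^sup>2)"
    by (subst sum.reindex) (auto intro: inj_onI)
  also have "\<dots> \<le> (\<Sum>e\<in>Basis. (L2_norm \<Omega> (wderiv \<Omega> e u))\<^sup>2)"
    using B by (intro sum_mono2) auto
  also have "\<dots> = (grad_norm \<Omega> u)\<^sup>2"
    by (simp add: grad_norm_def sum_nonneg)
  finally have "(L2_norm \<Omega> (div_x S D u))\<^sup>2 \<le> 2 * (grad_norm \<Omega> u)\<^sup>2" by simp
  \<comment> \<open>The natural constant is the square root of 2; it is rounded up.\<close>
  also have "\<dots> \<le> (2 * grad_norm \<Omega> u)\<^sup>2" by (simp add: power_mult_distrib)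
  finally show "L2_norm \<Omega> (div_x S D u) \<le> 2 * grad_norm \<Omega> u"
    by (rule power2_le_imp_le) simp
qed

lemma substep0_bound:
  assumes u: "u \<in> H1_bl S D" and Y: "Y \<subseteq> H0_dz S D" and s: "substep0 S D Y u u3"
  shows "L2_norm \<Omega> (dz S D u3) \<le> 2 * grad_norm \<Omega> u"
proof -
  have u3: "u3 \<in> Y" using s by (auto simp: substep0_def)
  then have "has_L2_deriv \<Omega> e_z u3" using Y by (auto simp: H0_dz_def H_dz_def)
  then have d: "L2 \<Omega> (dz S D u3)" by (rule wderiv_L2[OF _ open_Omega])
  have "(L2_norm \<Omega> (dz S D u3))\<^sup>2 = - L2_inner \<Omega> (div_x S D u) (dz S D u3)"
    using s u3 unfolding substep0_def L2_norm_power2 by blast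
  also have "\<dots> \<le> L2_norm \<Omega> (div_x S D u) * L2_norm \<Omega> (dz S D u3)"
    using L2_Cauchy_Schwarz[OF div_x_bound(1)[OF u] d] by simp
  also have "\<dots> \<le> 2 * grad_norm \<Omega> u * L2_norm \<Omega> (dz S D u3)"
    by (intro mult_right_mono div_x_bound(2)[OF u]) simp
  finally have *: "L2_norm \<Omega> (dz S D u3) * L2_norm \<Omega> (dz S D u3) \<le> 2 * grad_norm \<Omega> u * L2_norm \<Omega> (dz S D u3)"
    by (simp add: power2_eq_square)
  show ?thesis
  proof (cases "L2_norm \<Omega> (dz S D u3) = 0")
    case False
    then have "0 < L2_norm \<Omega> (dz S D u3)" using L2_norm_nonneg[of \<Omega> "dz S D u3"] by linarith
    with * show ?thesis by simp
  qed simp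
qed

lemma slice_eq: "slice S D z = {x. (x, z) \<in> \<Omega>}"
  by (auto simp: slice_def Omega_def)

lemma open_slice: "open (slice S D z)"
proof -
  have "open ((\<lambda>x. (x, z)) -` \<Omega>)"
    by (intro open_vimage open_Omega continuous_intros)
  then show ?thesis by (simp add: slice_eq vimage_def)
qed

lemma D_max_pos: "0 < D_max S D"
  using S_nonempty D_pos D_le closure_subset[of S] by (metis equals0I less_le_trans subsetD)

text \<open>The square of \<open>w (x, z)\<close> is at most \<open>width\<close> times an integral
  over the column above \<open>x\<close> that does not involve \<open>z\<close>. Integrating in
  \<open>x\<close> therefore bounds almost every slice by the same number.\<close>

lemma H0_dz_LinfL2:
  assumes v: "v \<in> H0_dz S D"
  shows "v \<in> LinfL2 S D" and "0 \<le> LinfL2_norm S D v"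
    and "LinfL2_norm S D v \<le> sqrt width * L2_norm \<Omega> (dz S D v)"
proof -
  have v': "L2 \<Omega> v" "has_L2_deriv \<Omega> e_z v" using v by (auto simp: H0_dz_def H_dz_def)
  have dv: "L2 \<Omega> (dz S D v)" by (rule wderiv_L2[OF v'(2) open_Omega])
  obtain w where w: "w \<in> borel_measurable borel" "\<And>p. p \<notin> \<Omega> \<Longrightarrow> w p = 0" "AE p in lborel. p \<in> \<Omega> \<longrightarrow> w p = v p \<bullet> 1"
    by (rule L2_borel_extension[OF v'(1) open_Omega, of 1]) (rule that)
  have w3: "AE p in lborel. p \<in> \<Omega> \<longrightarrow> w p = v p" using w(3) by simp
  obtain g where g: "line_rep \<Omega> width e_z w g" "AE p in lborel. p \<in> \<Omega> \<longrightarrow> g p = dz S D v p"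
    by (rule H0_dz_line_rep[OF v w(1) _ w3]) (use w(2) in blast)+
  have g2: "AE p in lborel. p \<in> \<Omega> \<longrightarrow> g p = dz S D v p \<bullet> 1" using g(2) by simp
  note [measurable] = w(1) line_repD(2)[OF g(1)]
  have [measurable]: "(\<lambda>x. w (x, z)) \<in> borel_measurable borel" "(\<lambda>z. g (x, z)) \<in> borel_measurable borel" for x z
    by measurable
  let ?C = "sqrt width * L2_norm \<Omega> (dz S D v)"
  have gC: "(\<integral>\<^sup>+p. ennreal ((g p)\<^sup>2) \<partial>lborel) = ennreal ((L2_norm \<Omega> (dz S D v))\<^sup>2)"
  proof -
    have "(\<integral>p. (g p)\<^sup>2 \<partial>lborel) = (LINT p|lebesgue_on \<Omega>. (dz S D v p \<bullet> 1)\<^sup>2)"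
      by (rule L2_extension(2)[OF dv open_Omega line_repD(2)[OF g(1)] _ g2]) (rule line_repD(4)[OF g(1)])
    then show ?thesis
      unfolding L2_norm_components(1)[OF dv] by (simp add: nn_integral_eq_integral line_repD(6)[OF g(1)])
  qed
  \<comment> \<open>The segment of integration is enlarged to the whole vertical line, which removes
    the dependence on the depth.\<close>
  have "AE p in lborel. ennreal ((w p)\<^sup>2) \<le> ennreal width * (\<integral>\<^sup>+s. ennreal ((g (fst p, s))\<^sup>2) \<partial>lborel)"
    using line_rep_pointwise[OF g(1) less_imp_le[OF width_pos]]
  proof eventually_elim
    case (elim p)
    have "(\<integral>\<^sup>+t. indicator {0..width} t * ennreal ((g (p - t *\<^sub>R e_z))\<^sup>2) \<partial>lborel)
        \<le> (\<integral>\<^sup>+t. ennreal ((g (p - t *\<^sub>R e_z))\<^sup>2) \<partial>lborel)"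
      by (intro nn_integral_mono) (auto simp: indicator_def)
    also have "\<dots> = (\<integral>\<^sup>+t. ennreal ((g (fst p, snd p + (-1) * t))\<^sup>2) \<partial>lborel)"
      by (intro nn_integral_cong) (simp add: minus_prod_def)
    also have "\<dots> = (\<integral>\<^sup>+s. ennreal ((g (fst p, s))\<^sup>2) \<partial>lborel)"
      using nn_integral_real_affine[of "\<lambda>s. ennreal ((g (fst p, s))\<^sup>2)" "-1" "snd p"] by simp
    finally show ?case using elim by (meson mult_left_mono order_trans zero_le)
  qed
  note pt = AE_lborel_prod_swap(1)[OF this]
  have slice_bound: "AE z in lborel. (\<integral>\<^sup>+x. ennreal ((w (x, z))\<^sup>2) \<partial>lborel) \<le> ennreal (?C\<^sup>2)"
    using pt
  proof eventually_elim
    case (elim z)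
    have "(\<integral>\<^sup>+x. ennreal ((w (x, z))\<^sup>2) \<partial>lborel)
       \<le> (\<integral>\<^sup>+x. ennreal width * (\<integral>\<^sup>+s. ennreal ((g (x, s))\<^sup>2) \<partial>lborel) \<partial>lborel)"
      by (rule nn_integral_mono_AE) (use elim in simp)
    also have "\<dots> = ennreal width * (\<integral>\<^sup>+x. (\<integral>\<^sup>+s. ennreal ((g (x, s))\<^sup>2) \<partial>lborel) \<partial>lborel)"
      by (rule nn_integral_cmult) measurable
    also have "(\<integral>\<^sup>+x. (\<integral>\<^sup>+s. ennreal ((g (x, s))\<^sup>2) \<partial>lborel) \<partial>lborel) = (\<integral>\<^sup>+p. ennreal ((g p)\<^sup>2) \<partial>(lborel \<Otimes>\<^sub>M lborel))"
      by (rule lborel.nn_integral_fst) (simp add: lborel_prod)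
    also have "\<dots> = ennreal ((L2_norm \<Omega> (dz S D v))\<^sup>2)"
      using gC by (simp add: lborel_prod)
    finally show ?case
      using width_pos by (simp add: power_mult_distrib ennreal_mult)
  qed
  let ?W = "\<lambda>z. sqrt (\<integral>x. (w (x, z))\<^sup>2 \<partial>lborel)"
  have sl: "AE z in lborel. L2 (slice S D z) (\<lambda>x. v (x, z)) \<and> L2_norm (slice S D z) (\<lambda>x. v (x, z)) = ?W z \<and> ?W z \<le> ?C"
    using slice_bound AE_lborel_prod_swap(1)[OF w3]
  proof eventually_elim
    case (elim z)
    have G: "slice S D z \<in> sets borel" using open_slice by simp
    have I: "integrable lborel (\<lambda>x. (w (x, z))\<^sup>2)"
      by (rule integrableI_bounded) (use elim(1) in \<open>auto simp: less_top[symmetric] top_unique\<close>)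
    have "AE x in lborel. x \<in> slice S D z \<longrightarrow> (norm (v (x, z)))\<^sup>2 = (w (x, z))\<^sup>2"
      using elim(2) by eventually_elim (auto simp: slice_eq)
    note t2 = lebesgue_on_transfer[OF G _ _ this]
    have "AE x in lborel. x \<in> slice S D z \<longrightarrow> v (x, z) = w (x, z)"
      using elim(2) by eventually_elim (auto simp: slice_eq)
    note t1 = lebesgue_on_transfer(1)[OF G _ _ this]
    have "L2 (slice S D z) (\<lambda>x. v (x, z))"
      unfolding L2_def using t1 t2(2) I w(2) by (auto simp: slice_eq)
    moreover have "L2_norm (slice S D z) (\<lambda>x. v (x, z)) = ?W z"
      unfolding L2_norm_def using t2(3) w(2) by (simp add: slice_eq)
    moreover have "?W z \<le> ?C"
    proof -
      have "ennreal (\<integral>x. (w (x, z))\<^sup>2 \<partial>lborel) \<le> ennreal (?C\<^sup>2)"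
        using elim(1) by (simp add: nn_integral_eq_integral[OF I])
      then have "(\<integral>x. (w (x, z))\<^sup>2 \<partial>lborel) \<le> ?C\<^sup>2" by (simp add: ennreal_le_iff)
      then show ?thesis using width_pos by (intro real_le_lsqrt) auto
    qed
    ultimately show ?case by blast
  qed
  let ?Z = "{- D_max S D<..<0}"
  have Z: "open ?Z" "?Z \<in> sets borel" by auto
  let ?f = "\<lambda>z. ereal (L2_norm (slice S D z) (\<lambda>x. v (x, z)))"
  \<comment> \<open>The bound on an essential supremum requires a measurable function. The slice
    norm inherits measurability from the Borel function \<open>?W\<close>, with which it agrees
    almost everywhere.\<close>
  have "(\<lambda>z. L2_norm (slice S D z) (\<lambda>x. v (x, z))) \<in> borel_measurable (lebesgue_on ?Z)"
  proof (rule lebesgue_on_transfer(1)[OF Z(2)])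
    have "(\<lambda>z. \<integral>x. (w (x, z))\<^sup>2 \<partial>lborel) \<in> borel_measurable borel" by measurable
    then show "(\<lambda>z. indicator ?Z z * ?W z) \<in> borel_measurable borel" by measurable
    show "AE z in lborel. z \<in> ?Z \<longrightarrow> L2_norm (slice S D z) (\<lambda>x. v (x, z)) = indicator ?Z z * ?W z"
      using sl by eventually_elim simp
  qed simp
  then have fm: "?f \<in> borel_measurable (lebesgue_on ?Z)" by simp
  have up: "LinfL2_norm_ereal S D v \<le> ereal ?C"
    unfolding LinfL2_norm_ereal_def
  proof (rule esssup_I[OF fm])
    show "AE z in lebesgue_on ?Z. ?f z \<le> ereal ?C"
      unfolding AE_lebesgue_on_iff[OF Z(1)] using sl by eventually_elim simp
  qed
  \<comment> \<open>Over a null set the essential supremum would be minus infinity. The interval of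
    depths has positive length, so the norm is a nonnegative real number.\<close>
  have lo: "0 \<le> LinfL2_norm_ereal S D v"
  proof -
    have "emeasure (lebesgue_on ?Z) (space (lebesgue_on ?Z)) \<noteq> 0"
      using D_max_pos by (simp add: emeasure_restrict_space)
    from esssup_const[OF this, of "0::ereal"]
    show ?thesis
      unfolding LinfL2_norm_ereal_def
      using esssup_mono[of "\<lambda>_. 0::ereal" "lebesgue_on ?Z" ?f] by simp
  qed
  obtain r where r: "LinfL2_norm_ereal S D v = ereal r"
    using up lo by (cases "LinfL2_norm_ereal S D v") auto
  show "0 \<le> LinfL2_norm S D v" "LinfL2_norm S D v \<le> ?C"
    using up lo by (auto simp: LinfL2_norm_def r)
  show "v \<in> LinfL2 S D"
    unfolding LinfL2_def
  proof (intro CollectI conjI)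
    show "v \<in> borel_measurable (lebesgue_on \<Omega>)" using v' by (simp add: L2_def)
    show "AE z in lebesgue_on ?Z. L2 (slice S D z) (\<lambda>x. v (x, z))"
      unfolding AE_lebesgue_on_iff[OF Z(1)] using sl by eventually_elim simp
  qed (simp add: r)
qed

end

section \<open>The surface trace\<close>

text \<open>A positive weight is distributed over the two factors. Weight 1 serves the L2 part of
  the trace norm, a power of the depth serves Hardy's inequality.\<close>

lemma Cauchy_Schwarz_set_nn:
  fixes f :: "real \<Rightarrow> real" and m :: "real \<Rightarrow> real"
  assumes [measurable]: "f \<in> borel_measurable borel" "m \<in> borel_measurable borel" "I \<in> sets borel"
    and m: "\<And>s. s \<in> I \<Longrightarrow> m s > 0"
  shows "ennreal ((\<integral>s. indicator I s * f s \<partial>lborel)\<^sup>2)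
    \<le> (\<integral>\<^sup>+s. indicator I s * ennreal (1 / m s) \<partial>lborel) * (\<integral>\<^sup>+s. indicator I s * ennreal (m s * (f s)\<^sup>2) \<partial>lborel)"
proof -
  have "ennreal \<bar>\<integral>s. indicator I s * f s \<partial>lborel\<bar> \<le> (\<integral>\<^sup>+s. ennreal (norm (indicator I s * f s)) \<partial>lborel)"
  proof (cases "integrable lborel (\<lambda>s. indicator I s * f s)")
    case True
    from integral_norm_bound_ennreal[OF this] show ?thesis by simp
  qed (simp add: not_integrable_integral_eq)
  also have "\<dots> = (\<integral>\<^sup>+s. (indicator I s * ennreal (sqrt (1 / m s))) * (indicator I s * ennreal (sqrt (m s) * \<bar>f s\<bar>)) \<partial>lborel)"
  proof (intro nn_integral_cong)
    fix s
    show "ennreal (norm (indicator I s * f s)) = (indicator I s * ennreal (sqrt (1 / m s))) * (indicator I s * ennreal (sqrt (m s) * \<bar>f s\<bar>))"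
    proof (cases "s \<in> I")
      case True
      then have "sqrt (1 / m s) * (sqrt (m s) * \<bar>f s\<bar>) = \<bar>f s\<bar>"
        using m[OF True] by (simp add: real_sqrt_divide)
      then show ?thesis using True m[OF True] by (simp flip: ennreal_mult')
    qed simp
  qed
  finally have "(ennreal \<bar>\<integral>s. indicator I s * f s \<partial>lborel\<bar>)\<^sup>2
     \<le> (\<integral>\<^sup>+s. (indicator I s * ennreal (sqrt (1 / m s))) * (indicator I s * ennreal (sqrt (m s) * \<bar>f s\<bar>)) \<partial>lborel)\<^sup>2"
    by (rule power_mono) simp
  also have "\<dots> \<le> (\<integral>\<^sup>+s. (indicator I s * ennreal (sqrt (1 / m s)))\<^sup>2 \<partial>lborel)
      * (\<integral>\<^sup>+s. (indicator I s * ennreal (sqrt (m s) * \<bar>f s\<bar>))\<^sup>2 \<partial>lborel)"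
    by (rule Cauchy_Schwarz_nn_integral) measurable
  also have "(\<integral>\<^sup>+s. (indicator I s * ennreal (sqrt (1 / m s)))\<^sup>2 \<partial>lborel) = (\<integral>\<^sup>+s. indicator I s * ennreal (1 / m s) \<partial>lborel)"
  proof (intro nn_integral_cong)
    fix s show "(indicator I s * ennreal (sqrt (1 / m s)))\<^sup>2 = indicator I s * ennreal (1 / m s)"
      using m[of s] by (cases "s \<in> I") (simp_all add: ennreal_power less_imp_le)
  qed
  also have "(\<integral>\<^sup>+s. (indicator I s * ennreal (sqrt (m s) * \<bar>f s\<bar>))\<^sup>2 \<partial>lborel) = (\<integral>\<^sup>+s. indicator I s * ennreal (m s * (f s)\<^sup>2) \<partial>lborel)"
  proof (intro nn_integral_cong)
    fix s show "(indicator I s * ennreal (sqrt (m s) * \<bar>f s\<bar>))\<^sup>2 = indicator I s * ennreal (m s * (f s)\<^sup>2)"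
      using m[of s] by (cases "s \<in> I") (simp_all add: ennreal_power less_imp_le power_mult_distrib)
  qed
  finally show ?thesis by (simp add: ennreal_power)
qed

lemma nn_integral_reflect:
  fixes f :: "real \<Rightarrow> ennreal"
  assumes [measurable]: "f \<in> borel_measurable borel"
  shows "(\<integral>\<^sup>+s. f (- s) \<partial>lborel) = (\<integral>\<^sup>+s. f s \<partial>lborel)"
  using nn_integral_real_affine[of f "-1" 0] by simp

lemma nn_integral_inverse_sqrt:
  assumes "z < 0"
  shows "(\<integral>\<^sup>+s. indicator {z<..<0} s * ennreal (1 / (- s) powr (1 / 2)) \<partial>lborel) \<le> ennreal (2 * (- z) powr (1 / 2))"
proof -
  have "((\<lambda>s. s powr (- 1 / 2)) has_integral ((- z) powr (- 1 / 2 + 1) / (- 1 / 2 + 1))) {0..- z}"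
    by (rule has_integral_powr_from_0) (use assms in auto)
  then have *: "(\<integral>\<^sup>+s. ennreal (indicator {0..- z} s * s powr (- 1 / 2)) \<partial>lborel) = ennreal ((- z) powr (1 / 2) / (1 / 2))"
    using nn_integral_has_integral_lebesgue[of "{0..- z}" "\<lambda>s. s powr (- 1 / 2)"] by simp
  have "(\<integral>\<^sup>+s. indicator {z<..<0} s * ennreal (1 / (- s) powr (1 / 2)) \<partial>lborel)
     = (\<integral>\<^sup>+s. indicator {z<..<0} (- s) * ennreal (1 / (- (- s)) powr (1 / 2)) \<partial>lborel)"
    by (rule nn_integral_reflect[symmetric]) measurable
  also have "\<dots> \<le> (\<integral>\<^sup>+s. ennreal (indicator {0..- z} s * s powr (- 1 / 2)) \<partial>lborel)"
    by (intro nn_integral_mono) (auto simp: indicator_def powr_minus divide_simps)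
  also have "\<dots> = ennreal (2 * (- z) powr (1 / 2))" unfolding * by (simp add: mult.commute)
  finally show ?thesis .
qed

lemma nn_integral_tail:
  assumes "s < 0"
  shows "(\<integral>\<^sup>+z. indicator {..<s} z * ennreal ((- z) powr (- 3 / 2)) \<partial>lborel) \<le> ennreal (2 * (- s) powr (- 1 / 2))"
proof -
  have "((\<lambda>z. z powr (- 3 / 2)) has_integral (- ((- s) powr (- 3 / 2 + 1)) / (- 3 / 2 + 1))) {- s..}"
    by (rule has_integral_powr_to_inf) (use assms in auto)
  then have *: "(\<integral>\<^sup>+z. ennreal (indicator {- s..} z * z powr (- 3 / 2)) \<partial>lborel) = ennreal (- ((- s) powr (- 1 / 2)) / (- 1 / 2))"
    using nn_integral_has_integral_lebesgue[of "{- s..}" "\<lambda>s. s powr (- 3 / 2)"] by simp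
  have "(\<integral>\<^sup>+z. indicator {..<s} z * ennreal ((- z) powr (- 3 / 2)) \<partial>lborel)
     = (\<integral>\<^sup>+z. indicator {..<s} (- z) * ennreal ((- (- z)) powr (- 3 / 2)) \<partial>lborel)"
    by (rule nn_integral_reflect[symmetric]) measurable
  also have "\<dots> \<le> (\<integral>\<^sup>+z. ennreal (indicator {- s..} z * z powr (- 3 / 2)) \<partial>lborel)"
    by (intro nn_integral_mono) (auto simp: indicator_def)
  also have "\<dots> = ennreal (2 * (- s) powr (- 1 / 2))" unfolding * by (simp add: mult.commute)
  finally show ?thesis .
qed

text \<open>The weight \<open>\<bar>s\<bar>\<^sup>1\<^sup>/\<^sup>2\<close> in the Cauchy-Schwarz inequality makes both remaining
  one-dimensional integrals converge.\<close>

lemma hardy: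
  fixes f g :: "real \<Rightarrow> real"
  assumes [measurable]: "f \<in> borel_measurable borel" "g \<in> borel_measurable borel"
    and f: "AE z in lborel. z < 0 \<longrightarrow> f z = (\<integral>s. indicator {z<..<0} s * g s \<partial>lborel)"
  shows "(\<integral>\<^sup>+z. indicator {..<0} z * ennreal ((f z)\<^sup>2 / z\<^sup>2) \<partial>lborel) \<le> 4 * (\<integral>\<^sup>+s. ennreal ((g s)\<^sup>2) \<partial>lborel)"
proof -
  \<comment> \<open>The exponent -3/2 comes from \<open>1 / z^2\<close> times the
    \<open>|z|^(1/2)\<close> left by integrating the inverse weight.\<close>
  let ?K = "\<lambda>z s. indicator {..<0} z * ennreal (2 * (- z) powr (- 3 / 2)) * (indicator {z<..<0} s * ennreal ((- s) powr (1 / 2) * (g s)\<^sup>2))"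
  have "(\<integral>\<^sup>+z. indicator {..<0} z * ennreal ((f z)\<^sup>2 / z\<^sup>2) \<partial>lborel) \<le> (\<integral>\<^sup>+z. (\<integral>\<^sup>+s. ?K z s \<partial>lborel) \<partial>lborel)"
  proof (rule nn_integral_mono_AE)
    show "AE z in lborel. indicator {..<0} z * ennreal ((f z)\<^sup>2 / z\<^sup>2) \<le> (\<integral>\<^sup>+s. ?K z s \<partial>lborel)"
      using f
    proof eventually_elim
      case (elim z)
      show ?case
      proof (cases "z < 0")
        case True
        have "ennreal ((f z)\<^sup>2) \<le> (\<integral>\<^sup>+s. indicator {z<..<0} s * ennreal (1 / (- s) powr (1 / 2)) \<partial>lborel)
            * (\<integral>\<^sup>+s. indicator {z<..<0} s * ennreal ((- s) powr (1 / 2) * (g s)\<^sup>2) \<partial>lborel)"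
          unfolding elim[rule_format, OF True] by (rule Cauchy_Schwarz_set_nn) auto
        also have "\<dots> \<le> ennreal (2 * (- z) powr (1 / 2)) * (\<integral>\<^sup>+s. indicator {z<..<0} s * ennreal ((- s) powr (1 / 2) * (g s)\<^sup>2) \<partial>lborel)"
          by (rule mult_right_mono[OF nn_integral_inverse_sqrt[OF True]]) simp
        finally have "ennreal ((f z)\<^sup>2) * ennreal (1 / z\<^sup>2)
          \<le> ennreal (2 * (- z) powr (1 / 2)) * (\<integral>\<^sup>+s. indicator {z<..<0} s * ennreal ((- s) powr (1 / 2) * (g s)\<^sup>2) \<partial>lborel) * ennreal (1 / z\<^sup>2)"
          by (rule mult_right_mono) simp
        moreover have "ennreal (2 * (- z) powr (1 / 2)) * ennreal (1 / z\<^sup>2) = ennreal (2 * (- z) powr (- 3 / 2))"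
        proof -
          have "1 / z\<^sup>2 = (- z) powr (- 2)"
            using True powr_realpow[of "- z" 2] by (simp add: powr_minus divide_simps)
          then have "2 * (- z) powr (1 / 2) * (1 / z\<^sup>2) = 2 * (- z) powr (- 3 / 2)"
            by (simp flip: powr_add)
          then show ?thesis by (simp flip: ennreal_mult')
        qed
        moreover have "ennreal ((f z)\<^sup>2) * ennreal (1 / z\<^sup>2) = ennreal ((f z)\<^sup>2 / z\<^sup>2)"
          by (simp flip: ennreal_mult')
        ultimately have "ennreal ((f z)\<^sup>2 / z\<^sup>2) \<le> ennreal (2 * (- z) powr (- 3 / 2)) * (\<integral>\<^sup>+s. indicator {z<..<0} s * ennreal ((- s) powr (1 / 2) * (g s)\<^sup>2) \<partial>lborel)"
          by (metis (no_types, lifting) mult.assoc mult.commute)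
        then show ?thesis using True by (simp add: nn_integral_cmult)
      qed simp
    qed
  qed
  \<comment> \<open>For fixed \<open>s\<close>, integrating \<open>|z|^(-3/2)\<close> over
    \<open>z < s\<close> gives \<open>2 |s|^(-1/2)\<close>, which cancels the weight; the constant 4
    is the product of the two factors 2.\<close>
  also have "\<dots> = (\<integral>\<^sup>+s. (\<integral>\<^sup>+z. ?K z s \<partial>lborel) \<partial>lborel)"
    by (rule lborel_pair.Fubini'[symmetric]) (unfold case_prod_unfold greaterThanLessThan_iff indicator_def, measurable)
  also have "\<dots> \<le> (\<integral>\<^sup>+s. 4 * ennreal ((g s)\<^sup>2) \<partial>lborel)"
  proof (rule nn_integral_mono)
    fix s :: real
    show "(\<integral>\<^sup>+z. ?K z s \<partial>lborel) \<le> 4 * ennreal ((g s)\<^sup>2)"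
    proof (cases "s < 0")
      case True
      have "(\<integral>\<^sup>+z. ?K z s \<partial>lborel) = (\<integral>\<^sup>+z. ennreal (2 * (- s) powr (1 / 2) * (g s)\<^sup>2) * (indicator {..<s} z * ennreal ((- z) powr (- 3 / 2))) \<partial>lborel)"
        using True by (intro nn_integral_cong) (auto simp: indicator_def ac_simps simp flip: ennreal_mult')
      also have "\<dots> = ennreal (2 * (- s) powr (1 / 2) * (g s)\<^sup>2) * (\<integral>\<^sup>+z. indicator {..<s} z * ennreal ((- z) powr (- 3 / 2)) \<partial>lborel)"
        by (rule nn_integral_cmult) measurable
      also have "\<dots> \<le> ennreal (2 * (- s) powr (1 / 2) * (g s)\<^sup>2) * ennreal (2 * (- s) powr (- 1 / 2))"
        by (rule mult_left_mono[OF nn_integral_tail[OF True]]) simp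
      also have "\<dots> = ennreal (4 * (g s)\<^sup>2)"
      proof -
        have "(- s) powr (1 / 2) * (- s) powr (- 1 / 2) = 1"
          using True by (simp flip: powr_add)
        moreover have "2 * x * c * (2 * y) = 4 * c * (x * y)" for x y c :: real by simp
        ultimately have "2 * (- s) powr (1 / 2) * (g s)\<^sup>2 * (2 * (- s) powr (- 1 / 2)) = 4 * (g s)\<^sup>2"
          by simp
        then show ?thesis by (simp flip: ennreal_mult')
      qed
      finally show ?thesis by (simp add: ennreal_mult)
    qed (auto simp: indicator_def)
  qed
  also have "\<dots> = 4 * (\<integral>\<^sup>+s. ennreal ((g s)\<^sup>2) \<partial>lborel)"
    by (rule nn_integral_cmult) measurable
  finally show ?thesis .
qed

text \<open>\<open>A\<close> is a union of full lines in direction \<open>e\<close>, so cutting off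
  to \<open>A\<close> commutes with the shifts. It will be a horizontal slab: the estimate must be
  available on each range of depths separately, with the derivative restricted to the same
  range.\<close>

lemma translation_bound:
  fixes w g :: "'a::euclidean_space \<Rightarrow> real" and e :: 'a
  assumes [measurable]: "w \<in> borel_measurable borel" "g \<in> borel_measurable borel" "A \<in> sets borel"
    and inv: "\<And>p t. p + t *\<^sub>R e \<in> A \<longleftrightarrow> p \<in> A" and A: "A \<subseteq> H"
    and inc: "\<And>\<tau>. 0 \<le> \<tau> \<Longrightarrow> AE p in lborel. p \<in> H \<longrightarrow> w p - w (p - \<tau> *\<^sub>R e) = (\<integral>t\<in>{0..\<tau>}. g (p - t *\<^sub>R e) \<partial>lborel)"
  shows "(\<integral>\<^sup>+p. indicator A p * ennreal ((w (p + \<tau> *\<^sub>R e) - w p)\<^sup>2) \<partial>lborel)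
     \<le> ennreal (\<tau>\<^sup>2) * (\<integral>\<^sup>+p. indicator A p * ennreal ((g p)\<^sup>2) \<partial>lborel)"
proof -
  have inv': "p - t *\<^sub>R e \<in> A \<longleftrightarrow> p \<in> A" for p t using inv[of p "- t"] by simp
  let ?G = "\<lambda>p. indicator A p * ennreal ((g p)\<^sup>2)"
  have nonneg: "(\<integral>\<^sup>+p. indicator A p * ennreal ((w p - w (p - \<sigma> *\<^sub>R e))\<^sup>2) \<partial>lborel) \<le> ennreal (\<sigma>\<^sup>2) * (\<integral>\<^sup>+p. ?G p \<partial>lborel)"
    if \<sigma>: "\<sigma> \<ge> 0" for \<sigma>
  proof -
    have "(\<integral>\<^sup>+p. indicator A p * ennreal ((w p - w (p - \<sigma> *\<^sub>R e))\<^sup>2) \<partial>lborel)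
       \<le> (\<integral>\<^sup>+p. ennreal \<sigma> * (\<integral>\<^sup>+t. indicator {0..\<sigma>} t * ?G (p - t *\<^sub>R e) \<partial>lborel) \<partial>lborel)"
    proof (rule nn_integral_mono_AE)
      show "AE p in lborel. indicator A p * ennreal ((w p - w (p - \<sigma> *\<^sub>R e))\<^sup>2)
         \<le> ennreal \<sigma> * (\<integral>\<^sup>+t. indicator {0..\<sigma>} t * ?G (p - t *\<^sub>R e) \<partial>lborel)"
        using inc[OF \<sigma>]
      proof eventually_elim
        case (elim p)
        show ?case
        proof (cases "p \<in> A")
          case True
          then have "ennreal ((w p - w (p - \<sigma> *\<^sub>R e))\<^sup>2) = ennreal ((\<integral>t\<in>{0..\<sigma>}. g (p - t *\<^sub>R e) \<partial>lborel)\<^sup>2)"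
            using elim A by auto
          also have "\<dots> \<le> ennreal \<sigma> * (\<integral>\<^sup>+t. indicator {0..\<sigma>} t * ennreal ((g (p - t *\<^sub>R e))\<^sup>2) \<partial>lborel)"
            by (rule Cauchy_Schwarz_Icc[OF _ \<sigma>]) measurable
          finally show ?thesis using True inv' by simp
        qed simp
      qed
    qed
    also have "\<dots> = ennreal \<sigma> * (\<integral>\<^sup>+p. (\<integral>\<^sup>+t. indicator {0..\<sigma>} t * ?G (p - t *\<^sub>R e) \<partial>lborel) \<partial>lborel)"
      using borel_measurable_shift_pair[of ?G e]
      by (intro nn_integral_cmult lborel.borel_measurable_nn_integral) (unfold case_prod_unfold, measurable)
    also have "\<dots> = ennreal \<sigma> * (ennreal \<sigma> * (\<integral>\<^sup>+p. ?G p \<partial>lborel))"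
      by (subst nn_integral_line[of ?G]) (use \<sigma> in auto)
    also have "\<dots> = ennreal (\<sigma>\<^sup>2) * (\<integral>\<^sup>+p. ?G p \<partial>lborel)"
      using \<sigma> by (simp add: power2_eq_square ennreal_mult mult.assoc)
    finally show ?thesis .
  qed
  show ?thesis
  proof (cases "\<tau> \<ge> 0")
    case True
    have "(\<integral>\<^sup>+p. indicator A p * ennreal ((w (p + \<tau> *\<^sub>R e) - w p)\<^sup>2) \<partial>lborel)
        = (\<integral>\<^sup>+p. indicator A (p + \<tau> *\<^sub>R e) * ennreal ((w (p + \<tau> *\<^sub>R e) - w (p + \<tau> *\<^sub>R e - \<tau> *\<^sub>R e))\<^sup>2) \<partial>lborel)"
      by (intro nn_integral_cong) (simp add: indicator_def inv)
    also have "\<dots> = (\<integral>\<^sup>+p. indicator A p * ennreal ((w p - w (p - \<tau> *\<^sub>R e))\<^sup>2) \<partial>lborel)"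
      by (rule nn_integral_translate) measurable
    finally show ?thesis using nonneg[OF True] by simp
  next
    case False
    then show ?thesis using nonneg[of "- \<tau>"] by (simp add: power2_commute)
  qed
qed

section \<open>From horizontal translations to the Sobolev-Slobodeckij seminorm\<close>

lemma ennreal_square_sum2: "ennreal ((x + y)\<^sup>2) \<le> 2 * (ennreal (x\<^sup>2) + ennreal (y\<^sup>2))"
proof -
  have "(x + y)\<^sup>2 \<le> 2 * (x\<^sup>2 + y\<^sup>2)"
    using sum_squares_bound[of x y] by (simp add: power2_sum)
  then have "ennreal ((x + y)\<^sup>2) \<le> ennreal (2 * (x\<^sup>2 + y\<^sup>2))" by (rule ennreal_leI)
  also have "\<dots> = 2 * (ennreal (x\<^sup>2) + ennreal (y\<^sup>2))"
    by (subst ennreal_mult') simp_all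
  finally show ?thesis .
qed

lemma ennreal_square_sum3: "ennreal ((x + y + z)\<^sup>2) \<le> 3 * (ennreal (x\<^sup>2) + ennreal (y\<^sup>2) + ennreal (z\<^sup>2))"
proof -
  have "0 \<le> (x - y)\<^sup>2 + (y - z)\<^sup>2 + (x - z)\<^sup>2" by simp
  then have "(x + y + z)\<^sup>2 \<le> 3 * (x\<^sup>2 + y\<^sup>2 + z\<^sup>2)"
    by (simp add: power2_eq_square algebra_simps)
  then have "ennreal ((x + y + z)\<^sup>2) \<le> ennreal (3 * (x\<^sup>2 + y\<^sup>2 + z\<^sup>2))" by (rule ennreal_leI)
  also have "\<dots> = 3 * (ennreal (x\<^sup>2) + ennreal (y\<^sup>2) + ennreal (z\<^sup>2))"
    by (subst ennreal_mult') simp_all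
  finally show ?thesis .
qed

lemma Basis_pt2: "(Basis :: pt2 set) = {axis 1 1, axis 2 1}"
  by (auto simp: Basis_vec_def UNIV_2)

text \<open>The shift by \<open>h\<close> is composed of one shift along each axis; the factor 2 is
  that of \<open>(x + y)^2 <= 2 (x^2 + y^2)\<close>, and Pythagoras adds up the squared
  lengths.\<close>

lemma horizontal_translation_bound:
  fixes w :: "pt3 \<Rightarrow> real"
  assumes [measurable]: "w \<in> borel_measurable borel" "I \<in> sets borel"
    and bnd: "\<And>e \<tau>. e \<in> Basis \<Longrightarrow> (\<integral>\<^sup>+p. indicator (UNIV \<times> I) p * ennreal ((w (p + \<tau> *\<^sub>R (e, 0)) - w p)\<^sup>2) \<partial>lborel) \<le> ennreal (\<tau>\<^sup>2) * \<Gamma>"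
  shows "(\<integral>\<^sup>+p. indicator (UNIV \<times> I) p * ennreal ((w (p + (h, 0)) - w p)\<^sup>2) \<partial>lborel) \<le> ennreal (2 * (norm h)\<^sup>2) * \<Gamma>"
proof -
  define a b :: pt2 where "a = axis 1 1" and "b = axis 2 1"
  have B: "a \<in> Basis" "b \<in> Basis" by (auto simp: a_def b_def Basis_pt2)
  have [measurable]: "UNIV \<times> I \<in> sets (borel :: pt3 measure)" by (simp add: borel_Times)
  have "a \<noteq> b" by (simp add: a_def b_def axis_eq_axis)
  then have h: "h = (h \<bullet> a) *\<^sub>R a + (h \<bullet> b) *\<^sub>R b" and nh: "(norm h)\<^sup>2 = (h \<bullet> a)\<^sup>2 + (h \<bullet> b)\<^sup>2"
    using euclidean_representation[of h] euclidean_inner[of h h] unfolding power2_norm_eq_inner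
    by (simp_all add: Basis_pt2 a_def[symmetric] b_def[symmetric] power2_eq_square)
  let ?q = "\<lambda>p. p + (h \<bullet> a) *\<^sub>R (a, 0 :: real)"
  have hp: "p + (h, 0) = ?q p + (h \<bullet> b) *\<^sub>R (b, 0)" for p :: pt3
    by (subst h) (simp add: plus_prod_def)
  have "(\<integral>\<^sup>+p. indicator (UNIV \<times> I) p * ennreal ((w (p + (h, 0)) - w p)\<^sup>2) \<partial>lborel)
     \<le> (\<integral>\<^sup>+p. 2 * (indicator (UNIV \<times> I) (?q p) * ennreal ((w (?q p + (h \<bullet> b) *\<^sub>R (b, 0)) - w (?q p))\<^sup>2)
          + indicator (UNIV \<times> I) p * ennreal ((w (?q p) - w p)\<^sup>2)) \<partial>lborel)"
  proof (rule nn_integral_mono)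
    fix p :: pt3
    have "indicator (UNIV \<times> I) (?q p) = (indicator (UNIV \<times> I) p :: ennreal)"
      by (cases p) (simp add: indicator_def)
    then show "indicator (UNIV \<times> I) p * ennreal ((w (p + (h, 0)) - w p)\<^sup>2)
      \<le> 2 * (indicator (UNIV \<times> I) (?q p) * ennreal ((w (?q p + (h \<bullet> b) *\<^sub>R (b, 0)) - w (?q p))\<^sup>2)
          + indicator (UNIV \<times> I) p * ennreal ((w (?q p) - w p)\<^sup>2))"
      using ennreal_square_sum2[of "w (?q p + (h \<bullet> b) *\<^sub>R (b, 0)) - w (?q p)" "w (?q p) - w p"]
      unfolding hp by (cases "p \<in> UNIV \<times> I") auto
  qed
  also have "\<dots> = 2 * ((\<integral>\<^sup>+p. indicator (UNIV \<times> I) (?q p) * ennreal ((w (?q p + (h \<bullet> b) *\<^sub>R (b, 0)) - w (?q p))\<^sup>2) \<partial>lborel)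
          + (\<integral>\<^sup>+p. indicator (UNIV \<times> I) p * ennreal ((w (?q p) - w p)\<^sup>2) \<partial>lborel))"
    by (subst nn_integral_cmult, measurable, subst nn_integral_add, measurable)
  also have "(\<integral>\<^sup>+p. indicator (UNIV \<times> I) (?q p) * ennreal ((w (?q p + (h \<bullet> b) *\<^sub>R (b, 0)) - w (?q p))\<^sup>2) \<partial>lborel)
     = (\<integral>\<^sup>+p. indicator (UNIV \<times> I) p * ennreal ((w (p + (h \<bullet> b) *\<^sub>R (b, 0)) - w p)\<^sup>2) \<partial>lborel)"
    by (rule nn_integral_translate[of "\<lambda>p. indicator (UNIV \<times> I) p * ennreal ((w (p + (h \<bullet> b) *\<^sub>R (b, 0)) - w p)\<^sup>2)"]) measurable
  also have "2 * (\<dots> + (\<integral>\<^sup>+p. indicator (UNIV \<times> I) p * ennreal ((w (?q p) - w p)\<^sup>2) \<partial>lborel))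
     \<le> 2 * (ennreal ((h \<bullet> b)\<^sup>2) * \<Gamma> + ennreal ((h \<bullet> a)\<^sup>2) * \<Gamma>)"
    by (intro mult_left_mono add_mono bnd B) simp
  also have "\<dots> = ennreal (2 * (norm h)\<^sup>2) * \<Gamma>"
  proof -
    have "ennreal (2 * ((h \<bullet> a)\<^sup>2 + (h \<bullet> b)\<^sup>2)) = 2 * (ennreal ((h \<bullet> a)\<^sup>2) + ennreal ((h \<bullet> b)\<^sup>2))"
      by (subst ennreal_mult') simp_all
    then show ?thesis unfolding nh by (simp add: distrib_left distrib_right ac_simps)
  qed
  finally show ?thesis .
qed

lemma nn_integral_lborel_prod:
  fixes f :: "'a::euclidean_space \<times> 'b::euclidean_space \<Rightarrow> ennreal"
  assumes [measurable]: "f \<in> borel_measurable borel"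
  shows "(\<integral>\<^sup>+p. f p \<partial>lborel) = (\<integral>\<^sup>+x. (\<integral>\<^sup>+z. f (x, z) \<partial>lborel) \<partial>lborel)"
    and "(\<integral>\<^sup>+p. f p \<partial>lborel) = (\<integral>\<^sup>+z. (\<integral>\<^sup>+x. f (x, z) \<partial>lborel) \<partial>lborel)"
proof -
  have m: "f \<in> borel_measurable (lborel \<Otimes>\<^sub>M lborel)" unfolding lborel_prod by simp
  have "(\<integral>\<^sup>+p. f p \<partial>lborel) = (\<integral>\<^sup>+p. f p \<partial>(lborel \<Otimes>\<^sub>M lborel))" unfolding lborel_prod ..
  then show "(\<integral>\<^sup>+p. f p \<partial>lborel) = (\<integral>\<^sup>+x. (\<integral>\<^sup>+z. f (x, z) \<partial>lborel) \<partial>lborel)"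
    "(\<integral>\<^sup>+p. f p \<partial>lborel) = (\<integral>\<^sup>+z. (\<integral>\<^sup>+x. f (x, z) \<partial>lborel) \<partial>lborel)"
    using lborel.nn_integral_fst[OF m] lborel_pair.nn_integral_snd[OF m] by simp_all
qed

text \<open>Gagliardo's estimate. The increment \<open>b (x + h) - b x\<close> is split at depth \<open>\<bar>z\<bar>\<close>, and the result
  is averaged over \<open>\<bar>h\<bar> < \<bar>z\<bar> < 2 \<bar>h\<bar>\<close>; after exchanging the integrals over \<open>h\<close> and \<open>z\<close>, only the area
  of a disc of radius \<open>\<bar>z\<bar>\<close> is needed.\<close>

lemma gagliardo:
  fixes b :: "pt2 \<Rightarrow> real" and w :: "pt3 \<Rightarrow> real" and \<Phi> :: "pt3 \<Rightarrow> ennreal"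
  assumes [measurable]: "b \<in> borel_measurable borel" "w \<in> borel_measurable borel" "\<Phi> \<in> borel_measurable borel"
    and trans: "\<And>h I. I \<in> sets borel \<Longrightarrow> I \<subseteq> {..<0} \<Longrightarrow>
        (\<integral>\<^sup>+p. indicator (UNIV \<times> I) p * ennreal ((w (p + (h, 0)) - w p)\<^sup>2) \<partial>lborel)
          \<le> ennreal (2 * (norm h)\<^sup>2) * (\<integral>\<^sup>+p. indicator (UNIV \<times> I) p * \<Phi> p \<partial>lborel)"
    and K: "(\<integral>\<^sup>+x. (\<integral>\<^sup>+z. indicator {..<0} z * ennreal ((b x - w (x, z))\<^sup>2 / z\<^sup>2) \<partial>lborel) \<partial>lborel) \<le> K"
  shows "(\<integral>\<^sup>+h. (\<integral>\<^sup>+x. ennreal ((b (x + h) - b x)\<^sup>2 / norm h ^ 3) \<partial>lborel) \<partial>lborel)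
     \<le> ennreal (96 * pi) * K + ennreal (24 * pi) * (\<integral>\<^sup>+p. \<Phi> p \<partial>lborel)"
proof -
  define A where "A z = (\<integral>\<^sup>+x. ennreal ((b x - w (x, z))\<^sup>2) \<partial>lborel)" for z
  define \<Psi> where "\<Psi> z = (\<integral>\<^sup>+x. \<Phi> (x, z) \<partial>lborel)" for z
  have [measurable]: "A \<in> borel_measurable borel" "\<Psi> \<in> borel_measurable borel"
    unfolding A_def[abs_def] \<Psi>_def[abs_def] by measurable
  have times [measurable]: "UNIV \<times> I \<in> sets (borel :: pt3 measure)" if "I \<in> sets borel" for I
    using that by (simp add: borel_Times)
  let ?N = "\<lambda>h. \<integral>\<^sup>+x. ennreal ((b (x + h) - b x)\<^sup>2) \<partial>lborel"
  have step: "ennreal (norm h) * ?N h \<le> (\<integral>\<^sup>+z. indicator {- 2 * norm h<..<- norm h} z * (6 * A z + ennreal (6 * (norm h)\<^sup>2) * \<Psi> z) \<partial>lborel)"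
    for h
  proof -
    let ?I = "{- 2 * norm h<..<- norm h}"
    \<comment> \<open>The averaging: \<open>norm h\<close> is the length of the interval
      \<open>?I\<close>, and the increment of \<open>b\<close> does not depend on
      \<open>z\<close>.\<close>
    have "ennreal (norm h) * ?N h = (\<integral>\<^sup>+z. indicator ?I z \<partial>lborel) * ?N h" by simp
    also have "\<dots> = (\<integral>\<^sup>+z. (\<integral>\<^sup>+x. indicator ?I z * ennreal ((b (x + h) - b x)\<^sup>2) \<partial>lborel) \<partial>lborel)"
      by (simp add: nn_integral_cmult nn_integral_multc)
    also have "\<dots> \<le> (\<integral>\<^sup>+z. (\<integral>\<^sup>+x. 3 * (indicator ?I z * ennreal ((b (x + h) - w (x + h, z))\<^sup>2)
        + indicator ?I z * ennreal ((w (x + h, z) - w (x, z))\<^sup>2) + indicator ?I z * ennreal ((b x - w (x, z))\<^sup>2)) \<partial>lborel) \<partial>lborel)"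
    proof (intro nn_integral_mono)
      fix z x
      show "indicator ?I z * ennreal ((b (x + h) - b x)\<^sup>2) \<le> 3 * (indicator ?I z * ennreal ((b (x + h) - w (x + h, z))\<^sup>2)
        + indicator ?I z * ennreal ((w (x + h, z) - w (x, z))\<^sup>2) + indicator ?I z * ennreal ((b x - w (x, z))\<^sup>2))"
        using ennreal_square_sum3[of "b (x + h) - w (x + h, z)" "w (x + h, z) - w (x, z)" "w (x, z) - b x"]
        by (cases "z \<in> ?I") (auto simp: power2_commute[of "w (x, z)" "b x"])
    qed
    also have "\<dots> = (\<integral>\<^sup>+z. 3 * (indicator ?I z * (\<integral>\<^sup>+x. ennreal ((b (x + h) - w (x + h, z))\<^sup>2) \<partial>lborel)
        + (\<integral>\<^sup>+x. indicator ?I z * ennreal ((w (x + h, z) - w (x, z))\<^sup>2) \<partial>lborel) + indicator ?I z * A z) \<partial>lborel)"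
      unfolding A_def by (simp add: nn_integral_add nn_integral_cmult)
    \<comment> \<open>By translation invariance the terms at \<open>x + h\<close> and at
      \<open>x\<close> have the same integral, so that \<open>A\<close> occurs twice and the factor
      3 becomes 6.\<close>
    also have "\<dots> = (\<integral>\<^sup>+z. 3 * (indicator ?I z * A z
        + (\<integral>\<^sup>+x. indicator ?I z * ennreal ((w (x + h, z) - w (x, z))\<^sup>2) \<partial>lborel) + indicator ?I z * A z) \<partial>lborel)"
      unfolding A_def using nn_integral_translate[of "\<lambda>x. ennreal ((b x - w (x, _))\<^sup>2)" h] by simp
    also have "\<dots> = 3 * ((\<integral>\<^sup>+z. indicator ?I z * A z \<partial>lborel)
        + (\<integral>\<^sup>+z. (\<integral>\<^sup>+x. indicator ?I z * ennreal ((w (x + h, z) - w (x, z))\<^sup>2) \<partial>lborel) \<partial>lborel) + (\<integral>\<^sup>+z. indicator ?I z * A z \<partial>lborel))"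
      by (simp add: nn_integral_add nn_integral_cmult)
    also have "(\<integral>\<^sup>+z. (\<integral>\<^sup>+x. indicator ?I z * ennreal ((w (x + h, z) - w (x, z))\<^sup>2) \<partial>lborel) \<partial>lborel)
       = (\<integral>\<^sup>+p. indicator (UNIV \<times> ?I) p * ennreal ((w (p + (h, 0)) - w p)\<^sup>2) \<partial>lborel)"
      by (subst nn_integral_lborel_prod(2), measurable) (intro nn_integral_cong, simp add: indicator_def)
    also have "\<dots> \<le> ennreal (2 * (norm h)\<^sup>2) * (\<integral>\<^sup>+p. indicator (UNIV \<times> ?I) p * \<Phi> p \<partial>lborel)"
      by (rule trans) (auto intro: less_le_trans)
    also have "(\<integral>\<^sup>+p. indicator (UNIV \<times> ?I) p * \<Phi> p \<partial>lborel) = (\<integral>\<^sup>+z. indicator ?I z * \<Psi> z \<partial>lborel)"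
      unfolding \<Psi>_def
      by (subst nn_integral_lborel_prod(2), measurable) (simp add: indicator_times nn_integral_cmult)
    also have "3 * ((\<integral>\<^sup>+z. indicator ?I z * A z \<partial>lborel) + ennreal (2 * (norm h)\<^sup>2) * (\<integral>\<^sup>+z. indicator ?I z * \<Psi> z \<partial>lborel) + (\<integral>\<^sup>+z. indicator ?I z * A z \<partial>lborel))
       = 6 * (\<integral>\<^sup>+z. indicator ?I z * A z \<partial>lborel) + ennreal (6 * (norm h)\<^sup>2) * (\<integral>\<^sup>+z. indicator ?I z * \<Psi> z \<partial>lborel)"
    proof -
      have "3 * (x + ennreal (2 * r) * y + x) = 6 * x + ennreal (6 * r) * y" if "r \<ge> 0" for x y r
      proof -
        have "3 * (x + ennreal (2 * r) * y + x) = 3 * (x + x) + (3 * ennreal (2 * r)) * y"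
          by (simp add: distrib_left ac_simps)
        also have "3 * ennreal (2 * r) = ennreal (6 * r)"
          using ennreal_mult'[of 3 "2 * r"] by simp
        also have "3 * (x + x) = 6 * x" by (simp flip: mult_2 mult.assoc)
        finally show ?thesis .
      qed
      then show ?thesis by simp
    qed
    also have "\<dots> = (\<integral>\<^sup>+z. indicator ?I z * (6 * A z + ennreal (6 * (norm h)\<^sup>2) * \<Psi> z) \<partial>lborel)"
      by (simp add: nn_integral_add nn_integral_cmult distrib_left mult.left_commute[of "indicator _ _"])
    finally show ?thesis by (simp add: add_left_mono mult_left_mono)
  qed
  \<comment> \<open>On the averaging range \<open>|z| < 2 |h|\<close>, so
    \<open>6 / |h|^4 <= 96 / z^4\<close> and \<open>6 / |h|^2 <= 24 / z^2\<close>. The other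
    condition \<open>|h| < |z|\<close> is kept as a disc in \<open>h\<close>, whose area
    \<open>pi z^2\<close> then lowers both powers by two.\<close>
  let ?J = "\<lambda>(h::pt2) z. indicator {..<0} z * (indicator (ball 0 (- z)) h * (ennreal (96 / z ^ 4) * A z + ennreal (24 / z\<^sup>2) * \<Psi> z))"
  have "(\<integral>\<^sup>+h. (\<integral>\<^sup>+x. ennreal ((b (x + h) - b x)\<^sup>2 / norm h ^ 3) \<partial>lborel) \<partial>lborel) \<le> (\<integral>\<^sup>+h. (\<integral>\<^sup>+z. ?J h z \<partial>lborel) \<partial>lborel)"
  proof (rule nn_integral_mono_AE)
    show "AE h in lborel. (\<integral>\<^sup>+x. ennreal ((b (x + h) - b x)\<^sup>2 / norm h ^ 3) \<partial>lborel) \<le> (\<integral>\<^sup>+z. ?J h z \<partial>lborel)"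
      using AE_lborel_singleton[of 0]
    proof eventually_elim
      case (elim h)
      then have h: "norm h > 0" by simp
      have "(\<integral>\<^sup>+x. ennreal ((b (x + h) - b x)\<^sup>2 / norm h ^ 3) \<partial>lborel)
         = (\<integral>\<^sup>+x. ennreal (1 / norm h ^ 4) * (ennreal (norm h) * ennreal ((b (x + h) - b x)\<^sup>2)) \<partial>lborel)"
        using h by (intro nn_integral_cong) (simp add: power_numeral_reduce flip: ennreal_mult')
      also have "\<dots> = ennreal (1 / norm h ^ 4) * (ennreal (norm h) * ?N h)"
        by (simp add: nn_integral_cmult)
      also have "\<dots> \<le> ennreal (1 / norm h ^ 4) * (\<integral>\<^sup>+z. indicator {- 2 * norm h<..<- norm h} z * (6 * A z + ennreal (6 * (norm h)\<^sup>2) * \<Psi> z) \<partial>lborel)"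
        by (rule mult_left_mono[OF step]) simp
      also have "\<dots> = (\<integral>\<^sup>+z. ennreal (1 / norm h ^ 4) * (indicator {- 2 * norm h<..<- norm h} z * (6 * A z + ennreal (6 * (norm h)\<^sup>2) * \<Psi> z)) \<partial>lborel)"
        by (rule nn_integral_cmult[symmetric]) measurable
      also have "\<dots> \<le> (\<integral>\<^sup>+z. ?J h z \<partial>lborel)"
      proof (rule nn_integral_mono)
        fix z
        show "ennreal (1 / norm h ^ 4) * (indicator {- 2 * norm h<..<- norm h} z * (6 * A z + ennreal (6 * (norm h)\<^sup>2) * \<Psi> z)) \<le> ?J h z"
        proof (cases "z \<in> {- 2 * norm h<..<- norm h}")
          case True
          then have z: "z < 0" "- z < 2 * norm h" "norm h < - z" using h by auto
          have 4: "z ^ 4 \<le> 16 * norm h ^ 4"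
            using power_mono[of "- z" "2 * norm h" 4] z by (simp add: power_mult_distrib)
          have 2: "z\<^sup>2 \<le> 4 * (norm h)\<^sup>2"
            using power_mono[of "- z" "2 * norm h" 2] z by (simp add: power_mult_distrib)
          have "ennreal (1 / norm h ^ 4) * (6 * A z + ennreal (6 * (norm h)\<^sup>2) * \<Psi> z)
             = ennreal (6 / norm h ^ 4) * A z + ennreal (6 / (norm h)\<^sup>2) * \<Psi> z"
          proof -
            have "ennreal (1 / norm h ^ 4) * 6 = ennreal (6 / norm h ^ 4)"
              using ennreal_mult''[of 6 "1 / norm h ^ 4"] by simp
            moreover have "ennreal (1 / norm h ^ 4) * ennreal (6 * (norm h)\<^sup>2) = ennreal (6 / (norm h)\<^sup>2)"
              using h by (simp add: power_numeral_reduce field_simps flip: ennreal_mult')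
            ultimately show ?thesis by (simp add: distrib_left flip: mult.assoc)
          qed
          also have "\<dots> \<le> ennreal (96 / z ^ 4) * A z + ennreal (24 / z\<^sup>2) * \<Psi> z"
            using z h 2 4 by (intro add_mono mult_right_mono ennreal_leI) (auto simp: field_simps)
          finally show ?thesis using True z by (simp add: dist_norm)
        qed simp
      qed
      finally show ?case .
    qed
  qed
  also have "\<dots> = (\<integral>\<^sup>+z. (\<integral>\<^sup>+h. ?J h z \<partial>lborel) \<partial>lborel)"
    by (rule lborel_pair.Fubini'[symmetric]) (unfold case_prod_unfold mem_ball indicator_def, measurable)
  also have "\<dots> = (\<integral>\<^sup>+z. ennreal (96 * pi) * (indicator {..<0} z * (ennreal (1 / z\<^sup>2) * A z)) + ennreal (24 * pi) * (indicator {..<0} z * \<Psi> z) \<partial>lborel)"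
  proof (rule nn_integral_cong)
    fix z :: real
    show "(\<integral>\<^sup>+h. ?J h z \<partial>lborel) = ennreal (96 * pi) * (indicator {..<0} z * (ennreal (1 / z\<^sup>2) * A z)) + ennreal (24 * pi) * (indicator {..<0} z * \<Psi> z)"
    proof (cases "z < 0")
      case True
      have "(\<integral>\<^sup>+h. ?J h z \<partial>lborel)
         = (\<integral>\<^sup>+h. indicator (ball (0 :: pt2) (- z)) h \<partial>lborel) * (ennreal (96 / z ^ 4) * A z + ennreal (24 / z\<^sup>2) * \<Psi> z)"
        using True by (subst nn_integral_multc[symmetric]) (auto intro!: borel_measurable_indicator)
      also have "(\<integral>\<^sup>+h. indicator (ball (0 :: pt2) (- z)) h \<partial>lborel) = emeasure lborel (ball (0 :: pt2) (- z))"
        by (rule nn_integral_indicator) simp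
      also have "emeasure lborel (ball (0 :: pt2) (- z)) = ennreal (z\<^sup>2 * pi)"
        using True by (simp add: emeasure_ball unit_ball_vol_2 mult.commute)
      also have "ennreal (z\<^sup>2 * pi) * (ennreal (96 / z ^ 4) * A z + ennreal (24 / z\<^sup>2) * \<Psi> z)
         = ennreal (z\<^sup>2 * pi * (96 / z ^ 4)) * A z + ennreal (z\<^sup>2 * pi * (24 / z\<^sup>2)) * \<Psi> z"
      proof -
        have "ennreal (z\<^sup>2 * pi * c) * a = ennreal (z\<^sup>2 * pi) * (ennreal c * a)" for c a
          by (subst ennreal_mult'[of "z\<^sup>2 * pi" c]) (simp_all add: mult.assoc)
        then show ?thesis by (simp only: distrib_left)
      qed
      also have "z\<^sup>2 * pi * (96 / z ^ 4) = 96 * pi * (1 / z\<^sup>2)" using True by (simp add: power_numeral_reduce field_simps)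
      also have "z\<^sup>2 * pi * (24 / z\<^sup>2) = 24 * pi" using True by simp
      also have "ennreal (96 * pi * (1 / z\<^sup>2)) = ennreal (96 * pi) * ennreal (1 / z\<^sup>2)" by (rule ennreal_mult') simp
      finally show ?thesis using True by (simp add: mult.assoc)
    qed simp
  qed
  also have "\<dots> = ennreal (96 * pi) * (\<integral>\<^sup>+z. indicator {..<0} z * (ennreal (1 / z\<^sup>2) * A z) \<partial>lborel) + ennreal (24 * pi) * (\<integral>\<^sup>+z. indicator {..<0} z * \<Psi> z \<partial>lborel)"
    by (subst nn_integral_add, measurable, subst nn_integral_cmult, measurable, subst nn_integral_cmult, measurable)
  also have "\<dots> \<le> ennreal (96 * pi) * K + ennreal (24 * pi) * (\<integral>\<^sup>+p. \<Phi> p \<partial>lborel)"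
  proof (intro add_mono mult_left_mono)
    have "(\<integral>\<^sup>+z. indicator {..<0} z * (ennreal (1 / z\<^sup>2) * A z) \<partial>lborel)
        = (\<integral>\<^sup>+z. (\<integral>\<^sup>+x. indicator {..<0} z * ennreal ((b x - w (x, z))\<^sup>2 / z\<^sup>2) \<partial>lborel) \<partial>lborel)"
    proof (rule nn_integral_cong)
      fix z :: real
      have "(\<integral>\<^sup>+x. indicator {..<0} z * ennreal ((b x - w (x, z))\<^sup>2 / z\<^sup>2) \<partial>lborel)
         = (\<integral>\<^sup>+x. indicator {..<0} z * ennreal (1 / z\<^sup>2) * ennreal ((b x - w (x, z))\<^sup>2) \<partial>lborel)"
        by (intro nn_integral_cong) (simp add: mult.assoc flip: ennreal_mult')
      also have "\<dots> = indicator {..<0} z * ennreal (1 / z\<^sup>2) * A z"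
        unfolding A_def by (rule nn_integral_cmult) measurable
      finally show "indicator {..<0} z * (ennreal (1 / z\<^sup>2) * A z) = (\<integral>\<^sup>+x. indicator {..<0} z * ennreal ((b x - w (x, z))\<^sup>2 / z\<^sup>2) \<partial>lborel)"
        by (simp add: mult.assoc)
    qed
    also have "\<dots> = (\<integral>\<^sup>+x. (\<integral>\<^sup>+z. indicator {..<0} z * ennreal ((b x - w (x, z))\<^sup>2 / z\<^sup>2) \<partial>lborel) \<partial>lborel)"
      by (rule lborel_pair.Fubini') measurable
    finally show "(\<integral>\<^sup>+z. indicator {..<0} z * (ennreal (1 / z\<^sup>2) * A z) \<partial>lborel) \<le> K" using K by simp
    have "(\<integral>\<^sup>+z. indicator {..<0} z * \<Psi> z \<partial>lborel) \<le> (\<integral>\<^sup>+z. \<Psi> z \<partial>lborel)"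
      by (intro nn_integral_mono) (auto simp: indicator_def)
    also have "\<dots> = (\<integral>\<^sup>+p. \<Phi> p \<partial>lborel)"
      unfolding \<Psi>_def by (rule nn_integral_lborel_prod(2)[symmetric]) measurable
    finally show "(\<integral>\<^sup>+z. indicator {..<0} z * \<Psi> z \<partial>lborel) \<le> (\<integral>\<^sup>+p. \<Phi> p \<partial>lborel)" .
  qed simp_all
  finally show ?thesis .
qed

text \<open>Intervals ending at 0 have positive measure, so a property valid almost everywhere can
  be met arbitrarily close to the surface. The representation of a velocity holds only almost
  everywhere, and the surface itself is reached as a limit.\<close>

lemma AE_lborel_obtain_seq:
  assumes P: "AE z in lborel. P z" and d: "d > (0::real)"
  obtains z where "\<And>n. P (z n)" "\<And>n. - d < z n" "\<And>n. z n < 0" "z \<longlonglongrightarrow> 0"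
proof -
  have "\<exists>z. P z \<and> - (d / real (Suc n)) < z \<and> z < 0" for n
  proof (rule ccontr)
    assume "\<not> ?thesis"
    then have "AE z in lborel. z \<notin> {- (d / real (Suc n))<..<0}"
      by (intro eventually_mono[OF P]) auto
    then have "{- (d / real (Suc n))<..<0} \<in> null_sets lborel"
      by (subst AE_iff_null_sets) auto
    then have "emeasure lborel {- (d / real (Suc n))<..<0} = 0" by auto
    moreover have "0 < d / real (Suc n)" using d by simp
    ultimately show False by (simp add: ennreal_eq_0_iff del: of_nat_Suc)
  qed
  then obtain z where z: "\<And>n. P (z n)" "\<And>n. - (d / real (Suc n)) < z n" "\<And>n. z n < 0" by metis
  show thesis
  proof (rule that[OF z(1) _ z(3)])
    show "- d < z n" for n
    proof -
      have "d / real (Suc n) \<le> d" using d by (simp add: divide_le_eq)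
      then show ?thesis using z(2)[of n] by linarith
    qed
    show "z \<longlonglongrightarrow> 0"
    proof (rule tendsto_sandwich)
      show "(\<lambda>n. - (d / real (Suc n))) \<longlonglongrightarrow> 0"
        using tendsto_minus[OF tendsto_mult_right_zero[OF LIMSEQ_Suc[OF lim_1_over_n], of d]] by simp
      show "\<forall>\<^sub>F n in sequentially. - (d / real (Suc n)) \<le> z n" "\<forall>\<^sub>F n in sequentially. z n \<le> 0"
        using z(2,3) by (auto intro!: always_eventually less_imp_le)
    qed simp
  qed
qed

section \<open>The surface trace of a velocity as a line integral, and its norm\<close>

context basin begin

lemma closure_Omega_top: "x \<in> S \<Longrightarrow> (x, 0) \<in> closure \<Omega>"
proof -
  assume x: "x \<in> S"
  \<comment> \<open>The denominators start at 2, so that even the first point lies strictly above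
    the bottom.\<close>
  have "(\<lambda>n. (x, - (D x / real (Suc (Suc n))))) \<longlonglongrightarrow> (x, 0)"
    using tendsto_minus[OF tendsto_mult_right_zero[OF LIMSEQ_Suc[OF LIMSEQ_Suc[OF lim_1_over_n]], of "D x"]]
    by (intro tendsto_Pair) simp_all
  moreover have "(x, - (D x / real (Suc (Suc n)))) \<in> \<Omega>" for n
    using x D_pos[OF x] by (auto simp: Omega_def divide_less_eq)
  ultimately show ?thesis
    unfolding closure_sequential by (intro exI[of _ "\<lambda>n. (x, - (D x / real (Suc (Suc n))))"] conjI allI)
qed

text \<open>A component of the surface trace, extended by zero to the plane so that it can be
  translated freely.\<close>

definition top_value :: "(pt3 \<Rightarrow> pt2) \<Rightarrow> pt2 \<Rightarrow> pt2 \<Rightarrow> real" where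
  "top_value v j x = indicator S x * (v (x, 0) \<bullet> j)"

lemma borel_measurable_top_value:
  assumes v: "continuous_on (closure \<Omega>) v"
  shows "top_value v j \<in> borel_measurable borel"
proof -
  have "continuous_on S (\<lambda>x. v (x, 0) \<bullet> j)"
    by (intro continuous_intros continuous_on_compose2[OF v]) (use closure_Omega_top in auto)
  from borel_measurable_continuous_on_indicator[OF _ this] show ?thesis
    using open_S by (simp add: top_value_def[abs_def])
qed

text \<open>The representation from below gives the integral of \<open>g\<close> up to depth
  \<open>z\<close>; letting \<open>z\<close> tend to 0 and using continuity of \<open>v\<close>
  gives the integral over the whole column as surface value. The difference is the integral above
  \<open>z\<close>.\<close>

lemma top_value_rep:
  assumes cont: "continuous_on (closure \<Omega>) v" and r: "line_rep \<Omega> width e_z w g"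
    and w: "\<And>p. w p = indicator \<Omega> p * (v p \<bullet> j)"
  shows "AE x in lborel. AE z in lborel. z < 0 \<longrightarrow> top_value v j x - w (x, z) = (\<integral>s. indicator {z<..<0} s * g (x, s) \<partial>lborel)"
proof -
  note [measurable] = line_repD(1,2)[OF r]
  have far: "\<And>p q. p \<in> \<Omega> \<Longrightarrow> q \<in> \<Omega> \<Longrightarrow> dist p q < width" using wide_width by (simp add: wide_def)
  have gI: "integrable lborel g"
    using square_integrable_imp_integrable[OF line_repD(2)[OF r] line_repD(6)[OF r] line_repD(4)[OF r] open_Omega bounded_Omega] .
  then have "integrable (lborel \<Otimes>\<^sub>M lborel) g" unfolding lborel_prod .
  then have gx: "AE x in lborel. integrable lborel (\<lambda>s. g (x, s))"
    by (rule lborel_pair.AE_integrable_fst')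
  show ?thesis
    using gx AE_lborel_prod_swap(2)[OF line_repD(7)[OF r]]
  proof eventually_elim
    case (elim x)
    note gi = elim(1)
    have [measurable]: "(\<lambda>s. g (x, s)) \<in> borel_measurable borel" using borel_measurable_integrable[OF gi] by simp
    show ?case
    proof (cases "x \<in> S")
      case False
      then have "g (x, s) = 0" "w (x, s) = 0" for s
        using line_repD(4)[OF r, of "(x, s)"] by (auto simp: Omega_def w)
      then show ?thesis using False by (simp add: top_value_def)
    next
      case True
      have g0: "g (x, s) = 0" if "s \<le> - D x \<or> 0 \<le> s" for s
        using line_repD(4)[OF r, of "(x, s)"] that by (auto simp: Omega_def)
      \<comment> \<open>After the substitution \<open>s = z - t\<close> the segment may be prolonged
        to all \<open>s <= z\<close>, since \<open>g\<close> vanishes at distances greater than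
        \<open>width\<close> from a point of the basin.\<close>
      have rep: "w (x, z) = (\<integral>s. indicator {..z} s * g (x, s) \<partial>lborel)"
        if z: "(x, z) \<in> \<Omega>" and e: "(x, z) \<in> \<Omega> \<longrightarrow> w (x, z) = (\<integral>t\<in>{0..width}. g ((x, z) - t *\<^sub>R e_z) \<partial>lborel)" for z
      proof -
        have "w (x, z) = (\<integral>t. indicator {0..width} t * g (x, z - t) \<partial>lborel)"
          using z e by (simp add: set_lebesgue_integral_def minus_prod_def)
        also have "\<dots> = (\<integral>s. indicator {0..width} (z + (-1) * s) * g (x, z - (z + (-1) * s)) \<partial>lborel)"
          using lborel_integral_real_affine[of "-1" "\<lambda>t. indicator {0..width} t * g (x, z - t)" z] by simp
        also have "\<dots> = (\<integral>s. indicator {..z} s * g (x, s) \<partial>lborel)"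
        proof (intro Bochner_Integration.integral_cong refl)
          fix s
          have "g (x, s) = 0" if "z - s > width"
          proof (rule line_repD(4)[OF r], rule notI)
            assume "(x, s) \<in> \<Omega>"
            from far[OF z this] show False using that by (simp add: dist_Pair_Pair dist_real_def)
          qed
          then show "indicator {0..width} (z + (-1) * s) * g (x, z - (z + (-1) * s)) = indicator {..z} s * g (x, s)"
            by (auto simp: indicator_def)
        qed
        finally show ?thesis .
      qed
      obtain z where z: "\<And>n. (x, z n) \<in> \<Omega> \<longrightarrow> w (x, z n) = (\<integral>t\<in>{0..width}. g ((x, z n) - t *\<^sub>R e_z) \<partial>lborel)"
        "\<And>n. - D x < z n" "\<And>n. z n < 0" "z \<longlonglongrightarrow> 0"
        by (rule AE_lborel_obtain_seq[OF elim(2) D_pos[OF True]]) (rule that)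
      have zO: "(x, z n) \<in> \<Omega>" for n using True z(2,3) by (simp add: Omega_def)
      have zrep: "v (x, z n) \<bullet> j = (\<integral>s. indicator {..z n} s * g (x, s) \<partial>lborel)" for n
      proof -
        have "w (x, z n) = v (x, z n) \<bullet> j" unfolding w using zO[of n] by simp
        then show ?thesis using rep[OF zO z(1), of n] by simp
      qed
      have "(\<lambda>n. v (x, z n)) \<longlonglongrightarrow> v (x, 0)"
      proof (rule continuous_on_tendsto_compose[OF cont _ closure_Omega_top[OF True]])
        show "(\<lambda>n. (x, z n)) \<longlonglongrightarrow> (x, 0)" by (intro tendsto_Pair tendsto_const z(4))
        show "\<forall>\<^sub>F n in sequentially. (x, z n) \<in> closure \<Omega>"
          using zO closure_subset by (intro always_eventually) blast
      qed
      then have "(\<lambda>n. v (x, z n) \<bullet> j) \<longlonglongrightarrow> v (x, 0) \<bullet> j" by (intro tendsto_intros)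
      moreover have "(\<lambda>n. v (x, z n) \<bullet> j) \<longlonglongrightarrow> (\<integral>s. g (x, s) \<partial>lborel)"
        unfolding zrep
      proof (rule integral_dominated_convergence[where w="\<lambda>s. norm (g (x, s))"])
        show "AE s in lborel. (\<lambda>n. indicator {..z n} s * g (x, s)) \<longlonglongrightarrow> g (x, s)"
        proof (intro AE_I2)
          fix s
          show "(\<lambda>n. indicator {..z n} s * g (x, s)) \<longlonglongrightarrow> g (x, s)"
          proof (cases "s < 0")
            case True
            then have "\<forall>\<^sub>F n in sequentially. s < z n" using order_tendstoD(1)[OF z(4)] by blast
            then have "\<forall>\<^sub>F n in sequentially. g (x, s) = indicator {..z n} s * g (x, s)"
              by eventually_elim simp
            then show ?thesis by (rule Lim_transform_eventually[OF tendsto_const])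
          qed (simp add: g0)
        qed
        show "AE s in lborel. norm (indicator {..z n} s * g (x, s)) \<le> norm (g (x, s))" for n
          by (intro AE_I2) (auto simp: indicator_def)
      qed (use gi in auto)
      ultimately have top: "v (x, 0) \<bullet> j = (\<integral>s. g (x, s) \<partial>lborel)" by (rule LIMSEQ_unique)
      show ?thesis
        using elim(2)
      proof eventually_elim
        case (elim z)
        show ?case
        proof
          assume z0: "z < 0"
          have wz: "w (x, z) = (\<integral>s. indicator {..z} s * g (x, s) \<partial>lborel)"
          \<comment> \<open>Below the bottom both sides vanish. The identity is wanted on the whole
            half line, on which Hardy's inequality integrates.\<close>
          proof (cases "- D x < z")
            case True
            with \<open>x \<in> S\<close> z0 have "(x, z) \<in> \<Omega>" by (simp add: Omega_def)
            from rep[OF this elim] show ?thesis .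
          next
            case False
            then have "(\<lambda>s. indicator {..z} s * g (x, s)) = (\<lambda>s. 0)"
              using g0 by (auto simp: indicator_def fun_eq_iff)
            moreover have "w (x, z) = 0" using False by (simp add: w Omega_def)
            ultimately show ?thesis by (simp only: Bochner_Integration.integral_zero)
          qed
          have i: "integrable lborel (\<lambda>s. indicator {..z} s * g (x, s))"
            using integrable_mult_indicator[OF _ gi, of "{..z}"] by simp
          have "(\<integral>s. indicator {z<..<0} s * g (x, s) \<partial>lborel) = (\<integral>s. g (x, s) - indicator {..z} s * g (x, s) \<partial>lborel)"
            by (intro Bochner_Integration.integral_cong refl) (use g0 in \<open>auto simp: indicator_def\<close>)
          also have "\<dots> = v (x, 0) \<bullet> j - w (x, z)"
            unfolding top wz by (rule Bochner_Integration.integral_diff[OF gi i])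
          finally show "top_value v j x - w (x, z) = (\<integral>s. indicator {z<..<0} s * g (x, s) \<partial>lborel)"
            using True by (simp add: top_value_def)
        qed
      qed
    qed
  qed
qed

text \<open>The L2 bound integrates from a depth just below the basin, whence
  \<open>D_max + 1\<close>. In the seminorm bound, \<open>432 = 96 * 4 + 24 * 2\<close>: Hardy's
  constant 4 in the first term of Gagliardo's estimate, and the two horizontal derivatives in the
  second.\<close>

lemma trace_component:
  assumes v: "v \<in> H1_bl S D" and cont: "continuous_on (closure \<Omega>) v" and j: "j \<in> Basis"
  shows "(\<integral>\<^sup>+x. ennreal ((top_value v j x)\<^sup>2) \<partial>lborel) \<le> ennreal (D_max S D + 1) * ennreal ((grad_norm \<Omega> v)\<^sup>2)"
    and "(\<integral>\<^sup>+h. (\<integral>\<^sup>+x. ennreal ((top_value v j (x + h) - top_value v j x)\<^sup>2 / norm h ^ 3) \<partial>lborel) \<partial>lborel)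
      \<le> ennreal (432 * pi) * ennreal ((grad_norm \<Omega> v)\<^sup>2)"
proof -
  define w where "w p = indicator \<Omega> p * (v p \<bullet> j)" for p
  have wm [measurable]: "w \<in> borel_measurable borel"
    using continuous_extension(1)[OF cont, of j] by (simp add: w_def[abs_def])
  have w0: "w p = 0" if "p \<notin> \<Omega>" for p using that by (simp add: w_def)
  have wv: "AE p in lborel. p \<in> \<Omega> \<longrightarrow> w p = v p \<bullet> j" by (simp add: w_def)
  note [measurable] = borel_measurable_top_value[OF cont, of j]
  have "\<exists>g. line_rep \<Omega> width e w g \<and> (AE p in lborel. p \<in> \<Omega> \<longrightarrow> g p = wderiv \<Omega> e v p \<bullet> j) \<and>
     (\<forall>\<tau>\<ge>0. AE p in lborel. snd p < 0 \<longrightarrow> w p - w (p - \<tau> *\<^sub>R e) = (\<integral>t\<in>{0..\<tau>}. g (p - t *\<^sub>R e) \<partial>lborel))"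
    if "e \<in> Basis" for e
  proof (rule H1_bl_line_rep[OF v that wm _ wv])
    show "w p = 0" if "p \<notin> \<Omega>" for p by (rule w0[OF that])
    fix g assume g: "line_rep \<Omega> width e w g" "AE p in lborel. p \<in> \<Omega> \<longrightarrow> g p = wderiv \<Omega> e v p \<bullet> j"
      "\<And>\<tau>. 0 \<le> \<tau> \<Longrightarrow> AE p in lborel. snd p < 0 \<longrightarrow> w p - w (p - \<tau> *\<^sub>R e) = (\<integral>t\<in>{0..\<tau>}. g (p - t *\<^sub>R e) \<partial>lborel)"
    show ?thesis by (intro exI[of _ g] conjI allI impI g)
  qed
  then have "\<forall>e\<in>Basis. \<exists>g. line_rep \<Omega> width e w g \<and> (AE p in lborel. p \<in> \<Omega> \<longrightarrow> g p = wderiv \<Omega> e v p \<bullet> j) \<and>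
     (\<forall>\<tau>\<ge>0. AE p in lborel. snd p < 0 \<longrightarrow> w p - w (p - \<tau> *\<^sub>R e) = (\<integral>t\<in>{0..\<tau>}. g (p - t *\<^sub>R e) \<partial>lborel))"
    by blast
  then obtain g where "\<forall>e\<in>Basis. line_rep \<Omega> width e w (g e) \<and> (AE p in lborel. p \<in> \<Omega> \<longrightarrow> g e p = wderiv \<Omega> e v p \<bullet> j) \<and>
     (\<forall>\<tau>\<ge>0. AE p in lborel. snd p < 0 \<longrightarrow> w p - w (p - \<tau> *\<^sub>R e) = (\<integral>t\<in>{0..\<tau>}. g e (p - t *\<^sub>R e) \<partial>lborel))"
    by (rule bchoice[THEN exE])
  then have g: "\<And>e. e \<in> Basis \<Longrightarrow> line_rep \<Omega> width e w (g e)"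
    "\<And>e. e \<in> Basis \<Longrightarrow> AE p in lborel. p \<in> \<Omega> \<longrightarrow> g e p = wderiv \<Omega> e v p \<bullet> j"
    "\<And>e \<tau>. e \<in> Basis \<Longrightarrow> 0 \<le> \<tau> \<Longrightarrow> AE p in lborel. snd p < 0 \<longrightarrow> w p - w (p - \<tau> *\<^sub>R e) = (\<integral>t\<in>{0..\<tau>}. g e (p - t *\<^sub>R e) \<partial>lborel)"
    by blast+
  have gm: "g e \<in> borel_measurable borel" if "e \<in> Basis" for e
    using line_repD(2)[OF g(1)[OF that]] .
  let ?\<Gamma> = "ennreal ((grad_norm \<Omega> v)\<^sup>2)"
  have total: "(\<integral>\<^sup>+p. ennreal ((g e p)\<^sup>2) \<partial>lborel) \<le> ?\<Gamma>" if e: "e \<in> Basis" for e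
  proof -
    have "has_L2_deriv \<Omega> e v" using v e by (auto simp: H1_bl_def H1_def)
    then have dv: "L2 \<Omega> (wderiv \<Omega> e v)" by (rule wderiv_L2[OF _ open_Omega])
    have "(\<integral>p. (g e p)\<^sup>2 \<partial>lborel) = (LINT p|lebesgue_on \<Omega>. (wderiv \<Omega> e v p \<bullet> j)\<^sup>2)"
      by (rule L2_extension(2)[OF dv open_Omega gm[OF e] _ g(2)[OF e]]) (rule line_repD(4)[OF g(1)[OF e]])
    also have "\<dots> \<le> (\<Sum>j\<in>Basis. LINT p|lebesgue_on \<Omega>. (wderiv \<Omega> e v p \<bullet> j)\<^sup>2)"
      by (rule member_le_sum[OF j]) simp_all
    also have "\<dots> = (L2_norm \<Omega> (wderiv \<Omega> e v))\<^sup>2" by (rule L2_norm_components(1)[OF dv, symmetric])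
    also have "\<dots> \<le> (grad_norm \<Omega> v)\<^sup>2" by (intro power_mono grad_norm_ge e) simp
    finally show ?thesis
      by (simp add: nn_integral_eq_integral line_repD(6)[OF g(1)[OF e]])
  qed
  have hor: "(e, 0) \<in> (Basis :: pt3 set)" if "e \<in> Basis" for e using that by (auto simp: Basis_prod_def)
  note rep = top_value_rep[OF cont g(1)[OF e_z_Basis] w_def]
  note gz [measurable] = gm[OF e_z_Basis]
  have gzx [measurable]: "(\<lambda>s. g e_z (x, s)) \<in> borel_measurable borel" for x by measurable
  show "(\<integral>\<^sup>+x. ennreal ((top_value v j x)\<^sup>2) \<partial>lborel) \<le> ennreal (D_max S D + 1) * ?\<Gamma>"
  proof -
    let ?K = "D_max S D"
    \<comment> \<open>Depths below the whole basin, where \<open>w\<close> is zero. An interval is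
      offered because the representation holds only for almost every depth.\<close>
    let ?Z = "{- ?K - 1<..<- ?K}"
    have "AE x in lborel. ennreal ((top_value v j x)\<^sup>2) \<le> ennreal (?K + 1) * (\<integral>\<^sup>+s. ennreal ((g e_z (x, s))\<^sup>2) \<partial>lborel)"
      using rep
    proof eventually_elim
      case (elim x)
      have "\<exists>z\<in>?Z. z < 0 \<longrightarrow> top_value v j x - w (x, z) = (\<integral>s. indicator {z<..<0} s * g e_z (x, s) \<partial>lborel)"
      proof (rule ccontr)
        assume "\<not> ?thesis"
        then have "AE z in lborel. z \<notin> ?Z" by (intro eventually_mono[OF elim]) auto
        then have "?Z \<in> null_sets lborel" by (subst AE_iff_null_sets) auto
        then have "emeasure lborel ?Z = 0" by auto
        then show False by (simp add: ennreal_eq_0_iff)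
      qed
      then obtain z where z: "z \<in> ?Z" "z < 0 \<longrightarrow> top_value v j x - w (x, z) = (\<integral>s. indicator {z<..<0} s * g e_z (x, s) \<partial>lborel)"
        by blast
      have z0: "z < 0" using z(1) D_max_pos by auto
      have "w (x, z) = 0" using z(1) Omega_subset by (intro w0) auto
      with z z0 have "ennreal ((top_value v j x)\<^sup>2) = ennreal ((\<integral>s. indicator {z<..<0} s * g e_z (x, s) \<partial>lborel)\<^sup>2)" by simp
      also have "\<dots> \<le> (\<integral>\<^sup>+s. indicator {z<..<0} s * ennreal (1 / 1) \<partial>lborel) * (\<integral>\<^sup>+s. indicator {z<..<0} s * ennreal (1 * (g e_z (x, s))\<^sup>2) \<partial>lborel)"
        by (rule Cauchy_Schwarz_set_nn[of "\<lambda>s. g e_z (x, s)" "\<lambda>_. 1"]) auto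
      also have "\<dots> \<le> ennreal (?K + 1) * (\<integral>\<^sup>+s. ennreal ((g e_z (x, s))\<^sup>2) \<partial>lborel)"
      proof (intro mult_mono)
        show "(\<integral>\<^sup>+s. indicator {z<..<0} s * ennreal (1 / 1) \<partial>lborel) \<le> ennreal (?K + 1)"
          using z(1) z0 by (simp add: ennreal_leI)
        show "(\<integral>\<^sup>+s. indicator {z<..<0} s * ennreal (1 * (g e_z (x, s))\<^sup>2) \<partial>lborel) \<le> (\<integral>\<^sup>+s. ennreal ((g e_z (x, s))\<^sup>2) \<partial>lborel)"
          by (intro nn_integral_mono) (auto simp: indicator_def)
      qed simp_all
      finally show ?case .
    qed
    then have "(\<integral>\<^sup>+x. ennreal ((top_value v j x)\<^sup>2) \<partial>lborel) \<le> (\<integral>\<^sup>+x. ennreal (?K + 1) * (\<integral>\<^sup>+s. ennreal ((g e_z (x, s))\<^sup>2) \<partial>lborel) \<partial>lborel)"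
      by (rule nn_integral_mono_AE)
    also have "\<dots> = ennreal (?K + 1) * (\<integral>\<^sup>+x. (\<integral>\<^sup>+s. ennreal ((g e_z (x, s))\<^sup>2) \<partial>lborel) \<partial>lborel)"
      by (rule nn_integral_cmult) measurable
    also have "(\<integral>\<^sup>+x. (\<integral>\<^sup>+s. ennreal ((g e_z (x, s))\<^sup>2) \<partial>lborel) \<partial>lborel) = (\<integral>\<^sup>+p. ennreal ((g e_z p)\<^sup>2) \<partial>lborel)"
      by (rule nn_integral_lborel_prod(1)[symmetric]) measurable
    also have "ennreal (?K + 1) * \<dots> \<le> ennreal (?K + 1) * ?\<Gamma>"
      by (rule mult_left_mono[OF total[OF e_z_Basis]]) simp
    finally show ?thesis .
  qed
  \<comment> \<open>The sum over both horizontal directions dominates each of them, so that a single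
    density controls shifts in every direction.\<close>
  let ?\<Phi> = "\<lambda>p. \<Sum>e\<in>Basis. ennreal ((g (e, 0) p)\<^sup>2)"
  have gsq: "(\<lambda>p. ennreal ((g (e, 0) p)\<^sup>2)) \<in> borel_measurable borel" if "e \<in> Basis" for e
  proof -
    note [measurable] = gm[OF hor[OF that]]
    show ?thesis by measurable
  qed
  have \<Phi>m: "?\<Phi> \<in> borel_measurable borel"
    by (rule borel_measurable_sum[OF gsq])
  have "(\<integral>\<^sup>+h. (\<integral>\<^sup>+x. ennreal ((top_value v j (x + h) - top_value v j x)\<^sup>2 / norm h ^ 3) \<partial>lborel) \<partial>lborel)
      \<le> ennreal (96 * pi) * (4 * ?\<Gamma>) + ennreal (24 * pi) * (\<integral>\<^sup>+p. ?\<Phi> p \<partial>lborel)"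
  proof (rule gagliardo[OF _ wm \<Phi>m])
    fix h and I :: "real set"
    assume I [measurable]: "I \<in> sets borel" and I0: "I \<subseteq> {..<0}"
    have [measurable]: "UNIV \<times> I \<in> sets (borel :: pt3 measure)" by (simp add: borel_Times)
    show "(\<integral>\<^sup>+p. indicator (UNIV \<times> I) p * ennreal ((w (p + (h, 0)) - w p)\<^sup>2) \<partial>lborel)
          \<le> ennreal (2 * (norm h)\<^sup>2) * (\<integral>\<^sup>+p. indicator (UNIV \<times> I) p * ?\<Phi> p \<partial>lborel)"
    proof (rule horizontal_translation_bound[OF wm I])
      fix e :: pt2 and \<tau> assume e: "e \<in> Basis"
      note [measurable] = gm[OF hor[OF e]]
      have "(\<integral>\<^sup>+p. indicator (UNIV \<times> I) p * ennreal ((w (p + \<tau> *\<^sub>R (e, 0)) - w p)\<^sup>2) \<partial>lborel)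
         \<le> ennreal (\<tau>\<^sup>2) * (\<integral>\<^sup>+p. indicator (UNIV \<times> I) p * ennreal ((g (e, 0) p)\<^sup>2) \<partial>lborel)"
      proof (rule translation_bound[where H="{p. snd p < 0}"])
        show "p + t *\<^sub>R (e, 0) \<in> UNIV \<times> I \<longleftrightarrow> p \<in> UNIV \<times> I" for p t by (cases p) simp
        show "AE p in lborel. p \<in> {p. snd p < 0} \<longrightarrow> w p - w (p - \<sigma> *\<^sub>R (e, 0)) = (\<integral>t\<in>{0..\<sigma>}. g (e, 0) (p - t *\<^sub>R (e, 0)) \<partial>lborel)"
          if "0 \<le> \<sigma>" for \<sigma> using g(3)[OF hor[OF e] that] by simp
      qed (use I0 in auto)
      also have "\<dots> \<le> ennreal (\<tau>\<^sup>2) * (\<integral>\<^sup>+p. indicator (UNIV \<times> I) p * ?\<Phi> p \<partial>lborel)"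
        by (intro mult_left_mono nn_integral_mono
            member_le_sum[of e Basis "\<lambda>e. ennreal ((g (e, 0) _)\<^sup>2)", OF e]) simp_all
      finally show "(\<integral>\<^sup>+p. indicator (UNIV \<times> I) p * ennreal ((w (p + \<tau> *\<^sub>R (e, 0)) - w p)\<^sup>2) \<partial>lborel)
        \<le> ennreal (\<tau>\<^sup>2) * (\<integral>\<^sup>+p. indicator (UNIV \<times> I) p * ?\<Phi> p \<partial>lborel)" .
    qed
  next
    have "(\<integral>\<^sup>+x. (\<integral>\<^sup>+z. indicator {..<0} z * ennreal ((top_value v j x - w (x, z))\<^sup>2 / z\<^sup>2) \<partial>lborel) \<partial>lborel)
       \<le> (\<integral>\<^sup>+x. 4 * (\<integral>\<^sup>+s. ennreal ((g e_z (x, s))\<^sup>2) \<partial>lborel) \<partial>lborel)"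
    proof (rule nn_integral_mono_AE)
      show "AE x in lborel. (\<integral>\<^sup>+z. indicator {..<0} z * ennreal ((top_value v j x - w (x, z))\<^sup>2 / z\<^sup>2) \<partial>lborel)
         \<le> 4 * (\<integral>\<^sup>+s. ennreal ((g e_z (x, s))\<^sup>2) \<partial>lborel)"
        using rep
      proof eventually_elim
        case (elim x)
        show ?case by (rule hardy[OF _ gzx elim]) measurable
      qed
    qed
    also have "\<dots> = 4 * (\<integral>\<^sup>+x. (\<integral>\<^sup>+s. ennreal ((g e_z (x, s))\<^sup>2) \<partial>lborel) \<partial>lborel)"
      by (rule nn_integral_cmult) measurable
    also have "(\<integral>\<^sup>+x. (\<integral>\<^sup>+s. ennreal ((g e_z (x, s))\<^sup>2) \<partial>lborel) \<partial>lborel) = (\<integral>\<^sup>+p. ennreal ((g e_z p)\<^sup>2) \<partial>lborel)"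
      by (rule nn_integral_lborel_prod(1)[symmetric]) measurable
    also have "4 * \<dots> \<le> 4 * ?\<Gamma>"
      by (rule mult_left_mono[OF total[OF e_z_Basis]]) simp
    finally show "(\<integral>\<^sup>+x. (\<integral>\<^sup>+z. indicator {..<0} z * ennreal ((top_value v j x - w (x, z))\<^sup>2 / z\<^sup>2) \<partial>lborel) \<partial>lborel) \<le> 4 * ?\<Gamma>" .
  qed measurable
  also have "(\<integral>\<^sup>+p. ?\<Phi> p \<partial>lborel) = (\<Sum>e\<in>Basis. \<integral>\<^sup>+p. ennreal ((g (e, 0) p)\<^sup>2) \<partial>lborel)"
    using gsq by (intro nn_integral_sum) simp
  also have "\<dots> \<le> (\<Sum>e\<in>(Basis :: pt2 set). ?\<Gamma>)"
    by (intro sum_mono total hor)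
  also have "\<dots> = 2 * ?\<Gamma>" by simp
  also have "ennreal (96 * pi) * (4 * ?\<Gamma>) + ennreal (24 * pi) * (2 * ?\<Gamma>) = ennreal (432 * pi) * ?\<Gamma>"
  proof -
    have "ennreal (96 * pi) * 4 = ennreal (384 * pi)" "ennreal (24 * pi) * 2 = ennreal (48 * pi)"
      using ennreal_mult''[of 4 "96 * pi"] ennreal_mult''[of 2 "24 * pi"] by (simp_all add: mult.commute)
    then have "ennreal (96 * pi) * (4 * ?\<Gamma>) + ennreal (24 * pi) * (2 * ?\<Gamma>) = (ennreal (384 * pi) + ennreal (48 * pi)) * ?\<Gamma>"
      by (simp add: distrib_right flip: mult.assoc)
    also have "ennreal (384 * pi) + ennreal (48 * pi) = ennreal (432 * pi)"
      by (subst ennreal_plus[symmetric]) simp_all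
    finally show ?thesis .
  qed
  finally show "(\<integral>\<^sup>+h. (\<integral>\<^sup>+x. ennreal ((top_value v j (x + h) - top_value v j x)\<^sup>2 / norm h ^ 3) \<partial>lborel) \<partial>lborel)
      \<le> ennreal (432 * pi) * ?\<Gamma>"
    by (simp add: add_left_mono mult_left_mono)
qed

end

lemma norm_power2_components:
  fixes a :: "'a::euclidean_space"
  shows "(norm a)\<^sup>2 = (\<Sum>j\<in>Basis. (a \<bullet> j)\<^sup>2)"
  unfolding power2_norm_eq_inner by (subst euclidean_inner) (simp add: power2_eq_square)

lemma integrable_lborel_bounded:
  fixes f :: "'a::euclidean_space \<Rightarrow> real"
  assumes "f \<in> borel_measurable borel" "\<And>x. 0 \<le> f x" "(\<integral>\<^sup>+x. ennreal (f x) \<partial>lborel) \<le> ennreal C" "0 \<le> C"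
  shows "integrable lborel f" "(\<integral>x. f x \<partial>lborel) \<le> C"
proof -
  have "(\<integral>\<^sup>+x. ennreal (norm (f x)) \<partial>lborel) < \<infinity>"
    using assms by (simp add: le_less_trans[OF assms(3)])
  then show "integrable lborel f" using assms(1) by (intro integrableI_bounded) auto
  from nn_integral_eq_integral[OF this] have "ennreal (\<integral>x. f x \<partial>lborel) \<le> ennreal C"
    using assms(2,3) by simp
  then show "(\<integral>x. f x \<partial>lborel) \<le> C" using assms(4) by (simp add: ennreal_le_iff)
qed

context basin begin

text \<open>The factors 2 count the components of the velocity; the two summands belong to the L2
  part and to the seminorm.\<close>

definition trace_const :: real where
  "trace_const = sqrt (2 * (D_max S D + 1) + 2 * (432 * pi))"

text \<open>The estimates for the zero extensions live on the whole plane. Restricting the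
  nonnegative double integral to \<open>S \<times> S\<close> can only decrease it.\<close>

lemma trace_H12:
  assumes v: "v \<in> H1_bl S D" and cont: "continuous_on (closure \<Omega>) v"
  shows "(\<lambda>x. v (x, 0)) \<in> H12 S" and "H12_norm S (\<lambda>x. v (x, 0)) \<le> trace_const * grad_norm \<Omega> v"
proof -
  let ?b = "top_value v" and ?\<gamma> = "(grad_norm \<Omega> v)\<^sup>2"
  have bm [measurable]: "?b j \<in> borel_measurable borel" for j by (rule borel_measurable_top_value[OF cont])
  have Sb: "S \<in> sets borel" using open_S by simp
  have bS: "?b j x = v (x, 0) \<bullet> j" if "x \<in> S" for j x using that by (simp add: top_value_def)
  have b0: "?b j x = 0" if "x \<notin> S" for j x using that by (simp add: top_value_def)
  have K: "0 \<le> (D_max S D + 1) * ?\<gamma>" using D_max_pos by simp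
  have l2: "integrable lborel (\<lambda>x. (?b j x)\<^sup>2)" "(\<integral>x. (?b j x)\<^sup>2 \<partial>lborel) \<le> (D_max S D + 1) * ?\<gamma>" if "j \<in> Basis" for j
  proof -
    have "(\<integral>\<^sup>+x. ennreal ((?b j x)\<^sup>2) \<partial>lborel) \<le> ennreal ((D_max S D + 1) * ?\<gamma>)"
      using trace_component(1)[OF v cont that] D_max_pos by (simp add: ennreal_mult)
    from integrable_lborel_bounded[OF _ _ this K]
    show "integrable lborel (\<lambda>x. (?b j x)\<^sup>2)" "(\<integral>x. (?b j x)\<^sup>2 \<partial>lborel) \<le> (D_max S D + 1) * ?\<gamma>"
      by simp_all
  qed
  have ae1: "AE x in lborel. x \<in> S \<longrightarrow> (norm (v (x, 0)))\<^sup>2 = (\<Sum>j\<in>Basis. (?b j x)\<^sup>2)"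
    by (simp add: norm_power2_components bS)
  have m1: "(\<lambda>x. \<Sum>j\<in>Basis. (?b j x)\<^sup>2) \<in> borel_measurable borel" by measurable
  have z1: "(\<Sum>j\<in>Basis. (?b j x)\<^sup>2) = 0" if "x \<notin> S" for x using b0[OF that] by simp
  note t1 = lebesgue_on_transfer[OF Sb m1 z1 ae1]
  have "continuous_on S (\<lambda>x. v (x, 0))"
    by (intro continuous_intros continuous_on_compose2[OF cont]) (use closure_Omega_top in auto)
  then have "(\<lambda>x. v (x, 0)) \<in> borel_measurable (lebesgue_on S)"
    using Sb by (intro continuous_imp_measurable_on_sets_lebesgue) auto
  moreover have "integrable lborel (\<lambda>x. \<Sum>j\<in>Basis. (?b j x)\<^sup>2)"
    by (intro Bochner_Integration.integrable_sum l2)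
  then have "integrable (lebesgue_on S) (\<lambda>x. (norm (v (x, 0)))\<^sup>2)" using t1(2) by blast
  ultimately have L2: "L2 S (\<lambda>x. v (x, 0))" by (simp add: L2_def)
  have "(LINT x|lebesgue_on S. (norm (v (x, 0)))\<^sup>2) = (\<Sum>j\<in>Basis. \<integral>x. (?b j x)\<^sup>2 \<partial>lborel)"
    using t1(3) by (simp add: Bochner_Integration.integral_sum l2)
  also have "\<dots> \<le> (\<Sum>j\<in>(Basis :: pt2 set). (D_max S D + 1) * ?\<gamma>)" by (intro sum_mono l2)
  finally have n1: "(LINT x|lebesgue_on S. (norm (v (x, 0)))\<^sup>2) \<le> 2 * ((D_max S D + 1) * ?\<gamma>)" by simp
  let ?f = "\<lambda>j q. (?b j (fst q) - ?b j (snd q))\<^sup>2 / norm (fst q - snd q) ^ 3"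
  have fm: "?f j \<in> borel_measurable borel" for j unfolding borel_prod[symmetric] by measurable
  have sn: "integrable lborel (?f j)" "(\<integral>q. ?f j q \<partial>lborel) \<le> 432 * pi * ?\<gamma>" if "j \<in> Basis" for j
  proof -
    have "(\<integral>\<^sup>+q. ennreal (?f j q) \<partial>lborel) = (\<integral>\<^sup>+x. (\<integral>\<^sup>+y. ennreal ((?b j x - ?b j y)\<^sup>2 / norm (x - y) ^ 3) \<partial>lborel) \<partial>lborel)"
      by (subst nn_integral_lborel_prod(1)) (use fm in auto)
    \<comment> \<open>The substitution \<open>y = x + h\<close> brings the seminorm into the form of
      Gagliardo's estimate.\<close>
    also have "\<dots> = (\<integral>\<^sup>+x. (\<integral>\<^sup>+h. ennreal ((?b j (x + h) - ?b j x)\<^sup>2 / norm h ^ 3) \<partial>lborel) \<partial>lborel)"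
    proof (rule nn_integral_cong)
      fix x :: pt2
      show "(\<integral>\<^sup>+y. ennreal ((?b j x - ?b j y)\<^sup>2 / norm (x - y) ^ 3) \<partial>lborel)
         = (\<integral>\<^sup>+h. ennreal ((?b j (x + h) - ?b j x)\<^sup>2 / norm h ^ 3) \<partial>lborel)"
        using nn_integral_translate[of "\<lambda>y. ennreal ((?b j x - ?b j y)\<^sup>2 / norm (x - y) ^ 3)" x]
        by (simp add: power2_commute[of "?b j x"] add.commute)
    qed
    also have "\<dots> = (\<integral>\<^sup>+h. (\<integral>\<^sup>+x. ennreal ((?b j (x + h) - ?b j x)\<^sup>2 / norm h ^ 3) \<partial>lborel) \<partial>lborel)"
      by (rule lborel_pair.Fubini') measurable
    also have "\<dots> \<le> ennreal (432 * pi * ?\<gamma>)"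
      using trace_component(2)[OF v cont that] by (subst ennreal_mult) auto
    finally have *: "(\<integral>\<^sup>+q. ennreal (?f j q) \<partial>lborel) \<le> ennreal (432 * pi * ?\<gamma>)" .
    show "integrable lborel (?f j)" "(\<integral>q. ?f j q \<partial>lborel) \<le> 432 * pi * ?\<gamma>"
      by (rule integrable_lborel_bounded[OF fm _ *]; simp)+
  qed
  let ?F = "\<lambda>(x, y). (norm (v (x, 0) - v (y, 0)))\<^sup>2 / norm (x - y) ^ 3"
  have SS: "S \<times> S \<in> sets borel" using open_S by (intro borel_open open_Times)
  have m2: "(\<lambda>q. indicator (S \<times> S) q * (\<Sum>j\<in>Basis. ?f j q)) \<in> borel_measurable borel"
    using SS fm by (intro borel_measurable_times borel_measurable_indicator borel_measurable_sum) auto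
  have ae2: "AE q in lborel. q \<in> S \<times> S \<longrightarrow> ?F q = indicator (S \<times> S) q * (\<Sum>j\<in>Basis. ?f j q)"
    by (intro AE_I2) (auto simp: norm_power2_components bS inner_diff_left sum_divide_distrib)
  have z2: "indicator (S \<times> S) q * (\<Sum>j\<in>Basis. ?f j q) = 0" if "q \<notin> S \<times> S" for q using that by simp
  note t2 = lebesgue_on_transfer[OF SS m2 z2 ae2]
  have I: "integrable lborel (\<lambda>q. \<Sum>j\<in>Basis. ?f j q)"
    by (intro Bochner_Integration.integrable_sum sn)
  have I': "integrable lborel (\<lambda>q. indicator (S \<times> S) q * (\<Sum>j\<in>Basis. ?f j q))"
    using integrable_mult_indicator[OF _ I, of "S \<times> S"] SS by simp
  then have "integrable (lebesgue_on (S \<times> S)) ?F" using t2(2) by blast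
  with L2 show "(\<lambda>x. v (x, 0)) \<in> H12 S" by (simp add: H12_def)
  have "(LINT q|lebesgue_on (S \<times> S). ?F q) = (\<integral>q. indicator (S \<times> S) q * (\<Sum>j\<in>Basis. ?f j q) \<partial>lborel)"
    by (rule t2(3))
  also have "\<dots> \<le> (\<integral>q. (\<Sum>j\<in>Basis. ?f j q) \<partial>lborel)"
    by (intro integral_mono I I') (auto simp: indicator_def intro!: sum_nonneg)
  also have "\<dots> = (\<Sum>j\<in>Basis. \<integral>q. ?f j q \<partial>lborel)"
    by (intro Bochner_Integration.integral_sum sn)
  also have "\<dots> \<le> (\<Sum>j\<in>(Basis :: pt2 set). 432 * pi * ?\<gamma>)" by (intro sum_mono sn)
  finally have n2: "(LINT q|lebesgue_on (S \<times> S). ?F q) \<le> 2 * (432 * pi * ?\<gamma>)" by simp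
  have "(L2_norm S (\<lambda>x. v (x, 0)))\<^sup>2 = (LINT x|lebesgue_on S. (norm (v (x, 0)))\<^sup>2)"
    unfolding L2_norm_power2 L2_inner_def power2_norm_eq_inner ..
  with n1 n2 have "H12_norm S (\<lambda>x. v (x, 0)) \<le> sqrt ((2 * (D_max S D + 1) + 2 * (432 * pi)) * ?\<gamma>)"
    unfolding H12_norm_def by (intro real_sqrt_le_mono) (simp add: algebra_simps)
  then show "H12_norm S (\<lambda>x. v (x, 0)) \<le> trace_const * grad_norm \<Omega> v"
    by (simp add: trace_const_def real_sqrt_mult)
qed

end

lemma H12_norm_nonneg: "0 \<le> H12_norm S g"
  unfolding H12_norm_def by (intro real_sqrt_ge_zero add_nonneg_nonneg integral_nonneg_AE AE_I2) auto

lemma H12_scale: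
  assumes g: "g \<in> H12 S"
  shows "(\<lambda>x. c *\<^sub>R g x) \<in> H12 S" "H12_norm S (\<lambda>x. c *\<^sub>R g x) = \<bar>c\<bar> * H12_norm S g"
proof -
  have g': "L2 S g" "integrable (lebesgue_on (S \<times> S)) (\<lambda>(x, y). (norm (g x - g y))\<^sup>2 / norm (x - y) ^ 3)"
    using g by (auto simp: H12_def)
  have F: "(\<lambda>(x, y). (norm (c *\<^sub>R g x - c *\<^sub>R g y))\<^sup>2 / norm (x - y) ^ 3)
     = (\<lambda>q. c\<^sup>2 * (case q of (x, y) \<Rightarrow> (norm (g x - g y))\<^sup>2 / norm (x - y) ^ 3))"
    by (auto simp: fun_eq_iff power_mult_distrib simp flip: scaleR_diff_right)
  have L: "L2 S (\<lambda>x. c *\<^sub>R g x)" using L2_lincomb[OF g'(1) g'(1), of c 0] by simp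
  have "integrable (lebesgue_on (S \<times> S)) (\<lambda>(x, y). (norm (c *\<^sub>R g x - c *\<^sub>R g y))\<^sup>2 / norm (x - y) ^ 3)"
    unfolding F using g'(2) by (rule integrable_mult_right)
  with L show "(\<lambda>x. c *\<^sub>R g x) \<in> H12 S" by (simp add: H12_def)
  have n: "(L2_norm S (\<lambda>x. c *\<^sub>R g x))\<^sup>2 = c\<^sup>2 * (L2_norm S g)\<^sup>2"
    using L2_norm_lincomb[OF g'(1) g'(1), of c 0] by simp
  show "H12_norm S (\<lambda>x. c *\<^sub>R g x) = \<bar>c\<bar> * H12_norm S g"
    unfolding H12_norm_def F n integral_mult_right_zero distrib_left[symmetric] by (simp add: real_sqrt_mult)
qed

section \<open>Forces averaged in time\<close>

text \<open>Apply the supremum to \<open>v / nrm v\<close>. Since \<open>nrm\<close> may be a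
  seminorm, \<open>nrm v = 0\<close> is possible; then boundedness of \<open>F\<close> forces
  \<open>F v = 0\<close>. Boundedness is also what makes the real supremum meaningful.\<close>

lemma dual_norm_bound:
  assumes F: "F \<in> dual_space V nrm" and v: "v \<in> V" and nn: "\<And>v. 0 \<le> nrm v"
    and scale: "\<And>c. (\<lambda>x. c *\<^sub>R v x) \<in> V" "\<And>c. nrm (\<lambda>x. c *\<^sub>R v x) = \<bar>c\<bar> * nrm v"
  shows "\<bar>F v\<bar> \<le> dual_norm V nrm F * nrm v"
proof -
  obtain B where B: "\<And>v. v \<in> V \<Longrightarrow> \<bar>F v\<bar> \<le> B * nrm v" using F unfolding dual_space_def by blast
  have lin: "F (\<lambda>x. a *\<^sub>R v x + b *\<^sub>R v x) = a * F v + b * F v" for a b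
    using F v by (auto simp: dual_space_def)
  show ?thesis
  proof (cases "nrm v = 0")
    case True
    then show ?thesis using B[OF v] by simp
  next
    case False
    then have pos: "0 < nrm v" using nn[of v] by linarith
    let ?w = "\<lambda>x. (1 / nrm v) *\<^sub>R v x"
    have "\<bar>F ?w\<bar> \<le> dual_norm V nrm F"
      unfolding dual_norm_def
    proof (rule cSUP_upper)
      show "?w \<in> {v \<in> V. nrm v \<le> 1}" using scale pos by simp
      have "\<bar>F u\<bar> \<le> \<bar>B\<bar>" if "u \<in> V" "nrm u \<le> 1" for u
      proof -
        have "B * nrm u \<le> \<bar>B\<bar> * 1" using that nn[of u] by (intro mult_mono) auto
        then show ?thesis using B[OF that(1)] by simp
      qed
      then show "bdd_above ((\<lambda>v. \<bar>F v\<bar>) ` {v \<in> V. nrm v \<le> 1})" by (intro bdd_aboveI2) auto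
    qed
    moreover have "F ?w = F v / nrm v" using lin[of "1 / nrm v" 0] by simp
    ultimately show ?thesis using pos by (simp add: abs_divide field_simps)
  qed
qed

lemma integrable_lebesgue_on_subset:
  fixes f :: "real \<Rightarrow> real"
  assumes "integrable (lebesgue_on A) f" "B \<subseteq> A" "A \<in> sets lebesgue" "B \<in> sets lebesgue"
  shows "integrable (lebesgue_on B) f"
proof -
  have "integrable lebesgue (\<lambda>x. indicator A x *\<^sub>R f x)" using assms by (simp add: integrable_restrict_space)
  then have "integrable lebesgue (\<lambda>x. indicator B x *\<^sub>R (indicator A x *\<^sub>R f x))"
    using assms(4) by (rule integrable_mult_indicator[rotated])
  moreover have "(\<lambda>x. indicator B x *\<^sub>R (indicator A x *\<^sub>R f x)) = (\<lambda>x. indicator B x *\<^sub>R f x)"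
    using assms(2) by (auto simp: indicator_def fun_eq_iff)
  ultimately show ?thesis using assms by (simp add: integrable_restrict_space)
qed

text \<open>Cauchy-Schwarz in time against the constant 1, whose norm is \<open>sqrt k\<close>,
  improves the factor \<open>1 / k\<close> of the mean to \<open>1 / sqrt k\<close>.\<close>

lemma time_mean_bound:
  assumes f: "f \<in> L2_time_dual T V nrm" and k: "k > 0" and m: "real (Suc m) * k \<le> T"
    and v: "v \<in> V" and nn: "\<And>v. 0 \<le> nrm v"
    and scale: "\<And>c. (\<lambda>x. c *\<^sub>R v x) \<in> V" "\<And>c. nrm (\<lambda>x. c *\<^sub>R v x) = \<bar>c\<bar> * nrm v"
  shows "\<bar>time_mean k f m v\<bar> \<le> sqrt ((LINT t|lebesgue_on {real m * k..real (Suc m) * k}. (dual_norm V nrm (f t))\<^sup>2) / k) * nrm v"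
proof -
  let ?I = "{real m * k..real (Suc m) * k}"
  \<comment> \<open>Square integrability of the dual norm yields measurability of its square, hence
    of the root, which is the absolute value.\<close>
  let ?a = "\<lambda>t. \<bar>dual_norm V nrm (f t)\<bar>"
  have sub: "?I \<subseteq> {0..T}" using m k by (auto intro: order_trans[rotated] mult_nonneg_nonneg)
  have I2: "integrable (lebesgue_on ?I) (\<lambda>t. (dual_norm V nrm (f t))\<^sup>2)"
    by (rule integrable_lebesgue_on_subset[OF _ sub]) (use f in \<open>auto simp: L2_time_dual_def\<close>)
  have am: "?a \<in> borel_measurable (lebesgue_on ?I)"
  proof -
    have "(\<lambda>t. sqrt ((dual_norm V nrm (f t))\<^sup>2)) \<in> borel_measurable (lebesgue_on ?I)"
      using borel_measurable_integrable[OF I2] by measurable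
    then show ?thesis by simp
  qed
  have La: "L2 ?I ?a" using am I2 by (simp add: L2_def)
  have L1: "L2 ?I (\<lambda>_. 1 :: real)"
    by (simp add: L2_def)
  have n1: "L2_norm ?I (\<lambda>_. 1 :: real) = sqrt k"
    using k by (simp add: L2_norm_def measure_restrict_space algebra_simps)
  have "AE t in lebesgue_on {0..T}. f t \<in> dual_space V nrm" using f by (auto simp: L2_time_dual_def)
  then have "AE t in lebesgue_on ?I. f t \<in> dual_space V nrm"
    using sub by (auto simp: AE_restrict_space_iff elim!: eventually_mono)
  then have bnd: "AE t in lebesgue_on ?I. \<bar>f t v\<bar> \<le> ?a t * nrm v"
  proof eventually_elim
    case (elim t)
    have "\<bar>f t v\<bar> \<le> dual_norm V nrm (f t) * nrm v"
      by (rule dual_norm_bound) (fact elim v nn scale)+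
    also have "\<dots> \<le> ?a t * nrm v" by (intro mult_right_mono nn) simp
    finally show ?case .
  qed
  have aI: "integrable (lebesgue_on ?I) ?a"
    using L2_integrable_inner[OF La L1] by simp
  have "\<bar>LINT t|lebesgue_on ?I. f t v\<bar> \<le> (LINT t|lebesgue_on ?I. ?a t * nrm v)"
  proof (cases "integrable (lebesgue_on ?I) (\<lambda>t. f t v)")
    case True
    have "\<bar>LINT t|lebesgue_on ?I. f t v\<bar> \<le> (LINT t|lebesgue_on ?I. \<bar>f t v\<bar>)"
      using integral_norm_bound[of "lebesgue_on ?I" "\<lambda>t. f t v"] by simp
    also have "\<dots> \<le> (LINT t|lebesgue_on ?I. ?a t * nrm v)"
      using True aI bnd by (intro integral_mono_AE) auto
    finally show ?thesis .
  next
    \<comment> \<open>The integral is 0 by convention.\<close>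
    case False
    then show ?thesis using nn by (simp add: not_integrable_integral_eq)
  qed
  also have "\<dots> = L2_inner ?I ?a (\<lambda>_. 1) * nrm v" by (simp add: L2_inner_def)
  also have "\<dots> \<le> (L2_norm ?I ?a * sqrt k) * nrm v"
    using L2_Cauchy_Schwarz[OF La L1] n1 by (intro mult_right_mono nn) simp
  finally have "\<bar>time_mean k f m v\<bar> \<le> (1 / k) * ((L2_norm ?I ?a * sqrt k) * nrm v)"
    using k by (simp add: time_mean_def abs_mult divide_right_mono)
  also have "\<dots> = L2_norm ?I ?a / sqrt k * nrm v"
    using k by (simp add: field_simps)
  also have "L2_norm ?I ?a = sqrt (LINT t|lebesgue_on ?I. (dual_norm V nrm (f t))\<^sup>2)"
    by (simp add: L2_norm_def)
  finally show ?thesis by (simp add: real_sqrt_divide)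
qed

text \<open>Turns the data terms summed over the steps into one integral over the time interval,
  which makes the bound uniform in \<open>k\<close>.\<close>

lemma sum_time_intervals:
  fixes a :: "real \<Rightarrow> real"
  assumes I: "integrable (lebesgue_on {0..T}) a" and k: "k > 0" and M: "real M * k \<le> T"
  shows "(\<Sum>m<M. LINT t|lebesgue_on {real m * k..real (Suc m) * k}. a t) = (LINT t|lebesgue_on {0..real M * k}. a t)"
  using M
proof (induction M)
  case 0
  have "(LINT t|lebesgue_on {0::real}. a t) = 0"
    by (subst integral_restrict_space) (auto intro!: integral_eq_zero_AE AE_completion eventually_mono[OF AE_lborel_singleton[of 0]])
  then show ?case by simp
next
  case (Suc M)
  have le: "real M * k \<le> real (Suc M) * k" using k by simp
  have i: "integrable (lebesgue_on {x..y}) a" if "0 \<le> x" "y \<le> T" for x y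
    by (rule integrable_lebesgue_on_subset[OF I]) (use that in auto)
  have eq: "(LINT t|lebesgue_on {x..y}. a t) = integral {x..y} a" if "0 \<le> x" "y \<le> T" for x y
    by (rule lebesgue_integral_eq_integral[OF i[OF that]]) simp
  have 0: "0 \<le> real M * k" using k by simp
  have "integral {0..real M * k} a + integral {real M * k..real (Suc M) * k} a = integral {0..real (Suc M) * k} a"
    by (rule Henstock_Kurzweil_Integration.integral_combine[OF 0 le])
       (rule integrable_on_lebesgue_on[OF i], use Suc.prems in auto)
  then show ?case using Suc le 0 by (simp add: eq del: of_nat_Suc)
qed

section \<open>The energy estimate\<close>

lemma finite_dim_space_lincomb:
  assumes X: "finite_dim_space X" and v: "v \<in> X" "w \<in> X"
  shows "(\<lambda>x. a *\<^sub>R v x + b *\<^sub>R w x) \<in> X"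
proof -
  obtain n and B :: "nat \<Rightarrow> 'a \<Rightarrow> 'b" where X: "X = {(\<lambda>x. \<Sum>i<n. c i *\<^sub>R B i x) |c. True}"
    using X by (auto simp: finite_dim_space_def)
  obtain c d where v: "v = (\<lambda>x. \<Sum>i<n. c i *\<^sub>R B i x)" and w: "w = (\<lambda>x. \<Sum>i<n. d i *\<^sub>R B i x)"
  proof -
    from v obtain c d where "v = (\<lambda>x. \<Sum>i<n. c i *\<^sub>R B i x)" "w = (\<lambda>x. \<Sum>i<n. d i *\<^sub>R B i x)"
      unfolding X mem_Collect_eq by (elim exE conjE)
    then show thesis by (rule that)
  qed
  have "(\<lambda>x. a *\<^sub>R v x + b *\<^sub>R w x) = (\<lambda>x. \<Sum>i<n. (a * c i + b * d i) *\<^sub>R B i x)"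
    unfolding v w by (rule ext) (simp add: scaleR_sum_right sum.distrib scaleR_add_left)
  then show ?thesis unfolding X mem_Collect_eq
    by (intro exI[of _ "\<lambda>i. a * c i + b * d i"] conjI TrueI)
qed

lemma L2_norm_cong_AE:
  assumes "L2 G v" "L2 G w" "AE x in lebesgue_on G. v x = w x"
  shows "L2_norm G v = L2_norm G w"
proof -
  have "(LINT x|lebesgue_on G. (norm (v x))\<^sup>2) = (LINT x|lebesgue_on G. (norm (w x))\<^sup>2)"
  proof (rule integral_cong_AE)
    show "(\<lambda>x. (norm (v x))\<^sup>2) \<in> borel_measurable (lebesgue_on G)" "(\<lambda>x. (norm (w x))\<^sup>2) \<in> borel_measurable (lebesgue_on G)"
      using assms(1,2) unfolding L2_def by (blast intro: borel_measurable_integrable)+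
    show "AE x in lebesgue_on G. (norm (v x))\<^sup>2 = (norm (w x))\<^sup>2"
      using assms(3) by eventually_elim simp
  qed
  then show ?thesis by (simp add: L2_norm_def)
qed

text \<open>The polarisation identity that makes implicit steps telescope. The difference is
  required only almost everywhere because the lemma is also applied to weak derivatives, which are
  chosen independently of each other.\<close>

lemma L2_inner_diff_self:
  assumes v: "L2 G v" and w: "L2 G w" and d: "L2 G d" and ae: "AE x in lebesgue_on G. d x = v x - w x"
  shows "2 * L2_inner G d v = (L2_norm G v)\<^sup>2 - (L2_norm G w)\<^sup>2 + (L2_norm G d)\<^sup>2"
proof -
  have "(L2_norm G w)\<^sup>2 = (L2_norm G (\<lambda>x. 1 *\<^sub>R v x + (-1) *\<^sub>R d x))\<^sup>2"
  proof (rule arg_cong[where f="\<lambda>x. x\<^sup>2"], rule L2_norm_cong_AE[OF w L2_lincomb[OF v d]])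
    show "AE x in lebesgue_on G. w x = 1 *\<^sub>R v x + (-1) *\<^sub>R d x"
      using ae by eventually_elim simp
  qed
  also have "\<dots> = (L2_norm G v)\<^sup>2 - 2 * L2_inner G v d + (L2_norm G d)\<^sup>2"
    by (subst L2_norm_lincomb[OF v d]) simp
  finally show ?thesis by (simp add: L2_inner_commute)
qed

lemma energy_sum:
  fixes a c e :: "nat \<Rightarrow> real"
  assumes "\<And>m. m < M \<Longrightarrow> a (Suc m) + e m \<le> a m + c m" "n \<le> M"
  shows "a n + (\<Sum>m<n. e m) \<le> a 0 + (\<Sum>m<n. c m)"
  using assms(2)
proof (induction n)
  case (Suc n)
  then show ?case using assms(1)[of n] by simp
qed simp

section \<open>The energy inequality of one time step\<close>

context basin begin

lemma H1_blD:
  assumes "v \<in> H1_bl S D"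
  shows "L2 \<Omega> v" "e \<in> Basis \<Longrightarrow> has_L2_deriv \<Omega> e v"
  using assms by (auto simp: H1_bl_def H1_def)

lemma H1_bl_dL2: "v \<in> H1_bl S D \<Longrightarrow> e \<in> Basis \<Longrightarrow> L2 \<Omega> (wderiv \<Omega> e v)"
  by (rule wderiv_L2[OF H1_blD(2) open_Omega])

lemma grad_inner_self: "grad_inner \<Omega> v v = (grad_norm \<Omega> v)\<^sup>2"
  by (simp add: grad_inner_def grad_norm_def L2_norm_power2[symmetric] sum_nonneg)

lemma grad_norm_power2: "(grad_norm \<Omega> v)\<^sup>2 = (\<Sum>e\<in>Basis. (L2_norm \<Omega> (wderiv \<Omega> e v))\<^sup>2)"
  by (simp add: grad_norm_def sum_nonneg)

lemma grad_inner_diff_self: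
  assumes v: "v \<in> H1_bl S D" and w: "w \<in> H1_bl S D" and d: "(\<lambda>p. v p - w p) \<in> H1_bl S D"
  shows "2 * grad_inner \<Omega> (\<lambda>p. v p - w p) v
     = (grad_norm \<Omega> v)\<^sup>2 - (grad_norm \<Omega> w)\<^sup>2 + (grad_norm \<Omega> (\<lambda>p. v p - w p))\<^sup>2"
proof -
  have "2 * L2_inner \<Omega> (wderiv \<Omega> e (\<lambda>p. v p - w p)) (wderiv \<Omega> e v)
     = (L2_norm \<Omega> (wderiv \<Omega> e v))\<^sup>2 - (L2_norm \<Omega> (wderiv \<Omega> e w))\<^sup>2 + (L2_norm \<Omega> (wderiv \<Omega> e (\<lambda>p. v p - w p)))\<^sup>2"
    if e: "e \<in> Basis" for e
  proof (rule L2_inner_diff_self[OF H1_bl_dL2[OF v e] H1_bl_dL2[OF w e] H1_bl_dL2[OF d e]])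
    show "AE x in lebesgue_on \<Omega>. wderiv \<Omega> e (\<lambda>p. v p - w p) x = wderiv \<Omega> e v x - wderiv \<Omega> e w x"
      using wderiv_lincomb[OF H1_blD(2)[OF v e] H1_blD(2)[OF w e] open_Omega e, of 1 "-1"] by simp
  qed
  then show ?thesis
    unfolding grad_inner_def grad_norm_power2 sum_distrib_left
    by (simp add: sum.distrib sum_subtractf)
qed

lemma grad_norm_scale:
  assumes v: "v \<in> H1_bl S D"
  shows "grad_norm \<Omega> (\<lambda>p. c *\<^sub>R v p) = \<bar>c\<bar> * grad_norm \<Omega> v"
proof -
  have "(L2_norm \<Omega> (wderiv \<Omega> e (\<lambda>p. c *\<^sub>R v p)))\<^sup>2 = c\<^sup>2 * (L2_norm \<Omega> (wderiv \<Omega> e v))\<^sup>2" if e: "e \<in> Basis" for e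
  proof -
    note d = H1_bl_dL2[OF v e]
    have ae: "AE x in lebesgue_on \<Omega>. wderiv \<Omega> e (\<lambda>p. c *\<^sub>R v p) x = c *\<^sub>R wderiv \<Omega> e v x + 0 *\<^sub>R wderiv \<Omega> e v x"
      using wderiv_lincomb[OF H1_blD(2)[OF v e] H1_blD(2)[OF v e] open_Omega e, of c 0] by simp
    have l: "L2 \<Omega> (\<lambda>x. c *\<^sub>R wderiv \<Omega> e v x + 0 *\<^sub>R wderiv \<Omega> e v x)" by (rule L2_lincomb[OF d d])
    then have l': "L2 \<Omega> (wderiv \<Omega> e (\<lambda>p. c *\<^sub>R v p))"
      using L2_cong_AE[OF ae] open_Omega by simp
    have "(L2_norm \<Omega> (wderiv \<Omega> e (\<lambda>p. c *\<^sub>R v p)))\<^sup>2 = (L2_norm \<Omega> (\<lambda>x. c *\<^sub>R wderiv \<Omega> e v x + 0 *\<^sub>R wderiv \<Omega> e v x))\<^sup>2"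
      by (rule arg_cong[where f="\<lambda>x. x\<^sup>2"], rule L2_norm_cong_AE[OF l' l ae])
    also have "\<dots> = c\<^sup>2 * (L2_norm \<Omega> (wderiv \<Omega> e v))\<^sup>2"
      by (subst L2_norm_lincomb[OF d d]) simp
    finally show ?thesis .
  qed
  then have "(grad_norm \<Omega> (\<lambda>p. c *\<^sub>R v p))\<^sup>2 = (\<bar>c\<bar> * grad_norm \<Omega> v)\<^sup>2"
    unfolding grad_norm_power2 power_mult_distrib by (simp add: sum_distrib_left)
  then show ?thesis by (rule power2_eq_imp_eq) simp_all
qed

text \<open>The integrals \<open>\<alpha>\<close> and \<open>\<beta>\<close> over one step enter
  divided by \<open>k\<close> after squaring, and the prefactor restores \<open>k\<close>; what
  remains adds up over the steps without any power of \<open>k\<close>.\<close>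

lemma force_bound:
  assumes f: "f \<in> L2_time_dual T (H1_bl S D) (grad_norm \<Omega>)" and gs: "gs \<in> L2_time_dual T (H12 S) (H12_norm S)"
    and k: "k > 0" and m: "real (Suc m) * k \<le> T"
    and X: "finite_dim_space X" "X \<subseteq> H1_bl S D" and v: "v \<in> X" and cont: "continuous_on (closure \<Omega>) v"
  defines "\<alpha> \<equiv> LINT t|lebesgue_on {real m * k..real (Suc m) * k}. (dual_norm (H1_bl S D) (grad_norm \<Omega>) (f t))\<^sup>2"
    and "\<beta> \<equiv> LINT t|lebesgue_on {real m * k..real (Suc m) * k}. (dual_norm (H12 S) (H12_norm S) (gs t))\<^sup>2"
  shows "2 * k * (time_mean k f m v + time_mean k gs m (\<lambda>x. v (x, 0)))
    \<le> 4 * (\<alpha> + trace_const\<^sup>2 * \<beta>) + k / 2 * (grad_norm \<Omega> v)\<^sup>2"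
proof -
  let ?n = "grad_norm \<Omega> v"
  have vH: "v \<in> H1_bl S D" using v X by blast
  have \<alpha>: "0 \<le> \<alpha>" and \<beta>: "0 \<le> \<beta>" by (simp_all add: \<alpha>_def \<beta>_def)
  have sc: "(\<lambda>x. c *\<^sub>R v x) \<in> H1_bl S D" for c
    using finite_dim_space_lincomb[OF X(1) v v, of c 0] X(2) by auto
  have 1: "\<bar>time_mean k f m v\<bar> \<le> sqrt (\<alpha> / k) * ?n"
    unfolding \<alpha>_def
    by (rule time_mean_bound[OF f k m vH grad_norm_nonneg sc grad_norm_scale[OF vH]])
  note tr = trace_H12[OF vH cont]
  have "\<bar>time_mean k gs m (\<lambda>x. v (x, 0))\<bar> \<le> sqrt (\<beta> / k) * H12_norm S (\<lambda>x. v (x, 0))"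
    unfolding \<beta>_def
    by (rule time_mean_bound[OF gs k m tr(1) H12_norm_nonneg H12_scale[OF tr(1)]])
  also have "\<dots> \<le> sqrt (\<beta> / k) * (trace_const * ?n)"
    by (rule mult_left_mono[OF tr(2)]) (use \<beta> k in simp)
  finally have 2: "\<bar>time_mean k gs m (\<lambda>x. v (x, 0))\<bar> \<le> (trace_const * sqrt (\<beta> / k)) * ?n" by (simp add: ac_simps)
  let ?c = "sqrt (\<alpha> / k) + trace_const * sqrt (\<beta> / k)"
  have "time_mean k f m v + time_mean k gs m (\<lambda>x. v (x, 0)) \<le> ?c * ?n"
    using 1 2 by (simp add: distrib_right)
  then have "2 * k * (time_mean k f m v + time_mean k gs m (\<lambda>x. v (x, 0))) \<le> 2 * k * (?c * ?n)"
    using k by (intro mult_left_mono) auto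
  also have "\<dots> = k * (2 * (?c * ?n))" by simp
  \<comment> \<open>Young's inequality, weighted so that only \<open>k / 2\<close> of the
    dissipation is spent on the data. With \<open>(a + b)^2 <= 2 (a^2 + b^2)\<close> in the next
    step, the constant becomes 4.\<close>
  also have "\<dots> \<le> k * (2 * ?c\<^sup>2 + ?n\<^sup>2 / 2)"
  proof (rule mult_left_mono)
    have "2 * (x * y) \<le> 2 * x\<^sup>2 + y\<^sup>2 / 2" for x y :: real
      using zero_le_power2[of "2 * x - y"] by (simp add: power2_diff power_mult_distrib)
    then show "2 * (?c * ?n) \<le> 2 * ?c\<^sup>2 + ?n\<^sup>2 / 2" .
  qed (use k in simp)
  also have "k * (2 * ?c\<^sup>2 + ?n\<^sup>2 / 2) \<le> k * (2 * (2 * (\<alpha> / k + trace_const\<^sup>2 * (\<beta> / k))) + ?n\<^sup>2 / 2)"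
  proof -
    have "?c\<^sup>2 \<le> 2 * ((sqrt (\<alpha> / k))\<^sup>2 + (trace_const * sqrt (\<beta> / k))\<^sup>2)"
      using sum_squares_bound[of "sqrt (\<alpha> / k)" "trace_const * sqrt (\<beta> / k)"] by (simp add: power2_sum)
    also have "\<dots> = 2 * (\<alpha> / k + trace_const\<^sup>2 * (\<beta> / k))"
      using \<alpha> \<beta> k by (simp add: power_mult_distrib)
    finally show ?thesis using k by (intro mult_left_mono add_right_mono) auto
  qed
  also have "\<dots> = 4 * (\<alpha> + trace_const\<^sup>2 * \<beta>) + k / 2 * ?n\<^sup>2"
    using k by (simp add: field_simps)
  finally show ?thesis .
qed

text \<open>Sub-step 1, multiplied by \<open>2 k\<close>, supplies dissipation \<open>2 k\<close>
  times the squared gradient norm of \<open>uh\<close>. Sub-step 2 takes back one \<open>k\<close>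
  of it, because polarising its viscous increment leaves the old gradient with a negative sign, and
  the data take \<open>k / 2\<close>; the last \<open>k / 2\<close> is kept. The first claim uses
  sub-step 1 alone, since the intermediate velocity is not an end value of the telescoping
  sum.\<close>

lemma energy_step:
  assumes X: "finite_dim_space X" "X \<subseteq> H1_bl S D" "\<And>v. v \<in> X \<Longrightarrow> continuous_on (closure \<Omega>) v"
    and Y: "Y \<subseteq> H0_dz S D" and k: "k > 0" and u: "u \<in> X"
    and s0: "substep0 S D Y u u3" and s1: "substep1 S D F G k X u u3 uh" and s2: "substep2 S D k X Q uh u' p'"
    and c: "2 * k * (F uh + G (\<lambda>x. uh (x, 0))) \<le> c + k / 2 * (grad_norm \<Omega> uh)\<^sup>2"
  shows "(L2_norm \<Omega> uh)\<^sup>2 + (L2_norm \<Omega> (\<lambda>p. uh p - u p))\<^sup>2 \<le> (L2_norm \<Omega> u)\<^sup>2 + c"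
    and "(L2_norm \<Omega> u')\<^sup>2 + ((L2_norm \<Omega> (\<lambda>p. u' p - uh p))\<^sup>2 + (L2_norm \<Omega> (\<lambda>p. uh p - u p))\<^sup>2
       + k * (grad_norm \<Omega> u')\<^sup>2 + k / 2 * (grad_norm \<Omega> uh)\<^sup>2) \<le> (L2_norm \<Omega> u)\<^sup>2 + c"
proof -
  have uhX: "uh \<in> X" using s1 by (simp add: substep1_def)
  have u'X: "u' \<in> X" and p'Q: "p' \<in> Q" using s2 by (auto simp: substep2_def)
  have dX: "(\<lambda>p. v p - w p) \<in> X" if "v \<in> X" "w \<in> X" for v w
    using finite_dim_space_lincomb[OF X(1) that, of 1 "-1"] by simp
  have XH: "v \<in> H1_bl S D" if "v \<in> X" for v using that X(2) by blast
  have L: "L2 \<Omega> v" if "v \<in> X" for v using H1_blD(1)[OF XH[OF that]] .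
  have u3: "u3 \<in> H0_dz S D" using s0 Y by (auto simp: substep0_def)
  have polar: "2 * L2_inner \<Omega> (\<lambda>p. v p - w p) v = (L2_norm \<Omega> v)\<^sup>2 - (L2_norm \<Omega> w)\<^sup>2 + (L2_norm \<Omega> (\<lambda>p. v p - w p))\<^sup>2"
    if "v \<in> X" "w \<in> X" for v w
    using L2_inner_diff_self[OF L[OF that(1)] L[OF that(2)] L[OF dX[OF that]]] by simp
  have "(1 / k) * L2_inner \<Omega> (\<lambda>p. uh p - u p) uh + tri_form S D (\<lambda>p. (u p, u3 p)) uh uh + grad_inner \<Omega> uh uh
     = F uh + G (\<lambda>x. uh (x, 0))"
    using s1 uhX by (auto simp: substep1_def)
  then have e1: "(1 / k) * L2_inner \<Omega> (\<lambda>p. uh p - u p) uh + (grad_norm \<Omega> uh)\<^sup>2 = F uh + G (\<lambda>x. uh (x, 0))"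
    unfolding tri_form_self[OF XH[OF u] u3 XH[OF uhX] X(3)[OF uhX]] grad_inner_self by simp
  have "2 * k * ((1 / k) * L2_inner \<Omega> (\<lambda>p. uh p - u p) uh + (grad_norm \<Omega> uh)\<^sup>2)
     = 2 * L2_inner \<Omega> (\<lambda>p. uh p - u p) uh + 2 * k * (grad_norm \<Omega> uh)\<^sup>2"
    using k by (simp add: field_simps)
  then have E1: "(L2_norm \<Omega> uh)\<^sup>2 - (L2_norm \<Omega> u)\<^sup>2 + (L2_norm \<Omega> (\<lambda>p. uh p - u p))\<^sup>2 + 2 * k * (grad_norm \<Omega> uh)\<^sup>2
     \<le> c + k / 2 * (grad_norm \<Omega> uh)\<^sup>2"
    using c unfolding e1 polar[OF uhX u] by simp
  have nn: "0 \<le> k * (grad_norm \<Omega> uh)\<^sup>2" using k by simp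
  show "(L2_norm \<Omega> uh)\<^sup>2 + (L2_norm \<Omega> (\<lambda>p. uh p - u p))\<^sup>2 \<le> (L2_norm \<Omega> u)\<^sup>2 + c"
    using E1 nn by simp
  \<comment> \<open>The discrete constraint is tested with the new pressure itself, which cancels
    the pressure term.\<close>
  have "(1 / k) * L2_inner \<Omega> (\<lambda>p. u' p - uh p) u' + grad_inner \<Omega> (\<lambda>p. u' p - uh p) u' - L2_inner S p' (wdiv S (vint D u')) = 0"
    and "L2_inner S (wdiv S (vint D u')) p' = 0"
    using s2 u'X p'Q by (auto simp: substep2_def)
  then have "(1 / k) * L2_inner \<Omega> (\<lambda>p. u' p - uh p) u' + grad_inner \<Omega> (\<lambda>p. u' p - uh p) u' = 0"
    using L2_inner_commute[of S p'] by simp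
  then have "2 * k * ((1 / k) * L2_inner \<Omega> (\<lambda>p. u' p - uh p) u' + grad_inner \<Omega> (\<lambda>p. u' p - uh p) u') = 0" by simp
  moreover have "2 * k * ((1 / k) * x + y) = 2 * x + k * (2 * y)" for x y :: real using k by (simp add: field_simps)
  ultimately have "2 * L2_inner \<Omega> (\<lambda>p. u' p - uh p) u' + k * (2 * grad_inner \<Omega> (\<lambda>p. u' p - uh p) u') = 0"
    by (rule trans[OF sym, rotated])
  then have E2: "(L2_norm \<Omega> u')\<^sup>2 - (L2_norm \<Omega> uh)\<^sup>2 + (L2_norm \<Omega> (\<lambda>p. u' p - uh p))\<^sup>2
     + k * ((grad_norm \<Omega> u')\<^sup>2 - (grad_norm \<Omega> uh)\<^sup>2 + (grad_norm \<Omega> (\<lambda>p. u' p - uh p))\<^sup>2) = 0"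
    unfolding polar[OF u'X uhX] grad_inner_diff_self[OF XH[OF u'X] XH[OF uhX] XH[OF dX[OF u'X uhX]]] .
  have "0 \<le> k * (grad_norm \<Omega> (\<lambda>p. u' p - uh p))\<^sup>2" using k by simp
  then show "(L2_norm \<Omega> u')\<^sup>2 + ((L2_norm \<Omega> (\<lambda>p. u' p - uh p))\<^sup>2 + (L2_norm \<Omega> (\<lambda>p. uh p - u p))\<^sup>2
       + k * (grad_norm \<Omega> u')\<^sup>2 + k / 2 * (grad_norm \<Omega> uh)\<^sup>2) \<le> (L2_norm \<Omega> u)\<^sup>2 + c"
    using E1 E2 by (simp add: algebra_simps)
qed

text \<open>In units of the norm of the vertical derivative: \<open>width\<close> from Poincare's
  inequality, 1 for the derivative itself, \<open>sqrt width\<close> from the slices. The factor 2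
  is that of \<open>substep0_bound\<close>.\<close>

lemma vertical_velocity_bound:
  assumes u: "u \<in> H1_bl S D" and Y: "Y \<subseteq> H0_dz S D" and s: "substep0 S D Y u u3"
  shows "u3 \<in> LinfL2 S D" "0 \<le> H_dz_norm S D u3 + LinfL2_norm S D u3"
    "H_dz_norm S D u3 + LinfL2_norm S D u3 \<le> 2 * (width + 1 + sqrt width) * grad_norm \<Omega> u"
proof -
  have u3: "u3 \<in> H0_dz S D" using s Y by (auto simp: substep0_def)
  let ?d = "L2_norm \<Omega> (dz S D u3)"
  note d = substep0_bound[OF u Y s]
  show "u3 \<in> LinfL2 S D" by (rule H0_dz_LinfL2(1)[OF u3])
  have "0 \<le> H_dz_norm S D u3" by (simp add: H_dz_norm_def)
  then show "0 \<le> H_dz_norm S D u3 + LinfL2_norm S D u3" using H0_dz_LinfL2(2)[OF u3] by simp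
  have "H_dz_norm S D u3 \<le> L2_norm \<Omega> u3 + ?d"
    unfolding H_dz_norm_def by (rule sqrt_sum_squares_le_sum) simp_all
  also have "\<dots> \<le> (width + 1) * ?d" using H0_dz_poincare[OF u3] by (simp add: distrib_right)
  finally have "H_dz_norm S D u3 + LinfL2_norm S D u3 \<le> (width + 1 + sqrt width) * ?d"
    using H0_dz_LinfL2(3)[OF u3] by (simp add: distrib_right)
  also have "\<dots> \<le> (width + 1 + sqrt width) * (2 * grad_norm \<Omega> u)"
    using width_pos d by (intro mult_left_mono) auto
  finally show "H_dz_norm S D u3 + LinfL2_norm S D u3 \<le> 2 * (width + 1 + sqrt width) * grad_norm \<Omega> u"
    by (simp add: algebra_simps)
qed

end

lemma l2_norm_le:
  assumes "k \<ge> 0" "k * (\<Sum>m<M. (nrm (w m))\<^sup>2) \<le> R\<^sup>2" "0 \<le> R"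
  shows "l2_norm k M nrm w \<le> R"
  unfolding l2_norm_def using assms by (intro real_le_lsqrt mult_nonneg_nonneg sum_nonneg) auto

lemma linf_norm_le:
  assumes "M \<ge> 1" "\<And>m. m < M \<Longrightarrow> nrm (w m) \<le> R"
  shows "linf_norm M nrm w \<le> R"
  unfolding linf_norm_def using assms by (subst Max_le_iff) (auto simp: lessThan_empty_iff)

theorem lemma2:
  fixes S :: "pt2 set" and D :: "pt2 \<Rightarrow> real" and T \<beta> :: real
    and f :: "real \<Rightarrow> (pt3 \<Rightarrow> pt2) \<Rightarrow> real" and gs :: "real \<Rightarrow> (pt2 \<Rightarrow> pt2) \<Rightarrow> real"
    and u0 :: "pt3 \<Rightarrow> pt2"
    and \<H> :: "real set" and \<T> :: "real \<Rightarrow> pt3 set set"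
    and X :: "real \<Rightarrow> (pt3 \<Rightarrow> pt2) set" and Y :: "real \<Rightarrow> (pt3 \<Rightarrow> real) set"
    and Q :: "real \<Rightarrow> (pt2 \<Rightarrow> real) set"
    and u0h :: "real \<Rightarrow> pt3 \<Rightarrow> pt2"
  assumes "polygonal_domain S" and "depth_function S D" and "T > 0"
    and "mesh_family S D \<H> \<T>"
    and "\<forall>h\<in>\<H>. fe_velocity_space S D (\<T> h) (X h)
              \<and> fe_vertical_space S D (\<T> h) (Y h)
              \<and> fe_pressure_space S (\<T> h) (Q h)"
    and "f \<in> L2_time_dual T (H1_bl S D) (grad_norm (Omega S D))"
    and "gs \<in> L2_time_dual T (H12 S) (H12_norm S)"
    and "u0 \<in> H_space S D"
    and "\<beta> > 0" and "\<forall>h\<in>\<H>. hydrostatic_inf_sup S D \<beta> (X h) (Q h)"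
    and "\<forall>h\<in>\<H>. u0h h \<in> X h"
    and "\<exists>B. \<forall>h\<in>\<H>. L2_norm (Omega S D) (u0h h) \<le> B"
  shows "\<exists>C>0. \<forall>h\<in>\<H>. \<forall>M\<ge>1. \<forall>k u uh u3 p.
      k = T / real M \<longrightarrow>
      scheme_solution S D f gs k M (X h) (Y h) (Q h) (u0h h) u uh u3 p \<longrightarrow>
      (linf_norm M (L2_norm (Omega S D)) (\<lambda>m. u (Suc m))
        + l2_norm k M (grad_norm (Omega S D)) (\<lambda>m. u (Suc m)))
      + (linf_norm M (L2_norm (Omega S D)) uh
        + l2_norm k M (grad_norm (Omega S D)) uh) \<le> C
      \<and> l2_norm k M (L2_norm (Omega S D)) (\<lambda>m q. u (Suc m) q - uh m q)
        + l2_norm k M (L2_norm (Omega S D)) (\<lambda>m q. uh m q - u m q) \<le> C * sqrt k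
      \<and> (\<forall>m<M. u3 (Suc m) \<in> LinfL2 S D)
      \<and> l2_norm k M (\<lambda>v. H_dz_norm S D v + LinfL2_norm S D v) (\<lambda>m. u3 (Suc m)) \<le> C"
proof -
  interpret basin S D by unfold_locales fact+
  obtain B where B: "\<And>h. h \<in> \<H> \<Longrightarrow> L2_norm \<Omega> (u0h h) \<le> B" using assms(12) by blast
  let ?a = "\<lambda>t. (dual_norm (H1_bl S D) (grad_norm \<Omega>) (f t))\<^sup>2"
    and ?b = "\<lambda>t. (dual_norm (H12 S) (H12_norm S) (gs t))\<^sup>2"
  \<comment> \<open>\<open>r^2\<close> collects all that can enter the summed energy inequality: the
    initial energy and the data over the whole time interval. Neither \<open>k\<close> nor
    \<open>h\<close> occurs.\<close>
  define r where "r = sqrt (B\<^sup>2 + 4 * ((LINT t|lebesgue_on {0..T}. ?a t) + trace_const\<^sup>2 * (LINT t|lebesgue_on {0..T}. ?b t)))"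
  have r2: "r\<^sup>2 = B\<^sup>2 + 4 * ((LINT t|lebesgue_on {0..T}. ?a t) + trace_const\<^sup>2 * (LINT t|lebesgue_on {0..T}. ?b t))"
    unfolding r_def by simp
  have r0: "0 \<le> r" by (simp add: r_def)
  define E where "E = 2 * (width + 1 + sqrt width)"
  have E0: "0 \<le> E" using width_pos by (simp add: E_def)
  \<comment> \<open>In the first estimate the four norms contribute \<open>r + r + r + 2 r\<close>;
    the vertical velocity contributes \<open>E r\<close>; the summand 1 guarantees
    positivity.\<close>
  let ?C = "(5 + E) * r + 1"
  have "?C > 0" using r0 E0 by (simp add: add_nonneg_pos)
  moreover have "(linf_norm M (L2_norm \<Omega>) (\<lambda>m. u (Suc m)) + l2_norm k M (grad_norm \<Omega>) (\<lambda>m. u (Suc m)))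
      + (linf_norm M (L2_norm \<Omega>) uh + l2_norm k M (grad_norm \<Omega>) uh) \<le> ?C
      \<and> l2_norm k M (L2_norm \<Omega>) (\<lambda>m q. u (Suc m) q - uh m q)
        + l2_norm k M (L2_norm \<Omega>) (\<lambda>m q. uh m q - u m q) \<le> ?C * sqrt k
      \<and> (\<forall>m<M. u3 (Suc m) \<in> LinfL2 S D)
      \<and> l2_norm k M (\<lambda>v. H_dz_norm S D v + LinfL2_norm S D v) (\<lambda>m. u3 (Suc m)) \<le> ?C"
    if h: "h \<in> \<H>" and M: "M \<ge> 1" and k_def: "k = T / real M"
      and sol: "scheme_solution S D f gs k M (X h) (Y h) (Q h) (u0h h) u uh u3 p"
    for h and M :: nat and k u uh u3 p
  proof -
    have k: "k > 0" and Mk: "real M * k = T" using M assms(3) by (simp_all add: k_def)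
    have Xh: "finite_dim_space (X h)" "X h \<subseteq> H1_bl S D" "\<And>v. v \<in> X h \<Longrightarrow> continuous_on (closure \<Omega>) v"
      using assms(5) h by (auto simp: fe_velocity_space_def)
    have Yh: "Y h \<subseteq> H0_dz S D" using assms(5) h by (auto simp: fe_vertical_space_def)
    have u0X: "u 0 \<in> X h" and u00: "u 0 = u0h h" using sol assms(11) h by (auto simp: scheme_solution_def)
    \<comment> \<open>The last index is included: \<open>u3 (Suc m)\<close> is needed up to
      \<open>Suc m = M\<close>.\<close>
    have s0: "substep0 S D (Y h) (u m) (u3 m)" if "m \<le> M" for m using sol that by (auto simp: scheme_solution_def)
    have s1: "substep1 S D (time_mean k f m) (time_mean k gs m) k (X h) (u m) (u3 m) (uh m)"
      and s2: "substep2 S D k (X h) (Q h) (uh m) (u (Suc m)) (p (Suc m))" if "m < M" for m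
      using sol that by (auto simp: scheme_solution_def)
    have uX: "u m \<in> X h" if "m \<le> M" for m
    proof (cases m)
      case (Suc i)
      then show ?thesis using s2[of i] that by (auto simp: substep2_def)
    qed (simp add: u0X)
    have uhX: "uh m \<in> X h" if "m < M" for m using s1[OF that] by (simp add: substep1_def)
    let ?I = "\<lambda>m. {real m * k..real (Suc m) * k}"
    define c where "c m = 4 * ((LINT t|lebesgue_on (?I m). ?a t) + trace_const\<^sup>2 * (LINT t|lebesgue_on (?I m). ?b t))" for m
    have c0: "0 \<le> c m" for m by (simp add: c_def)
    have c: "2 * k * (time_mean k f m (uh m) + time_mean k gs m (\<lambda>x. uh m (x, 0))) \<le> c m + k / 2 * (grad_norm \<Omega> (uh m))\<^sup>2"
      if "m < M" for m
    proof -
      have "real (Suc m) * k \<le> T"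
        unfolding Mk[symmetric] using that k by (intro mult_right_mono) auto
      then show ?thesis
        unfolding c_def by (rule force_bound[OF assms(6,7) k _ Xh(1,2) uhX[OF that] Xh(3)[OF uhX[OF that]]])
    qed
    define e where "e m = (L2_norm \<Omega> (\<lambda>q. u (Suc m) q - uh m q))\<^sup>2 + (L2_norm \<Omega> (\<lambda>q. uh m q - u m q))\<^sup>2
       + k * (grad_norm \<Omega> (u (Suc m)))\<^sup>2 + k / 2 * (grad_norm \<Omega> (uh m))\<^sup>2" for m
    have e0: "0 \<le> e m" for m using k by (simp add: e_def)
    have st: "(L2_norm \<Omega> (uh m))\<^sup>2 + (L2_norm \<Omega> (\<lambda>q. uh m q - u m q))\<^sup>2 \<le> (L2_norm \<Omega> (u m))\<^sup>2 + c m"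
      "(L2_norm \<Omega> (u (Suc m)))\<^sup>2 + e m \<le> (L2_norm \<Omega> (u m))\<^sup>2 + c m" if "m < M" for m
      unfolding e_def
      using energy_step[OF Xh Yh k uX s0 s1 s2 c, of m] that by auto
    have ia: "integrable (lebesgue_on {0..T}) ?a" "integrable (lebesgue_on {0..T}) ?b"
      using assms(6,7) by (auto simp: L2_time_dual_def)
    have csum: "(\<Sum>m<M. c m) = 4 * ((LINT t|lebesgue_on {0..T}. ?a t) + trace_const\<^sup>2 * (LINT t|lebesgue_on {0..T}. ?b t))"
      unfolding c_def sum_distrib_left[symmetric] sum.distrib
      using sum_time_intervals[OF ia(1) k, of M] sum_time_intervals[OF ia(2) k, of M] Mk by simp
    have "0 \<le> B" using B[OF h] L2_norm_nonneg[of \<Omega> "u0h h"] by linarith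
    then have B2: "(L2_norm \<Omega> (u 0))\<^sup>2 \<le> B\<^sup>2" unfolding u00 by (intro power_mono B h) simp
    have total: "(L2_norm \<Omega> (u n))\<^sup>2 + (\<Sum>m<n. e m) \<le> (L2_norm \<Omega> (u 0))\<^sup>2 + (\<Sum>m<n. c m)" if "n \<le> M" for n
      by (rule energy_sum[of M "\<lambda>n. (L2_norm \<Omega> (u n))\<^sup>2", OF st(2) that])
    have part: "(\<Sum>m<n. c m) \<le> (\<Sum>m<M. c m)" if "n \<le> M" for n
      using c0 that by (intro sum_mono2) auto
    have R: "(L2_norm \<Omega> (u n))\<^sup>2 + (\<Sum>m<n. e m) \<le> r\<^sup>2" if "n \<le> M" for n
      using total[OF that] part[OF that] B2 unfolding r2 csum by simp
    have un: "L2_norm \<Omega> (u n) \<le> r" if "n \<le> M" for n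
    proof (rule power2_le_imp_le[OF _ r0])
      show "(L2_norm \<Omega> (u n))\<^sup>2 \<le> r\<^sup>2" using R[OF that] sum_nonneg[of "{..<n}" e] e0 by fastforce
    qed
    \<comment> \<open>The bound for \<open>uh m\<close> spends the data term of step
      \<open>m\<close> on top of those before it, so the partial sum up to \<open>Suc m\<close> is
      compared with the full one.\<close>
    have uhn: "L2_norm \<Omega> (uh m) \<le> r" if "m < M" for m
    proof (rule power2_le_imp_le[OF _ r0])
      have "(L2_norm \<Omega> (u m))\<^sup>2 \<le> (L2_norm \<Omega> (u 0))\<^sup>2 + (\<Sum>m<m. c m)"
        using total[of m] that sum_nonneg[of "{..<m}" e] e0 by fastforce
      moreover have "(\<Sum>m<m. c m) + c m \<le> (\<Sum>m<M. c m)" using part[of "Suc m"] that by simp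
      moreover have "(L2_norm \<Omega> (uh m))\<^sup>2 \<le> (L2_norm \<Omega> (u m))\<^sup>2 + c m"
        using st(1)[OF that] zero_le_power2[of "L2_norm \<Omega> (\<lambda>q. uh m q - u m q)"] by linarith
      ultimately show "(L2_norm \<Omega> (uh m))\<^sup>2 \<le> r\<^sup>2" using B2 unfolding r2 csum by simp
    qed
    have es: "(\<Sum>m<M. e m) \<le> r\<^sup>2" using R[of M] zero_le_power2[of "L2_norm \<Omega> (u M)"] by linarith
    have esum: "(\<Sum>m<M. (L2_norm \<Omega> (\<lambda>q. u (Suc m) q - uh m q))\<^sup>2) + (\<Sum>m<M. (L2_norm \<Omega> (\<lambda>q. uh m q - u m q))\<^sup>2)
       + k * (\<Sum>m<M. (grad_norm \<Omega> (u (Suc m)))\<^sup>2) + k / 2 * (\<Sum>m<M. (grad_norm \<Omega> (uh m))\<^sup>2) \<le> r\<^sup>2"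
      using es by (simp add: e_def sum.distrib sum_distrib_left)
    have nn: "0 \<le> (\<Sum>m<M. (L2_norm \<Omega> (\<lambda>q. u (Suc m) q - uh m q))\<^sup>2)" "0 \<le> (\<Sum>m<M. (L2_norm \<Omega> (\<lambda>q. uh m q - u m q))\<^sup>2)"
       "0 \<le> k * (\<Sum>m<M. (grad_norm \<Omega> (u (Suc m)))\<^sup>2)" "0 \<le> k / 2 * (\<Sum>m<M. (grad_norm \<Omega> (uh m))\<^sup>2)"
      using k by (auto intro!: sum_nonneg mult_nonneg_nonneg)
    have n1: "linf_norm M (L2_norm \<Omega>) (\<lambda>m. u (Suc m)) \<le> r"
      by (rule linf_norm_le[OF M]) (use un in simp)
    have n2: "linf_norm M (L2_norm \<Omega>) uh \<le> r"
      by (rule linf_norm_le[OF M]) (use uhn in simp)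
    have gsum: "k * (\<Sum>m<M. (grad_norm \<Omega> (u (Suc m)))\<^sup>2) \<le> r\<^sup>2" using esum nn by linarith
    then have n3: "l2_norm k M (grad_norm \<Omega>) (\<lambda>m. u (Suc m)) \<le> r"
      by (intro l2_norm_le r0) (use k in auto)
    have "k * (\<Sum>m<M. (grad_norm \<Omega> (uh m))\<^sup>2) \<le> 2 * r\<^sup>2" using esum nn by linarith
    \<comment> \<open>Only half the dissipation of \<open>uh\<close> was kept, which costs a factor
      2 in the square.\<close>
    also have "\<dots> \<le> (2 * r)\<^sup>2" by (simp add: power_mult_distrib)
    finally have n4: "l2_norm k M (grad_norm \<Omega>) uh \<le> 2 * r"
      by (intro l2_norm_le) (use k r0 in auto)
    \<comment> \<open>The squared increments are summed in the energy without a factor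
      \<open>k\<close>; the \<open>k\<close> in the discrete norm is therefore a gain and yields the
      rate \<open>sqrt k\<close>.\<close>
    have "k * (\<Sum>m<M. (L2_norm \<Omega> (\<lambda>q. u (Suc m) q - uh m q))\<^sup>2) \<le> k * r\<^sup>2"
      using esum nn k by (intro mult_left_mono) linarith+
    then have n5: "l2_norm k M (L2_norm \<Omega>) (\<lambda>m q. u (Suc m) q - uh m q) \<le> r * sqrt k"
      using k r0 by (intro l2_norm_le) (auto simp: power_mult_distrib mult.commute)
    have "k * (\<Sum>m<M. (L2_norm \<Omega> (\<lambda>q. uh m q - u m q))\<^sup>2) \<le> k * r\<^sup>2"
      using esum nn k by (intro mult_left_mono) linarith+
    then have n6: "l2_norm k M (L2_norm \<Omega>) (\<lambda>m q. uh m q - u m q) \<le> r * sqrt k"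
      using k r0 by (intro l2_norm_le) (auto simp: power_mult_distrib mult.commute)
    note vv = vertical_velocity_bound[OF subsetD[OF Xh(2) uX] Yh s0]
    have "k * (\<Sum>m<M. (H_dz_norm S D (u3 (Suc m)) + LinfL2_norm S D (u3 (Suc m)))\<^sup>2)
        \<le> k * (\<Sum>m<M. (E * grad_norm \<Omega> (u (Suc m)))\<^sup>2)"
      using k vv(2,3) unfolding E_def by (intro mult_left_mono sum_mono power_mono) auto
    also have "\<dots> = E\<^sup>2 * (k * (\<Sum>m<M. (grad_norm \<Omega> (u (Suc m)))\<^sup>2))"
      by (simp add: power_mult_distrib sum_distrib_left ac_simps)
    also have "\<dots> \<le> E\<^sup>2 * r\<^sup>2" by (rule mult_left_mono[OF gsum]) simp
    finally have n7: "l2_norm k M (\<lambda>v. H_dz_norm S D v + LinfL2_norm S D v) (\<lambda>m. u3 (Suc m)) \<le> E * r"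
      using k r0 E0 by (intro l2_norm_le) (auto simp: power_mult_distrib)
    have Er: "0 \<le> E * r" using E0 r0 by simp
    have "r * sqrt k + r * sqrt k \<le> ?C * sqrt k"
    proof -
      have "r + r \<le> ?C" using r0 Er by (simp add: distrib_right)
      then have "(r + r) * sqrt k \<le> ?C * sqrt k" using k by (intro mult_right_mono) auto
      then show ?thesis by (simp add: distrib_right)
    qed
    moreover have "\<forall>m<M. u3 (Suc m) \<in> LinfL2 S D" using vv(1) by auto
    ultimately show ?thesis
      using n1 n2 n3 n4 n5 n6 n7 r0 Er by (simp add: distrib_right)
  qed
  ultimately show ?thesis by blast
qed

end
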